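(* Let $(V_k)_{k\ge1}$ be random variables with values in $[0,1]$ (not necessarily independent) with $\sum_{k}V_k<\infty$ almost surely, and let $\lambda$ be a non-negative random variable, with an arbitrary joint law with $(V_k)_{k\ge1}$. One obtains an exchangeable feature allocation of $\mathbb{N}$ by generating a feature allocation from the feature frequency model with frequencies $(V_k)_{k\ge 1}$ and then, for each index $n$, including an independent $\mathrm{Poisson}(\lambda)$-distributed number of features of the form $\{n\}$ in addition to the features previously generated (which may also include index $n$). Every feature allocation of this type has an exchangeable feature probability function (EFPF). Conversely, every feature allocation of $\mathbb{N}$ with an EFPF has the same distribution as one generated by this construction for some joint distribution of $\lambda$ and the feature frequencies $(V_k)_{k\ge1}$.
   Context: Let $[N]=\{1,\dots,N\}$. Feature allocation: a feature allocation of $[N]$ (or of $\mathbb{N}$) is a multiset of non-empty subsets of $[N]$ (resp. $\mathbb{N}$), called features, such that no index $n$ belongs to infinitely many features (counted with multiplicity). The empty multiset is allowed. For $M<N$, the restriction of a feature allocation $f_N$ of $[N]$ to $[M]$ is the multiset $\{A\cap[M]: A\in f_N,\ A\cap[M]\ne\emptyset\}$ (with multiplicities). Random feature allocation: a random feature allocation of $[N]$ is a random element of the (countable) set of feature allocations of $[N]$. A random feature allocation $F_\infty$ of $\mathbb{N}$ is a sequence $(F_n)_{n\ge1}$ of random feature allocations, $F_n$ of $[n]$, that is consistent: for all $M<N$, almost surely $F_M$ is the restriction of $F_N$ to $[M]$. Such a sequence is identified with the corresponding random multiset of subsets of $\mathbb{N}$; its distribution is its law on the $\sigma$-field generated by all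 $F_n$. Exchangeability: for a permutation $\sigma$ of the indices, $\sigma(A)=\{\sigma(n):n\in A\}$ and $\sigma$ acts on a feature allocation by acting on each of its features. $F_\infty$ is exchangeable if for every $N$ and every permutation $\sigma$ of $[N]$, $F_N$ and $\sigma(F_N)$ have the same distribution. EFPF: let $\tilde F_N$ be the random ordered feature allocation obtained by putting the features of $F_N$ in a uniformly random order. Thus, if $f_N$ has $K$ features whose distinct elements have multiplicities $\kappa_1,\dots,\kappa_H$, then for every ordering $\tilde f_N=(A_1,\dots,A_K)$ of $f_N$, $P(\tilde F_N=\tilde f_N)=\left(\frac{K!}{\kappa_1!\cdots\kappa_H!}\right)^{-1}P(F_N=f_N)$. The feature allocation $F_\infty$ has an exchangeable feature probability function (EFPF) if there is a function $p$, symmetric in all arguments after the first, such that for every $N$ and every ordered feature allocation $(A_1,\dots,A_K)$ of $[N]$, $P(\tilde F_N=(A_1,\dots,A_K))=p(N,|A_1|,\dots,|A_K|)$. Feature frequency model: given the frequencies $(V_k)_{k\ge1}$, for each index $n\in\mathbb{N}$ and each $k$ make a Bernoulli draw with success probability $V_k$, all draws being conditionally independent given $(V_k)$; index $n$ belongs to the feature indexed by $k$ iff the $(n,k)$ draw is a success. The feature allocation is the multiset of the resulting non-empty sets of indices, one for each $k$ whose set is non-empty. In the construction with added singletons, conditionally on $\lambda$ and $(V_k)$ the Poisson$(\lambda)$ counts for the different indices $n$ are independent of each other and of the Bernoulli draws. *)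

theory Defs
  imports "HOL-Probability.Probability" "HOL-Combinatorics.Combinatorics"
begin

section \<open>Feature allocations\<close>

text \<open>
  Since features are non-empty subsets of the finite set \<open>{1..N}\<close>, the requirement that no index
  lies in infinitely many features says exactly that the multiset of features is finite.
\<close>

definition feature_allocs :: "nat \<Rightarrow> nat set multiset set" where
  "feature_allocs N = {f. \<forall>A \<in># f. A \<noteq> {} \<and> A \<subseteq> {1..N}}"

definition restrict_alloc :: "nat \<Rightarrow> nat set multiset \<Rightarrow> nat set multiset" where
  "restrict_alloc m f = filter_mset (\<lambda>A. A \<noteq> {}) (image_mset (\<lambda>A. A \<inter> {1..m}) f)"

abbreviation alloc_space :: "nat \<Rightarrow> nat set multiset measure" where
  "alloc_space N \<equiv> count_space (feature_allocs N)"

text \<open>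
  A random feature allocation of the positive integers is a consistent sequence \<open>F 1, F 2, \<dots>\<close>;
  the value \<open>F 0\<close> is irrelevant throughout.
\<close>

definition random_feature_allocation :: "'w measure \<Rightarrow> (nat \<Rightarrow> 'w \<Rightarrow> nat set multiset) \<Rightarrow> bool" where
  "random_feature_allocation M F \<longleftrightarrow>
     prob_space M \<and>
     (\<forall>N\<ge>1. F N \<in> M \<rightarrow>\<^sub>M alloc_space N) \<and>
     (\<forall>m\<ge>1. \<forall>N>m. AE \<omega> in M. F m \<omega> = restrict_alloc m (F N \<omega>))"

definition alloc_law ::
    "'w measure \<Rightarrow> (nat \<Rightarrow> 'w \<Rightarrow> nat set multiset) \<Rightarrow> (nat \<Rightarrow> nat set multiset) measure" where
  "alloc_law M F = distr M (PiM {1..} alloc_space) (\<lambda>\<omega>. \<lambda>N\<in>{1..}. F N \<omega>)"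

definition exchangeable_alloc :: "'w measure \<Rightarrow> (nat \<Rightarrow> 'w \<Rightarrow> nat set multiset) \<Rightarrow> bool" where
  "exchangeable_alloc M F \<longleftrightarrow>
     (\<forall>N\<ge>1. \<forall>\<sigma>. \<sigma> permutes {1..N} \<longrightarrow>
        distr M (alloc_space N) (F N) =
        distr M (alloc_space N) (\<lambda>\<omega>. image_mset (\<lambda>A. \<sigma> ` A) (F N \<omega>)))"

section \<open>Exchangeable feature probability functions\<close>

text \<open>
  The law of the ordered feature allocation: given \<open>F N\<close>, its features are put in a uniformly
  random order, i.e. a list is drawn uniformly from the distinct lists having \<open>F N\<close> as their
  multiset of entries.
\<close>

definition ordered_alloc_law ::
    "'w measure \<Rightarrow> (nat \<Rightarrow> 'w \<Rightarrow> nat set multiset) \<Rightarrow> nat \<Rightarrow> nat set list measure" where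
  "ordered_alloc_law M F N =
     distr M (alloc_space N) (F N) \<bind>
       (\<lambda>f. measure_pmf (pmf_of_set (permutations_of_multiset f)))"

definition has_EFPF :: "'w measure \<Rightarrow> (nat \<Rightarrow> 'w \<Rightarrow> nat set multiset) \<Rightarrow> bool" where
  "has_EFPF M F \<longleftrightarrow>
     (\<exists>p :: nat \<Rightarrow> nat list \<Rightarrow> real.
        (\<forall>N ks ks'. mset ks = mset ks' \<longrightarrow> p N ks = p N ks') \<and>
        (\<forall>N\<ge>1. \<forall>As. mset As \<in> feature_allocs N \<longrightarrow>
           measure (ordered_alloc_law M F N) {As} = p N (map card As)))"

lemma measure_ordered_alloc_law:
  assumes M: "prob_space M" and F: "F N \<in> M \<rightarrow>\<^sub>M alloc_space N"
    and As: "mset As \<in> feature_allocs N"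
  shows "measure (ordered_alloc_law M F N) {As} =
    inverse (fact (length As) / (\<Prod>A\<in>set As. fact (count (mset As) A))) *
    measure M {\<omega> \<in> space M. F N \<omega> = mset As}"
proof -
  interpret prob_space M by fact
  let ?P = "permutations_of_multiset :: nat set multiset \<Rightarrow> _"
  let ?Q = "\<lambda>f. measure_pmf (pmf_of_set (?P f))"
  let ?D = "distr M (alloc_space N) (F N)"
  interpret D: prob_space ?D by (rule prob_space_distr[OF F])
  have Q: "?Q \<in> ?D \<rightarrow>\<^sub>M subprob_algebra (count_space UNIV)"
    by (auto simp: space_subprob_algebra intro: prob_space_imp_subprob_space
        measure_pmf.prob_space_axioms)
  have fin: "finite (?P f)" "?P f \<noteq> {}" for f
    by (auto simp: permutations_of_multiset_not_empty)
  have pm: "emeasure (?Q f) {As} =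
      ennreal (1 / card (?P (mset As))) * indicator {mset As} f" for f
  proof -
    have "emeasure (?Q f) {As} = ennreal (pmf (pmf_of_set (?P f)) As)"
      by (simp add: emeasure_pmf_single)
    also have "\<dots> = ennreal (indicator (?P f) As / card (?P f))"
      using fin[of f] by (simp add: pmf_of_set)
    finally show ?thesis
      by (auto simp: indicator_def permutations_of_multiset_def)
  qed
  have S: "{mset As} \<in> sets ?D" using As by simp
  have "emeasure (ordered_alloc_law M F N) {As} = (\<integral>\<^sup>+f. emeasure (?Q f) {As} \<partial>?D)"
    unfolding ordered_alloc_law_def
    by (rule emeasure_bind[OF _ Q]) (use S D.not_empty in auto)
  also have "\<dots> = ennreal (1 / card (?P (mset As))) * emeasure ?D {mset As}"
    unfolding pm using S by (subst nn_integral_cmult_indicator) auto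
  also have "emeasure ?D {mset As} = emeasure M {\<omega> \<in> space M. F N \<omega> = mset As}"
    using F As by (subst emeasure_distr) (auto intro!: arg_cong[where f = "emeasure M"])
  finally have "measure (ordered_alloc_law M F N) {As} =
      1 / card (?P (mset As)) * measure M {\<omega> \<in> space M. F N \<omega> = mset As}"
    by (simp add: measure_def enn2real_mult)
  moreover have "real (card (?P (mset As))) =
      fact (length As) / (\<Prod>A\<in>set As. fact (count (mset As) A))"
  proof -
    have "card (?P (mset As)) * (\<Prod>A\<in>set As. fact (count (mset As) A)) = fact (length As)"
      using card_permutations_of_multiset_aux[of "mset As"] by simp
    then have "real (card (?P (mset As))) * (\<Prod>A\<in>set As. fact (count (mset As) A)) = fact (length As)"
      by (metis (mono_tags, lifting) of_nat_fact of_nat_mult of_nat_prod prod.cong)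
    then show ?thesis
      by (simp add: field_simps)
  qed
  ultimately show ?thesis by (simp add: field_simps)
qed

section \<open>Feature frequency model with added singletons\<close>

text \<open>\<open>poisson_pmf\<close> is only specified for positive rates; rate zero is the point mass at zero.\<close>

definition poisson_law :: "real \<Rightarrow> nat pmf" where
  "poisson_law l = (if l = 0 then return_pmf 0 else poisson_pmf l)"

lemma pmf_poisson_law: "0 \<le> l \<Longrightarrow> pmf (poisson_law l) n = l ^ n / fact n * exp (- l)"
  by (auto simp: poisson_law_def indicator_def)

text \<open>
  \<open>V k \<omega>\<close> is the frequency of feature \<open>k\<close> (features are labelled from zero) and \<open>L \<omega>\<close> is the
  Poisson rate.
\<close>

abbreviation param_space :: "((nat \<Rightarrow> real) \<times> real) measure" where
  "param_space \<equiv> PiM UNIV (\<lambda>_. borel) \<Otimes>\<^sub>M borel"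

abbreviation params ::
    "(nat \<Rightarrow> 'w \<Rightarrow> real) \<Rightarrow> ('w \<Rightarrow> real) \<Rightarrow> 'w \<Rightarrow> (nat \<Rightarrow> real) \<times> real" where
  "params V L \<omega> \<equiv> (\<lambda>k. V k \<omega>, L \<omega>)"

definition random_params :: "'w measure \<Rightarrow> (nat \<Rightarrow> 'w \<Rightarrow> real) \<Rightarrow> ('w \<Rightarrow> real) \<Rightarrow> bool" where
  "random_params M V L \<longleftrightarrow>
     prob_space M \<and>
     (\<forall>k. V k \<in> borel_measurable M) \<and>
     (\<forall>k. \<forall>\<omega>\<in>space M. 0 \<le> V k \<omega> \<and> V k \<omega> \<le> 1) \<and>
     (AE \<omega> in M. summable (\<lambda>k. V k \<omega>)) \<and>
     L \<in> borel_measurable M \<and>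
     (\<forall>\<omega>\<in>space M. 0 \<le> L \<omega>)"

text \<open>
  \<open>B n k\<close> is the Bernoulli draw for index \<open>n\<close> and feature \<open>k\<close>, and \<open>Y n\<close> is the number of added
  singletons \<open>{n}\<close>. Given the \<open>\<sigma>\<close>-field generated by all the frequencies and the rate, every
  finite family of draws has the product of the Bernoulli and Poisson masses as its joint mass
  function, i.e. all draws are conditionally independent with these conditional laws.
\<close>

definition conditional_draws ::
    "'w measure \<Rightarrow> (nat \<Rightarrow> 'w \<Rightarrow> real) \<Rightarrow> ('w \<Rightarrow> real) \<Rightarrow>
     (nat \<Rightarrow> nat \<Rightarrow> 'w \<Rightarrow> bool) \<Rightarrow> (nat \<Rightarrow> 'w \<Rightarrow> nat) \<Rightarrow> bool" where
  "conditional_draws M V L B Y \<longleftrightarrow>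
     (\<forall>n\<ge>1. \<forall>k. B n k \<in> M \<rightarrow>\<^sub>M count_space UNIV) \<and>
     (\<forall>n\<ge>1. Y n \<in> M \<rightarrow>\<^sub>M count_space UNIV) \<and>
     (\<forall>I J b y. finite I \<and> I \<subseteq> {1..} \<times> UNIV \<and> finite J \<and> J \<subseteq> {1..} \<longrightarrow>
        (AE \<omega> in M.
           real_cond_exp M (vimage_algebra (space M) (params V L) param_space)
             (indicator {\<omega>' \<in> space M. (\<forall>(n, k)\<in>I. B n k \<omega>' = b n k) \<and> (\<forall>n\<in>J. Y n \<omega>' = y n)}) \<omega> =
           (\<Prod>(n, k)\<in>I. pmf (bernoulli_pmf (V k \<omega>)) (b n k)) *
           (\<Prod>n\<in>J. pmf (poisson_law (L \<omega>)) (y n))))"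

text \<open>
  The restriction to \<open>{1..N}\<close> of the generated multiset of features. By summability of the
  frequencies, almost surely only finitely many \<open>k\<close> have a non-empty trace on \<open>{1..N}\<close>; on the
  exceptional null set \<open>mset_set\<close> returns the empty multiset.
\<close>

definition feature_set :: "(nat \<Rightarrow> nat \<Rightarrow> 'w \<Rightarrow> bool) \<Rightarrow> nat \<Rightarrow> 'w \<Rightarrow> nat set" where
  "feature_set B k \<omega> = {n. 1 \<le> n \<and> B n k \<omega>}"

definition generated_alloc ::
    "(nat \<Rightarrow> nat \<Rightarrow> 'w \<Rightarrow> bool) \<Rightarrow> (nat \<Rightarrow> 'w \<Rightarrow> nat) \<Rightarrow> nat \<Rightarrow> 'w \<Rightarrow> nat set multiset" where
  "generated_alloc B Y N \<omega> =
     image_mset (\<lambda>k. feature_set B k \<omega> \<inter> {1..N})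
       (mset_set {k. feature_set B k \<omega> \<inter> {1..N} \<noteq> {}}) +
     (\<Sum>n\<in>{1..N}. replicate_mset (Y n \<omega>) {n})"

end

theory Submission
  imports Defs
begin

text \<open>
  Write \<open>E \<Prod>\<^sub>A t A\<close> for the probability generating function of \<open>F N\<close>, where \<open>t\<close> weights the subsets
  of \<open>{1..N}\<close>. Having an EFPF means that this generating function does not change when \<open>t\<close> is averaged
  over the subsets of each size. For the feature frequency model with added singletons it is the
  expectation of a product over the frequencies times a Poisson factor, both depending on \<open>t\<close> only
  through its sums over the subsets of a given size; hence the EFPF, and hence exchangeability.

  Conversely, an EFPF makes \<open>F m\<close> the trace of independent uniform subsets of \<open>{1..N}\<close> with the sizes of the
  features of \<open>F N\<close>. The sum of the \<open>r\<close> largest relative sizes and \<open>exp\<close> of minus the sum of all of them are bounded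
  reverse submartingales, so they converge in \<open>L\<^sup>2\<close> and almost surely along a subsequence. The
  increments of the limits of the former are the frequencies, the mass lost in the limit is the Poisson rate,
  and the generating functions converge to that of the model.
\<close>

section \<open>Uniqueness of generating functions of random multisets\<close>

text \<open>For the converse, no conditional law of the allocation given its frequencies is
  computed. Only generating functions are compared; they determine the law because polynomials and
  power series that vanish for all weights in [0,1] have zero coefficients.

  Sums of the \<open>r\<close> largest sizes are used because a single ranked size satisfies no
  averaging inequality in general, whereas the best choice of at most \<open>r\<close> features is a
  maximum. The total relative size may have infinite expectation; \<open>exp\<close> of its negative
  is bounded and convex, at the price of excluding separately that the total tends to infinity. This
  exclusion rests on index 1 lying in finitely many features.

  A subsequence suffices, because the sampling identity holds for every \<open>N\<close> from
  \<open>m\<close> on and its left side does not depend on \<open>N\<close>. The lost mass turns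
  into singletons because it sits in features of vanishing relative size, and up to second order
  such a feature meets a fixed finite index set in at most one point.\<close>

definition msets_of_size :: "'b set \<Rightarrow> nat \<Rightarrow> 'b multiset set" where
  "msets_of_size S n = {f. set_mset f \<subseteq> S \<and> size f = n}"

lemma finite_msets_of_size:
  assumes "finite S"
  shows "finite (msets_of_size S n)"
proof -
  from assms have "finite (mset ` {xs. set xs \<subseteq> S \<and> length xs = n})"
    by (intro finite_imageI finite_lists_length_eq)
  moreover have "msets_of_size S n \<subseteq> mset ` {xs. set xs \<subseteq> S \<and> length xs = n}"
  proof
    fix f assume f: "f \<in> msets_of_size S n"
    obtain xs where "mset xs = f" using ex_mset by blast
    with f show "f \<in> mset ` {xs. set xs \<subseteq> S \<and> length xs = n}"
      by (auto simp: msets_of_size_def intro!: image_eqI[of _ _ xs])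
  qed
  ultimately show ?thesis using finite_subset by blast
qed

text \<open>Induction on the number of variables: sorting the monomials by the multiplicity of
  \<open>x\<close> gives a polynomial in \<open>t x\<close> that has all of [0,1] among its roots.
  Its coefficients therefore vanish, and they are homogeneous polynomials in the remaining
  variables.\<close>

lemma homogeneous_polynomial_zero:
  fixes a :: "'b multiset \<Rightarrow> real"
  assumes "finite S"
    and "\<And>t. \<forall>x. 0 \<le> t x \<and> t x \<le> 1 \<Longrightarrow> (\<Sum>f\<in>msets_of_size S n. a f * (\<Prod>x\<in>#f. t x)) = 0"
    and "f \<in> msets_of_size S n"
  shows "a f = 0"
  using assms
proof (induction S arbitrary: n a f rule: finite_induct)
  case empty
  then have "f = {#}" "n = 0" by (auto simp: msets_of_size_def)
  moreover have "msets_of_size ({} :: 'b set) 0 = {{#}}" by (auto simp: msets_of_size_def)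
  ultimately show ?case using empty(1)[of "\<lambda>_. 0"] by simp
next
  case (insert x S)
  \<comment> \<open>\<open>c t k\<close> is the coefficient of the \<open>k\<close>-th power of
    \<open>t x\<close>, homogeneous of degree \<open>n - k\<close> in the variables of
    \<open>S\<close>.\<close>
  define c where "c t k = (\<Sum>g\<in>msets_of_size S (n - k). a (g + replicate_mset k x) * (\<Prod>y\<in>#g. t y))" for t k
  let ?h = "\<lambda>(k, g). g + replicate_mset k x"
  have bij: "bij_betw ?h (SIGMA k:{..n}. msets_of_size S (n - k)) (msets_of_size (insert x S) n)"
  proof (rule bij_betw_byWitness[where f' = "\<lambda>f. (count f x, filter_mset (\<lambda>y. y \<noteq> x) f)"])
    show "\<forall>p\<in>(SIGMA k:{..n}. msets_of_size S (n - k)). (count (?h p) x, filter_mset (\<lambda>y. y \<noteq> x) (?h p)) = p"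
    proof (rule ballI)
      fix p assume "p \<in> (SIGMA k:{..n}. msets_of_size S (n - k))"
      then obtain k g where p: "p = (k, g)" "g \<in> msets_of_size S (n - k)" by auto
      then have "x \<notin># g" using insert.hyps by (auto simp: msets_of_size_def)
      then show "(count (?h p) x, filter_mset (\<lambda>y. y \<noteq> x) (?h p)) = p"
        by (auto simp: p not_in_iff intro!: multiset_eqI)
    qed
    show *: "\<forall>f\<in>msets_of_size (insert x S) n. ?h (count f x, filter_mset (\<lambda>y. y \<noteq> x) f) = f"
      by (auto intro!: multiset_eqI)
    show "?h ` (SIGMA k:{..n}. msets_of_size S (n - k)) \<subseteq> msets_of_size (insert x S) n"
      by (auto simp: msets_of_size_def split: if_splits)
    show "(\<lambda>f. (count f x, filter_mset (\<lambda>y. y \<noteq> x) f)) ` msets_of_size (insert x S) n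
        \<subseteq> (SIGMA k:{..n}. msets_of_size S (n - k))"
    proof (rule image_subsetI)
      fix f assume f: "f \<in> msets_of_size (insert x S) n"
      have "size (filter_mset (\<lambda>y. y \<noteq> x) f) + count f x = size f"
        using arg_cong[OF *[rule_format, OF f], of size] by simp
      with f show "(count f x, filter_mset (\<lambda>y. y \<noteq> x) f) \<in> (SIGMA k:{..n}. msets_of_size S (n - k))"
        by (auto simp: msets_of_size_def)
    qed
  qed
  have split: "(\<Sum>f\<in>msets_of_size (insert x S) n. a f * (\<Prod>y\<in>#f. t y)) = (\<Sum>k\<le>n. c t k * t x ^ k)" for t
    unfolding sum.reindex_bij_betw[OF bij, symmetric] c_def sum_distrib_right
    by (subst sum.Sigma) (auto simp: insert.hyps finite_msets_of_size intro!: sum.cong)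
  have c0: "c t k = 0" if t: "\<forall>y. 0 \<le> t y \<and> t y \<le> 1" and k: "k \<le> n" for t k
  proof (rule ccontr)
    assume "c t k \<noteq> 0"
    then have fin: "finite {z. (\<Sum>k\<le>n. c t k * z ^ k) = 0}"
      by (intro polyfun_roots_finite[of _ k]) (use k in auto)
    have "{0..1} \<subseteq> {z. (\<Sum>k\<le>n. c t k * z ^ k) = 0}"
    proof
      fix z :: real assume z: "z \<in> {0..1}"
      \<comment> \<open>The coefficients do not see \<open>t x\<close>, since \<open>x\<close> is
        not in \<open>S\<close>; so \<open>t x\<close> can run through [0,1] while they stay
        fixed.\<close>
      let ?t = "t(x := z)"
      have "c ?t = c t" unfolding c_def
        by (intro ext sum.cong refl arg_cong2[where f = "(*)"] arg_cong[where f = prod_mset] image_mset_cong)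
          (use insert.hyps in \<open>auto simp: msets_of_size_def\<close>)
      moreover have "(\<Sum>k\<le>n. c ?t k * ?t x ^ k) = 0"
        using split[of ?t] insert.prems(1)[of ?t] t z by auto
      ultimately show "z \<in> {z. (\<Sum>k\<le>n. c t k * z ^ k) = 0}" by simp
    qed
    with fin have "finite {0..1::real}" using finite_subset by blast
    then show False by (simp add: infinite_Icc)
  qed
  from insert.prems(2) have "f \<in> ?h ` (SIGMA k:{..n}. msets_of_size S (n - k))"
    by (simp only: bij_betw_imp_surj_on[OF bij])
  then obtain k g where f: "f = g + replicate_mset k x" "k \<le> n" "g \<in> msets_of_size S (n - k)"
    by auto
  show ?case unfolding f(1)
    by (rule insert.IH[of "\<lambda>g. a (g + replicate_mset k x)" "n - k"]) (use c0 f in \<open>auto simp: c_def\<close>)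
qed

lemma sum_lists_by_mset:
  fixes g :: "'b multiset \<Rightarrow> real"
  assumes S: "finite S"
  shows "(\<Sum>xs | set xs \<subseteq> S \<and> length xs = n. g (mset xs)) =
    (\<Sum>f\<in>msets_of_size S n. card (permutations_of_multiset f) * g f)"
proof -
  let ?L = "{xs. set xs \<subseteq> S \<and> length xs = n}"
  have "(\<Sum>xs\<in>?L. g (mset xs)) = (\<Sum>f\<in>msets_of_size S n. \<Sum>xs | xs \<in> ?L \<and> mset xs = f. g (mset xs))"
    by (rule sum.group[symmetric])
      (use S in \<open>auto simp: finite_lists_length_eq finite_msets_of_size\<close>, auto simp: msets_of_size_def)
  also have "\<dots> = (\<Sum>f\<in>msets_of_size S n. card (permutations_of_multiset f) * g f)"
  proof (rule sum.cong[OF refl])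
    fix f assume "f \<in> msets_of_size S n"
    then have "{xs \<in> ?L. mset xs = f} = permutations_of_multiset f"
      by (auto simp: permutations_of_multiset_def msets_of_size_def)
    then show "(\<Sum>xs | xs \<in> ?L \<and> mset xs = f. g (mset xs)) = card (permutations_of_multiset f) * g f"
      by (simp add: permutations_of_multiset_def)
  qed
  finally show ?thesis .
qed

lemma sum_lists_fibre:
  fixes t :: "'b \<Rightarrow> real"
  assumes S: "finite S"
  shows "(\<Sum>xs | set xs \<subseteq> S \<and> map c xs = ks. \<Prod>x\<leftarrow>xs. t x) = (\<Prod>k\<leftarrow>ks. \<Sum>x | x \<in> S \<and> c x = k. t x)"
proof (induction ks)
  case Nil
  have "{xs. set xs \<subseteq> S \<and> xs = []} = {[]}" by auto
  then show ?case by simp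
next
  case (Cons k ks)
  let ?L = "{xs. set xs \<subseteq> S \<and> map c xs = ks}"
  have fin: "finite ?L"
    by (rule finite_subset[OF _ finite_lists_length_eq[OF S, of "length ks"]]) auto
  have "{xs. set xs \<subseteq> S \<and> map c xs = k # ks} = (\<lambda>(x, xs). x # xs) ` ({x\<in>S. c x = k} \<times> ?L)"
    by (auto simp: map_eq_Cons_conv image_iff)
  then have "(\<Sum>xs | set xs \<subseteq> S \<and> map c xs = k # ks. \<Prod>x\<leftarrow>xs. t x) =
      (\<Sum>p\<in>{x\<in>S. c x = k} \<times> ?L. \<Prod>x\<leftarrow>(fst p # snd p). t x)"
    by (simp add: sum.reindex inj_on_def case_prod_beta)
  also have "\<dots> = (\<Sum>x | x \<in> S \<and> c x = k. t x) * (\<Sum>xs\<in>?L. \<Prod>x\<leftarrow>xs. t x)"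
    by (simp add: sum_product sum.cartesian_product case_prod_beta)
  finally show ?case by (simp add: Cons.IH)
qed

text \<open>Weighting a multiset by its number of orderings turns the sum into one over lists. For
  lists with prescribed types the product of weights factorises position by position, so
  \<open>t\<close> enters only through its class sums.\<close>

lemma sum_msets_by_type:
  fixes t :: "'b \<Rightarrow> real" and c :: "'b \<Rightarrow> 'c"
  assumes S: "finite S"
  shows "(\<Sum>f\<in>msets_of_size S n. card (permutations_of_multiset f) * (q (image_mset c f) * (\<Prod>x\<in>#f. t x))) =
    (\<Sum>\<kappa>\<in>msets_of_size (c ` S) n. card (permutations_of_multiset \<kappa>) *
       (q \<kappa> * (\<Prod>k\<in>#\<kappa>. \<Sum>x | x \<in> S \<and> c x = k. t x)))"
proof -
  let ?L = "{xs. set xs \<subseteq> S \<and> length xs = n}"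
  let ?K = "{ks. set ks \<subseteq> c ` S \<and> length ks = n}"
  have "(\<Sum>f\<in>msets_of_size S n. card (permutations_of_multiset f) * (q (image_mset c f) * (\<Prod>x\<in>#f. t x))) =
      (\<Sum>xs\<in>?L. q (mset (map c xs)) * (\<Prod>x\<leftarrow>xs. t x))"
    by (subst sum_lists_by_mset[OF S, symmetric]) (simp flip: prod_mset_prod_list)
  also have "\<dots> = (\<Sum>ks\<in>?K. \<Sum>xs | xs \<in> ?L \<and> map c xs = ks. q (mset (map c xs)) * (\<Prod>x\<leftarrow>xs. t x))"
    by (rule sum.group[symmetric]) (use S in \<open>auto simp: finite_lists_length_eq intro!: imageI\<close>)
  also have "\<dots> = (\<Sum>ks\<in>?K. q (mset ks) * (\<Prod>k\<leftarrow>ks. \<Sum>x | x \<in> S \<and> c x = k. t x))"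
  proof (rule sum.cong[OF refl])
    fix ks assume ks: "ks \<in> ?K"
    then have "{xs. xs \<in> ?L \<and> map c xs = ks} = {xs. set xs \<subseteq> S \<and> map c xs = ks}" by auto
    then show "(\<Sum>xs | xs \<in> ?L \<and> map c xs = ks. q (mset (map c xs)) * (\<Prod>x\<leftarrow>xs. t x)) =
        q (mset ks) * (\<Prod>k\<leftarrow>ks. \<Sum>x | x \<in> S \<and> c x = k. t x)"
      unfolding sum_lists_fibre[OF S, symmetric] sum_distrib_left by (auto intro!: sum.cong)
  qed
  also have "\<dots> = (\<Sum>\<kappa>\<in>msets_of_size (c ` S) n. card (permutations_of_multiset \<kappa>) *
       (q \<kappa> * (\<Prod>k\<in>#\<kappa>. \<Sum>x | x \<in> S \<and> c x = k. t x)))"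
    by (subst sum_lists_by_mset[symmetric]) (simp_all add: S flip: prod_mset_prod_list)
  finally show ?thesis .
qed

text \<open>Once the lower coefficients vanish, the series divided by \<open>z ^ n\<close> is 0 for
  small positive \<open>z\<close> and tends to \<open>d n\<close> as \<open>z\<close> decreases to
  0. Nothing is known for negative \<open>z\<close>, hence the one-sided limit.\<close>

lemma power_series_zero_unique:
  fixes d :: "nat \<Rightarrow> real"
  assumes sums: "\<And>z. 0 \<le> z \<Longrightarrow> z \<le> 1 \<Longrightarrow> (\<lambda>n. d n * z ^ n) sums 0"
  shows "d n = 0"
proof (induction n rule: less_induct)
  case (less n)
  define f where "f z = (\<Sum>k. d (k + n) * z ^ k)" for z
  have "summable (\<lambda>k. d k * 1 ^ k)"
    by (rule sums_summable[OF sums[of 1]]) auto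
  then have "summable d" by (simp only: power_one mult_1_right)
  then have "summable (\<lambda>k. d (k + n))"
    by (rule summable_iff_shift[THEN iffD2])
  then have sm: "summable (\<lambda>k. d (k + n) * 1 ^ k)"
    by (simp only: power_one mult_1_right)
  have "summable (\<lambda>k. d (k + n) * z ^ k)" if "norm z < 1" for z :: real
    by (rule powser_inside[OF sm]) (use that in simp)
  then have "(f \<longlongrightarrow> d (0 + n)) (at 0)"
    unfolding f_def by (intro powser_limit_0_strong[of 1]) (auto simp: summable_sums)
  then have "(f \<longlongrightarrow> d n) (at_right 0)"
    by (simp add: filterlim_at_split)
  moreover have "f z = 0" if z: "0 < z" "z < 1" for z
  proof -
    have "(\<lambda>k. d (k + n) * z ^ (k + n)) sums (0 - (\<Sum>k<n. d k * z ^ k))"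
      using sums[of z] z by (intro sums_iff_shift[THEN iffD2]) auto
    then have "(\<lambda>k. d (k + n) * z ^ k * z ^ n) sums 0"
      using less.IH by (simp add: power_add mult_ac)
    then have "(\<lambda>k. d (k + n) * z ^ k) sums 0"
      using sums_mult2_iff[of "z ^ n" "\<lambda>k. d (k + n) * z ^ k" 0] z by simp
    then show ?thesis unfolding f_def by (simp add: sums_iff)
  qed
  then have "eventually (\<lambda>z. f z = 0) (at_right 0)"
    unfolding eventually_at_right_field by (intro exI[of _ 1]) auto
  then have "(f \<longlongrightarrow> 0) (at_right 0)"
    by (rule tendsto_eventually)
  ultimately show ?case
    using tendsto_unique[OF trivial_limit_at_right_real] by blast
qed

section \<open>Feature allocations as multisets over a finite set, and their generating
  functions\<close>

lemma finite_feature_types: "finite (Pow {1..N} - {{}} :: nat set set)"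
  by simp

lemma feature_allocs_alt: "feature_allocs N = {f. set_mset f \<subseteq> Pow {1..N} - {{}}}"
  by (auto simp: feature_allocs_def)

lemma countable_feature_allocs: "countable (feature_allocs N)"
proof -
  have "feature_allocs N \<subseteq> mset ` lists (Pow {1..N})"
  proof
    fix f assume f: "f \<in> feature_allocs N"
    obtain xs where xs: "f = mset xs" using ex_mset[of f] by metis
    from f have "\<forall>A\<in>set xs. A \<in> Pow {1..N}"
      unfolding xs feature_allocs_def by simp
    then have "xs \<in> lists (Pow {1..N})" by (simp only: in_lists_conv_set)
    then show "f \<in> mset ` lists (Pow {1..N})" unfolding xs by (rule imageI)
  qed
  moreover have "countable (mset ` lists (Pow {1..N}))"
    by (rule countable_image[OF countable_lists[OF countable_finite]]) simp
  ultimately show ?thesis using countable_subset by blast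
qed

lemma prod_mset_unit_interval:
  fixes t :: "'b \<Rightarrow> real"
  assumes "\<And>x. x \<in># f \<Longrightarrow> 0 \<le> t x \<and> t x \<le> 1"
  shows "0 \<le> (\<Prod>x\<in>#f. t x)" "(\<Prod>x\<in>#f. t x) \<le> 1"
  using assms by (induction f) (auto intro!: mult_le_one)

lemma prod_mset_scale: "(\<Prod>x\<in>#f. z * t x) = z ^ size f * (\<Prod>x\<in>#f. t x :: real)"
  by (induction f) (auto simp: mult_ac)

lemma measurable_mset_fun:
  assumes "F \<in> M \<rightarrow>\<^sub>M count_space X"
  shows "(\<lambda>\<omega>. h (F \<omega>) :: real) \<in> borel_measurable M"
  using measurable_compose[OF assms, of h borel] by simp

context prob_space
begin

lemma pgf_size_slice:
  fixes F :: "'a \<Rightarrow> 'b multiset" and t :: "'b \<Rightarrow> real"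
  assumes S: "finite S" and F: "F \<in> M \<rightarrow>\<^sub>M count_space {f. set_mset f \<subseteq> S}"
  shows "expectation (\<lambda>\<omega>. if size (F \<omega>) = n then \<Prod>x\<in>#F \<omega>. t x else 0) =
    (\<Sum>f\<in>msets_of_size S n. prob {\<omega>\<in>space M. F \<omega> = f} * (\<Prod>x\<in>#f. t x))"
proof -
  have meas: "{\<omega>\<in>space M. F \<omega> = f} \<in> events" if "f \<in> msets_of_size S n" for f
    using measurable_sets[OF F, of "{f}"] that
    by (auto simp: msets_of_size_def vimage_def Int_def conj_commute)
  have "expectation (\<lambda>\<omega>. if size (F \<omega>) = n then \<Prod>x\<in>#F \<omega>. t x else 0) =
      expectation (\<lambda>\<omega>. \<Sum>f\<in>msets_of_size S n. indicator {\<omega>\<in>space M. F \<omega> = f} \<omega> * (\<Prod>x\<in>#f. t x))"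
  proof (rule Bochner_Integration.integral_cong[OF refl])
    fix \<omega> assume w: "\<omega> \<in> space M"
    have "F \<omega> \<in> {f. set_mset f \<subseteq> S}" using measurable_space[OF F w] by simp
    moreover have "(\<Sum>f\<in>msets_of_size S n. indicator {\<omega>\<in>space M. F \<omega> = f} \<omega> * (\<Prod>x\<in>#f. t x)) =
        (\<Sum>f\<in>msets_of_size S n. if F \<omega> = f then \<Prod>x\<in>#f. t x else 0)"
      using w by (intro sum.cong) auto
    ultimately show "(if size (F \<omega>) = n then \<Prod>x\<in>#F \<omega>. t x else 0) =
        (\<Sum>f\<in>msets_of_size S n. indicator {\<omega>\<in>space M. F \<omega> = f} \<omega> * (\<Prod>x\<in>#f. t x))"
      using finite_msets_of_size[OF S, of n] by (auto simp: msets_of_size_def)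
  qed
  also have "\<dots> = (\<Sum>f\<in>msets_of_size S n. prob {\<omega>\<in>space M. F \<omega> = f} * (\<Prod>x\<in>#f. t x))"
    using meas by (subst Bochner_Integration.integral_sum) (auto intro!: integrable_mult_left integrable_real_indicator simp: less_top[symmetric])
  finally show ?thesis .
qed

text \<open>The factor \<open>z\<close> marks the size, which is unbounded, and so cuts the
  generating function into finite homogeneous slices. The products are at most 1, which gives
  dominated convergence for the truncation \<open>size (F \<omega>) < K\<close>.\<close>

lemma pgf_sums:
  fixes F :: "'a \<Rightarrow> 'b multiset" and t :: "'b \<Rightarrow> real"
  assumes S: "finite S" and F: "F \<in> M \<rightarrow>\<^sub>M count_space {f. set_mset f \<subseteq> S}"
    and t: "\<And>x. x \<in> S \<Longrightarrow> 0 \<le> t x \<and> t x \<le> 1" and z: "0 \<le> z" "z \<le> 1"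
  shows "(\<lambda>n. (\<Sum>f\<in>msets_of_size S n. prob {\<omega>\<in>space M. F \<omega> = f} * (\<Prod>x\<in>#f. t x)) * z ^ n)
    sums expectation (\<lambda>\<omega>. \<Prod>x\<in>#F \<omega>. z * t x)"
proof -
  have FS: "set_mset (F \<omega>) \<subseteq> S" if "\<omega> \<in> space M" for \<omega>
    using measurable_space[OF F that] by simp
  have b: "0 \<le> (\<Prod>x\<in>#F \<omega>. z * t x)" "(\<Prod>x\<in>#F \<omega>. z * t x) \<le> 1" if "\<omega> \<in> space M" for \<omega>
    using FS[OF that] t z by (auto intro!: prod_mset_unit_interval mult_le_one)
  have "(\<lambda>K. expectation (\<lambda>\<omega>. if size (F \<omega>) < K then \<Prod>x\<in>#F \<omega>. z * t x else 0))
      \<longlonglongrightarrow> expectation (\<lambda>\<omega>. \<Prod>x\<in>#F \<omega>. z * t x)"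
  proof (rule integral_dominated_convergence[where w = "\<lambda>_. 1"])
    show "AE \<omega> in M. (\<lambda>K. if size (F \<omega>) < K then \<Prod>x\<in>#F \<omega>. z * t x else 0) \<longlonglongrightarrow> (\<Prod>x\<in>#F \<omega>. z * t x)"
      by (intro AE_I2 tendsto_eventually eventually_mono[OF eventually_gt_at_top]) auto
    show "AE \<omega> in M. norm (if size (F \<omega>) < K then \<Prod>x\<in>#F \<omega>. z * t x else 0) \<le> 1" for K
      using b by (intro AE_I2) auto
  qed (auto intro!: measurable_mset_fun[OF F])
  moreover have "expectation (\<lambda>\<omega>. if size (F \<omega>) < K then \<Prod>x\<in>#F \<omega>. z * t x else 0) =
     (\<Sum>n<K. (\<Sum>f\<in>msets_of_size S n. prob {\<omega>\<in>space M. F \<omega> = f} * (\<Prod>x\<in>#f. t x)) * z ^ n)" for K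
  proof -
    have "expectation (\<lambda>\<omega>. if size (F \<omega>) < K then \<Prod>x\<in>#F \<omega>. z * t x else 0) =
      expectation (\<lambda>\<omega>. \<Sum>n<K. if size (F \<omega>) = n then \<Prod>x\<in>#F \<omega>. z * t x else 0)"
      by (intro Bochner_Integration.integral_cong) auto
    also have "\<dots> = (\<Sum>n<K. expectation (\<lambda>\<omega>. if size (F \<omega>) = n then \<Prod>x\<in>#F \<omega>. z * t x else 0))"
      using b by (intro Bochner_Integration.integral_sum integrable_const_bound[where B = 1] AE_I2)
        (auto intro!: measurable_mset_fun[OF F])
    also have "\<dots> = (\<Sum>n<K. (\<Sum>f\<in>msets_of_size S n. prob {\<omega>\<in>space M. F \<omega> = f} * (\<Prod>x\<in>#f. t x)) * z ^ n)"
      unfolding pgf_size_slice[OF S F] sum_distrib_right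
      by (intro sum.cong refl) (auto simp: prod_mset_scale msets_of_size_def)
    finally show ?thesis .
  qed
  ultimately show ?thesis by (simp add: sums_def)
qed

end

text \<open>Two weights are allowed because the EFPF criterion compares one random multiset at a
  weight and at its average. Varying \<open>z\<close> separates the sizes.\<close>

lemma pgf_slice_unique:
  fixes F :: "'a \<Rightarrow> 'b multiset" and F' :: "'c \<Rightarrow> 'b multiset" and t t' :: "'b \<Rightarrow> real"
  assumes M: "prob_space M" and M': "prob_space M'"
    and S: "finite S" and F: "F \<in> M \<rightarrow>\<^sub>M count_space {f. set_mset f \<subseteq> S}"
    and F': "F' \<in> M' \<rightarrow>\<^sub>M count_space {f. set_mset f \<subseteq> S}"
    and t: "\<And>x. x \<in> S \<Longrightarrow> 0 \<le> t x \<and> t x \<le> 1" and t': "\<And>x. x \<in> S \<Longrightarrow> 0 \<le> t' x \<and> t' x \<le> 1"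
    and eq: "\<And>z. 0 \<le> z \<Longrightarrow> z \<le> 1 \<Longrightarrow>
      (\<integral>\<omega>. (\<Prod>x\<in>#F \<omega>. z * t x) \<partial>M) = (\<integral>\<omega>. (\<Prod>x\<in>#F' \<omega>. z * t' x) \<partial>M')"
  shows "(\<Sum>f\<in>msets_of_size S n. measure M {\<omega>\<in>space M. F \<omega> = f} * (\<Prod>x\<in>#f. t x)) =
    (\<Sum>f\<in>msets_of_size S n. measure M' {\<omega>\<in>space M'. F' \<omega> = f} * (\<Prod>x\<in>#f. t' x))"
    (is "?c n = ?c' n")
proof -
  have "(\<lambda>n. (?c n - ?c' n) * z ^ n) sums 0" if z: "0 \<le> z" "z \<le> 1" for z
    using sums_diff[OF prob_space.pgf_sums[OF M S F t z, of "\<lambda>x. x"] prob_space.pgf_sums[OF M' S F' t' z, of "\<lambda>x. x"]] eq[OF z]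
    by (simp add: left_diff_distrib)
  then have "?c n - ?c' n = 0" by (rule power_series_zero_unique)
  then show ?thesis by simp
qed

text \<open>First \<open>z\<close> isolates the multisets of the size of \<open>f\<close>; then the
  point masses are the coefficients of a homogeneous polynomial in the weights.\<close>

lemma pgf_unique:
  fixes F :: "'a \<Rightarrow> 'b multiset" and F' :: "'c \<Rightarrow> 'b multiset"
  assumes M: "prob_space M" and M': "prob_space M'"
    and S: "finite S" and F: "F \<in> M \<rightarrow>\<^sub>M count_space {f. set_mset f \<subseteq> S}"
    and F': "F' \<in> M' \<rightarrow>\<^sub>M count_space {f. set_mset f \<subseteq> S}"
    and eq: "\<And>t :: 'b \<Rightarrow> real. \<forall>x. 0 \<le> t x \<and> t x \<le> 1 \<Longrightarrow>
      (\<integral>\<omega>. (\<Prod>x\<in>#F \<omega>. t x) \<partial>M) = (\<integral>\<omega>. (\<Prod>x\<in>#F' \<omega>. t x) \<partial>M')"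
    and f: "set_mset f \<subseteq> S"
  shows "measure M {\<omega>\<in>space M. F \<omega> = f} = measure M' {\<omega>\<in>space M'. F' \<omega> = f}"
proof -
  have "measure M {\<omega>\<in>space M. F \<omega> = f} - measure M' {\<omega>\<in>space M'. F' \<omega> = f} = 0"
  proof (rule homogeneous_polynomial_zero[OF S, of
        "\<lambda>f. measure M {\<omega>\<in>space M. F \<omega> = f} - measure M' {\<omega>\<in>space M'. F' \<omega> = f}" "size f"])
    fix t :: "'b \<Rightarrow> real" assume t: "\<forall>x. 0 \<le> t x \<and> t x \<le> 1"
    have "(\<integral>\<omega>. (\<Prod>x\<in>#F \<omega>. z * t x) \<partial>M) = (\<integral>\<omega>. (\<Prod>x\<in>#F' \<omega>. z * t x) \<partial>M')"
      if "0 \<le> z" "z \<le> 1" for z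
      using that t by (intro eq[of "\<lambda>x. z * t x"]) (auto intro!: mult_le_one)
    from pgf_slice_unique[OF M M' S F F' _ _ this, of "size f"] t
    show "(\<Sum>f\<in>msets_of_size S (size f). (measure M {\<omega>\<in>space M. F \<omega> = f} -
        measure M' {\<omega>\<in>space M'. F' \<omega> = f}) * (\<Prod>x\<in>#f. t x)) = 0"
      by (simp add: left_diff_distrib sum_subtractf)
  qed (use f in \<open>auto simp: msets_of_size_def\<close>)
  then show ?thesis by simp
qed

text \<open>For \<open>c = card\<close> this is the mean weight of a uniformly chosen feature of the
  same size. An empty class gets the value 0 through division by zero, so the value at the empty
  feature has to be reset whenever a unit weight is wanted.\<close>

definition class_avg :: "'b set \<Rightarrow> ('b \<Rightarrow> 'c) \<Rightarrow> ('b \<Rightarrow> real) \<Rightarrow> 'b \<Rightarrow> real" where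
  "class_avg S c t x = (\<Sum>y | y \<in> S \<and> c y = c x. t y) / card {y \<in> S. c y = c x}"

lemma class_avg_unit_interval:
  assumes S: "finite S" and t: "\<And>x. x \<in> S \<Longrightarrow> 0 \<le> t x \<and> t x \<le> 1"
  shows "0 \<le> class_avg S c t x \<and> class_avg S c t x \<le> 1"
proof -
  have "(\<Sum>y | y \<in> S \<and> c y = c x. t y) \<le> real (card {y \<in> S. c y = c x}) * 1"
    by (rule sum_bounded_above) (use t in auto)
  moreover have "0 \<le> (\<Sum>y | y \<in> S \<and> c y = c x. t y)"
    by (rule sum_nonneg) (use t in auto)
  ultimately show ?thesis
    by (auto simp: class_avg_def divide_le_eq_1)
qed

lemma class_avg_scale: "class_avg S c (\<lambda>x. z * t x) x = z * class_avg S c t x"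
  by (simp add: class_avg_def flip: sum_distrib_left)

lemma sum_class_avg:
  assumes S: "finite S" and k: "k \<in> c ` S"
  shows "(\<Sum>x | x \<in> S \<and> c x = k. class_avg S c t x) = (\<Sum>x | x \<in> S \<and> c x = k. t x)"
proof -
  have "(\<Sum>x | x \<in> S \<and> c x = k. class_avg S c t x) =
      (\<Sum>x | x \<in> S \<and> c x = k. (\<Sum>y | y \<in> S \<and> c y = k. t y) / card {y \<in> S. c y = k})"
    by (rule sum.cong) (auto simp: class_avg_def)
  also have "card {y \<in> S. c y = k} \<noteq> 0"
    using S k by (auto simp: card_eq_0_iff)
  then have "(\<Sum>x | x \<in> S \<and> c x = k. (\<Sum>y | y \<in> S \<and> c y = k. t y) / card {y \<in> S. c y = k}) =
      (\<Sum>x | x \<in> S \<and> c x = k. t x)"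
    by simp
  finally show ?thesis .
qed

text \<open>The denominator of \<open>q\<close> counts the lists over \<open>S\<close> whose types
  form \<open>\<kappa>\<close>, so \<open>q\<close> is the mean mass per list. Averaging the weights
  amounts to spreading the mass of each type evenly over its lists.\<close>

lemma slice_class_avg:
  fixes P :: "'b multiset \<Rightarrow> real" and t :: "'b \<Rightarrow> real" and c :: "'b \<Rightarrow> 'c"
  assumes S: "finite S"
  defines "q \<equiv> \<lambda>\<kappa>. (\<Sum>f | f \<in> msets_of_size S (size \<kappa>) \<and> image_mset c f = \<kappa>. P f) /
    (card (permutations_of_multiset \<kappa>) * (\<Prod>k\<in>#\<kappa>. real (card {x \<in> S. c x = k})))"
  shows "(\<Sum>f\<in>msets_of_size S n. P f * (\<Prod>x\<in>#f. class_avg S c t x)) =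
    (\<Sum>f\<in>msets_of_size S n. card (permutations_of_multiset f) * (q (image_mset c f) * (\<Prod>x\<in>#f. t x)))"
proof -
  let ?\<tau> = "\<lambda>k. \<Sum>x | x \<in> S \<and> c x = k. t x" and ?\<beta> = "\<lambda>k. real (card {x \<in> S. c x = k})"
  have "(\<Sum>f\<in>msets_of_size S n. P f * (\<Prod>x\<in>#f. class_avg S c t x)) =
      (\<Sum>\<kappa>\<in>msets_of_size (c ` S) n. \<Sum>f | f \<in> msets_of_size S n \<and> image_mset c f = \<kappa>.
        P f * (\<Prod>x\<in>#f. class_avg S c t x))"
    using S by (intro sum.group[symmetric] finite_msets_of_size finite_imageI)
      (auto simp: msets_of_size_def intro!: imageI)
  also have "\<dots> = (\<Sum>\<kappa>\<in>msets_of_size (c ` S) n. card (permutations_of_multiset \<kappa>) *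
       (q \<kappa> * (\<Prod>k\<in>#\<kappa>. ?\<tau> k)))"
  proof (rule sum.cong[OF refl])
    fix \<kappa> assume "\<kappa> \<in> msets_of_size (c ` S) n"
    then have k: "set_mset \<kappa> \<subseteq> c ` S" "size \<kappa> = n" by (auto simp: msets_of_size_def)
    have "(\<Sum>f | f \<in> msets_of_size S n \<and> image_mset c f = \<kappa>. P f * (\<Prod>x\<in>#f. class_avg S c t x)) =
        (\<Sum>f | f \<in> msets_of_size S n \<and> image_mset c f = \<kappa>. P f * (\<Prod>k\<in>#\<kappa>. ?\<tau> k / ?\<beta> k))"
      by (intro sum.cong refl) (auto simp: class_avg_def image_mset.compositionality o_def)
    also have "\<dots> = (\<Sum>f | f \<in> msets_of_size S n \<and> image_mset c f = \<kappa>. P f) * (\<Prod>k\<in>#\<kappa>. ?\<tau> k / ?\<beta> k)"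
      by (simp add: sum_distrib_right)
    also have "(\<Prod>k\<in>#\<kappa>. ?\<tau> k / ?\<beta> k) = (\<Prod>k\<in>#\<kappa>. ?\<tau> k) / (\<Prod>k\<in>#\<kappa>. ?\<beta> k)"
      by (induction \<kappa>) auto
    finally show "(\<Sum>f | f \<in> msets_of_size S n \<and> image_mset c f = \<kappa>. P f * (\<Prod>x\<in>#f. class_avg S c t x)) =
        card (permutations_of_multiset \<kappa>) * (q \<kappa> * (\<Prod>k\<in>#\<kappa>. ?\<tau> k))"
      using k by (simp add: q_def permutations_of_multiset_not_empty)
  qed
  also have "\<dots> = (\<Sum>f\<in>msets_of_size S n. card (permutations_of_multiset f) *
      (q (image_mset c f) * (\<Prod>x\<in>#f. t x)))"
    by (rule sum_msets_by_type[OF S, symmetric])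
  finally show ?thesis .
qed

text \<open>If averaging changes no slice, \<open>slice_class_avg\<close> puts every slice into the
  evenly spread form and the coefficients can be compared. Conversely, the evenly spread form
  involves \<open>t\<close> only through class sums, which averaging preserves.\<close>

lemma class_avg_invariant_iff:
  fixes P :: "'b multiset \<Rightarrow> real" and c :: "'b \<Rightarrow> 'c"
  assumes S: "finite S"
  shows "(\<forall>n t. (\<forall>x. 0 \<le> t x \<and> t x \<le> 1) \<longrightarrow>
      (\<Sum>f\<in>msets_of_size S n. P f * (\<Prod>x\<in>#f. t x)) =
      (\<Sum>f\<in>msets_of_size S n. P f * (\<Prod>x\<in>#f. class_avg S c t x))) \<longleftrightarrow>
    (\<exists>q :: 'c multiset \<Rightarrow> real. \<forall>f. set_mset f \<subseteq> S \<longrightarrow> P f = card (permutations_of_multiset f) * q (image_mset c f))"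
    (is "?L \<longleftrightarrow> ?R")
proof
  assume ?L
  define q :: "'c multiset \<Rightarrow> real" where "q \<kappa> = (\<Sum>f | f \<in> msets_of_size S (size \<kappa>) \<and> image_mset c f = \<kappa>. P f) /
    (card (permutations_of_multiset \<kappa>) * (\<Prod>k\<in>#\<kappa>. real (card {x \<in> S. c x = k})))" for \<kappa>
  have "P f - card (permutations_of_multiset f) * q (image_mset c f) = 0" if "set_mset f \<subseteq> S" for f
  proof (rule homogeneous_polynomial_zero[OF S, of
        "\<lambda>f. P f - card (permutations_of_multiset f) * q (image_mset c f)" "size f"])
    fix t :: "'b \<Rightarrow> real" assume "\<forall>x. 0 \<le> t x \<and> t x \<le> 1"
    moreover have "(\<Sum>f\<in>msets_of_size S n. P f * (\<Prod>x\<in>#f. class_avg S c t x)) =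
        (\<Sum>f\<in>msets_of_size S n. card (permutations_of_multiset f) *
          (q (image_mset c f) * (\<Prod>x\<in>#f. t x)))" for n
      unfolding q_def by (rule slice_class_avg[OF S])
    ultimately show "(\<Sum>f\<in>msets_of_size S (size f).
        (P f - card (permutations_of_multiset f) * q (image_mset c f)) * (\<Prod>x\<in>#f. t x)) = 0"
      using \<open>?L\<close> by (simp add: left_diff_distrib sum_subtractf mult.assoc)
  qed (use that in \<open>auto simp: msets_of_size_def\<close>)
  then show ?R by (intro exI[of _ q]) auto
next
  assume ?R
  then obtain q :: "'c multiset \<Rightarrow> real" where q: "P f = card (permutations_of_multiset f) * q (image_mset c f)"
    if "set_mset f \<subseteq> S" for f by blast
  have "(\<Sum>f\<in>msets_of_size S n. P f * (\<Prod>x\<in>#f. t x)) =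
    (\<Sum>\<kappa>\<in>msets_of_size (c ` S) n. card (permutations_of_multiset \<kappa>) *
       (q \<kappa> * (\<Prod>k\<in>#\<kappa>. \<Sum>x | x \<in> S \<and> c x = k. t x)))" for n and t :: "'b \<Rightarrow> real"
    unfolding sum_msets_by_type[OF S, symmetric]
    by (intro sum.cong refl) (auto simp: q msets_of_size_def)
  moreover have "(\<Prod>k\<in>#\<kappa>. \<Sum>x | x \<in> S \<and> c x = k. class_avg S c t x) =
      (\<Prod>k\<in>#\<kappa>. \<Sum>x | x \<in> S \<and> c x = k. t x)" if "\<kappa> \<in> msets_of_size (c ` S) n" for \<kappa> n t
    using that by (intro arg_cong[where f = prod_mset] image_mset_cong sum_class_avg[OF S])
      (auto simp: msets_of_size_def)
  ultimately show ?L by simp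
qed

section \<open>The EFPF as an invariance of generating functions\<close>

lemma ordered_alloc_law_prob:
  assumes M: "prob_space M" and F: "F N \<in> M \<rightarrow>\<^sub>M alloc_space N" and As: "mset As \<in> feature_allocs N"
  shows "measure M {\<omega> \<in> space M. F N \<omega> = mset As} =
    card (permutations_of_multiset (mset As)) * measure (ordered_alloc_law M F N) {As}"
proof -
  have "real (card (permutations_of_multiset (mset As)) * (\<Prod>A\<in>set As. fact (count (mset As) A))) =
      real (fact (length As))"
    using card_permutations_of_multiset_aux[of "mset As"] by simp
  then have "real (card (permutations_of_multiset (mset As))) * (\<Prod>A\<in>set As. fact (count (mset As) A)) =
      fact (length As)"
    by (simp add: of_nat_prod)
  moreover have "(\<Prod>A\<in>set As. fact (count (mset As) A) :: real) \<noteq> 0" by simp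
  ultimately have "real (card (permutations_of_multiset (mset As))) =
      fact (length As) / (\<Prod>A\<in>set As. fact (count (mset As) A))"
    by (simp add: field_simps)
  moreover have "card (permutations_of_multiset (mset As)) \<noteq> 0"
    by (simp add: permutations_of_multiset_not_empty)
  ultimately show ?thesis
    unfolding measure_ordered_alloc_law[where F = F and N = N and As = As, OF M F As] by (simp add: field_simps)
qed

abbreviation size_avg :: "nat \<Rightarrow> (nat set \<Rightarrow> real) \<Rightarrow> nat set \<Rightarrow> real" where
  "size_avg N \<equiv> class_avg (Pow {1..N} - {{}}) card"

lemma has_EFPF_iff_symmetric_weights:
  assumes M: "prob_space M" and F: "\<And>N. 1 \<le> N \<Longrightarrow> F N \<in> M \<rightarrow>\<^sub>M alloc_space N"
  shows "has_EFPF M F \<longleftrightarrow> (\<forall>N\<ge>1. \<exists>q :: nat multiset \<Rightarrow> real. \<forall>f\<in>feature_allocs N.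
    measure M {\<omega>\<in>space M. F N \<omega> = f} = card (permutations_of_multiset f) * q (image_mset card f))"
    (is "_ \<longleftrightarrow> ?R")
proof
  assume "has_EFPF M F"
  then obtain p :: "nat \<Rightarrow> nat list \<Rightarrow> real" where
    p: "\<And>N ks ks'. mset ks = mset ks' \<Longrightarrow> p N ks = p N ks'"
      "\<And>N As. 1 \<le> N \<Longrightarrow> mset As \<in> feature_allocs N \<Longrightarrow>
        measure (ordered_alloc_law M F N) {As} = p N (map card As)"
    unfolding has_EFPF_def by (elim exE conjE) auto
  show ?R
  proof (intro allI impI)
    fix N :: nat assume N: "1 \<le> N"
    show "\<exists>q :: nat multiset \<Rightarrow> real. \<forall>f\<in>feature_allocs N. measure M {\<omega>\<in>space M. F N \<omega> = f} =
        card (permutations_of_multiset f) * q (image_mset card f)"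
    \<comment> \<open>Any ordering of the sizes will do, by the symmetry of
      \<open>p\<close>.\<close>
    proof (intro exI[of _ "\<lambda>\<kappa>. p N (SOME ks. mset ks = \<kappa>)"] ballI)
      fix f assume f: "f \<in> feature_allocs N"
      obtain As where As: "mset As = f" using ex_mset by blast
      have "mset (SOME ks. mset ks = image_mset card f) = image_mset card f"
        using ex_mset by (rule someI_ex)
      then have "p N (SOME ks. mset ks = image_mset card f) = p N (map card As)"
        by (intro p(1)) (simp add: As)
      with ordered_alloc_law_prob[where F = F and N = N and As = As, OF M F[OF N]] p(2)[OF N, of As] f
      show "measure M {\<omega>\<in>space M. F N \<omega> = f} =
          card (permutations_of_multiset f) * p N (SOME ks. mset ks = image_mset card f)"
        by (simp add: As)
    qed
  qed
next
  assume ?R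
  define q :: "nat \<Rightarrow> nat multiset \<Rightarrow> real" where "q N = (SOME q :: nat multiset \<Rightarrow> real. \<forall>f\<in>feature_allocs N.
    measure M {\<omega>\<in>space M. F N \<omega> = f} = card (permutations_of_multiset f) * q (image_mset card f))" for N
  have q: "measure M {\<omega>\<in>space M. F N \<omega> = f} = card (permutations_of_multiset f) * q N (image_mset card f)"
    if "1 \<le> N" "f \<in> feature_allocs N" for N f
    unfolding q_def using someI_ex[OF \<open>?R\<close>[rule_format, OF that(1)]] that(2) by blast
  have "measure (ordered_alloc_law M F N) {As} = q N (mset (map card As))"
    if N: "1 \<le> N" and As: "mset As \<in> feature_allocs N" for N As
    using ordered_alloc_law_prob[where F = F and N = N and As = As, OF M F[OF N] As] q[OF N As]
    by (simp add: permutations_of_multiset_not_empty)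
  then show "has_EFPF M F"
    unfolding has_EFPF_def by (intro exI[of _ "\<lambda>N ks. q N (mset ks)"]) auto
qed

text \<open>The slices by size are the link: summed at \<open>z = 1\<close> they give the generating
  function, and a comparison in \<open>z\<close> recovers them, because averaging commutes with
  scaling by \<open>z\<close>. For the slices the claim is
  \<open>class_avg_invariant_iff\<close>.\<close>

lemma has_EFPF_iff_pgf:
  assumes M: "prob_space M" and F: "\<And>N. 1 \<le> N \<Longrightarrow> F N \<in> M \<rightarrow>\<^sub>M alloc_space N"
  shows "has_EFPF M F \<longleftrightarrow> (\<forall>N\<ge>1. \<forall>t. (\<forall>A. 0 \<le> t A \<and> t A \<le> 1) \<longrightarrow>
    (\<integral>\<omega>. (\<Prod>A\<in>#F N \<omega>. t A) \<partial>M) = (\<integral>\<omega>. (\<Prod>A\<in>#F N \<omega>. size_avg N t A) \<partial>M))"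
proof -
  have "(\<exists>q :: nat multiset \<Rightarrow> real. \<forall>f\<in>feature_allocs N. measure M {\<omega>\<in>space M. F N \<omega> = f} =
        card (permutations_of_multiset f) * q (image_mset card f)) \<longleftrightarrow>
      (\<forall>t. (\<forall>A. 0 \<le> t A \<and> t A \<le> 1) \<longrightarrow>
        (\<integral>\<omega>. (\<Prod>A\<in>#F N \<omega>. t A) \<partial>M) = (\<integral>\<omega>. (\<Prod>A\<in>#F N \<omega>. size_avg N t A) \<partial>M))"
    if N: "1 \<le> N" for N
  proof -
    let ?S = "Pow {1..N} - {{}} :: nat set set"
    let ?P = "\<lambda>f. measure M {\<omega>\<in>space M. F N \<omega> = f}"
    let ?sl = "\<lambda>n t. \<Sum>f\<in>msets_of_size ?S n. ?P f * (\<Prod>x\<in>#f. t x)"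
    have S: "finite ?S" by simp
    note F' = F[OF N, unfolded feature_allocs_alt]
    have "(\<forall>n t. (\<forall>x. 0 \<le> t x \<and> t x \<le> 1) \<longrightarrow> ?sl n t = ?sl n (size_avg N t)) \<longleftrightarrow>
        (\<forall>t. (\<forall>A. 0 \<le> t A \<and> t A \<le> 1) \<longrightarrow>
        (\<integral>\<omega>. (\<Prod>A\<in>#F N \<omega>. t A) \<partial>M) = (\<integral>\<omega>. (\<Prod>A\<in>#F N \<omega>. size_avg N t A) \<partial>M))"
      (is "?A \<longleftrightarrow> ?B")
    proof safe
      fix t :: "nat set \<Rightarrow> real" assume A: ?A and t: "\<forall>A. 0 \<le> t A \<and> t A \<le> 1"
      have "(\<lambda>n. ?sl n t * 1 ^ n) sums (\<integral>\<omega>. (\<Prod>A\<in>#F N \<omega>. 1 * t A) \<partial>M)"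
        by (rule prob_space.pgf_sums[OF M S F']) (use t in auto)
      moreover have "(\<lambda>n. ?sl n (size_avg N t) * 1 ^ n) sums (\<integral>\<omega>. (\<Prod>A\<in>#F N \<omega>. 1 * size_avg N t A) \<partial>M)"
        by (rule prob_space.pgf_sums[OF M S F']) (use t class_avg_unit_interval[OF S, of t] in auto)
      moreover have "?sl n (size_avg N t) = ?sl n t" for n
        using A t by (auto simp del: mult_eq_if)
      ultimately show "(\<integral>\<omega>. (\<Prod>A\<in>#F N \<omega>. t A) \<partial>M) = (\<integral>\<omega>. (\<Prod>A\<in>#F N \<omega>. size_avg N t A) \<partial>M)"
        by (simp add: sums_iff)
    next
      fix n and t :: "nat set \<Rightarrow> real" assume B: ?B and t: "\<forall>A. 0 \<le> t A \<and> t A \<le> 1"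
      show "?sl n t = ?sl n (size_avg N t)"
      proof (rule pgf_slice_unique[OF M M S F' F'])
        fix z :: real assume z: "0 \<le> z" "z \<le> 1"
        have "\<forall>A. 0 \<le> z * t A \<and> z * t A \<le> 1" using z t by (auto intro!: mult_le_one)
        with B show "(\<integral>\<omega>. (\<Prod>x\<in>#F N \<omega>. z * t x) \<partial>M) = (\<integral>\<omega>. (\<Prod>x\<in>#F N \<omega>. z * size_avg N t x) \<partial>M)"
          by (simp add: class_avg_scale)
      qed (use t class_avg_unit_interval[OF S, of t] in auto)
    qed
    then show ?thesis
      unfolding class_avg_invariant_iff[OF S] by (simp add: feature_allocs_alt)
  qed
  then show ?thesis
    by (simp add: has_EFPF_iff_symmetric_weights[where M = M and F = F, OF M F])
qed

section \<open>Sampling without replacement\<close>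

definition subsets_of_size :: "nat \<Rightarrow> nat \<Rightarrow> nat set set" where
  "subsets_of_size N k = {A. A \<subseteq> {1..N} \<and> card A = k}"

text \<open>The value 1 at the empty set lets features with empty trace on \<open>{1..m}\<close>
  drop out of a product; the range [0,1] supplies the domination bounds.\<close>

definition unit_weight :: "(nat set \<Rightarrow> real) \<Rightarrow> bool" where
  "unit_weight t \<longleftrightarrow> t {} = 1 \<and> (\<forall>A. 0 \<le> t A \<and> t A \<le> 1)"

text \<open>Mean weight of the trace on \<open>{1..m}\<close> of a uniformly random
  \<open>k\<close>-subset of \<open>{1..N}\<close>.\<close>

definition sampled_weight :: "nat \<Rightarrow> (nat set \<Rightarrow> real) \<Rightarrow> nat \<Rightarrow> nat \<Rightarrow> real" where
  "sampled_weight m t N k = (\<Sum>B\<in>subsets_of_size N k. t (B \<inter> {1..m})) / real (N choose k)"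

text \<open>Mean weight of the set of successes among \<open>m\<close> independent draws with
  success probability \<open>v\<close>.\<close>

definition bernoulli_weight :: "nat \<Rightarrow> (nat set \<Rightarrow> real) \<Rightarrow> real \<Rightarrow> real" where
  "bernoulli_weight m t v = (\<Sum>C\<in>Pow {1..m}. t C * (v ^ card C * (1 - v) ^ (m - card C)))"

text \<open>For a unit weight this is the derivative at \<open>v = 0\<close> of
  \<open>1 - bernoulli_weight m t v\<close>. It is also the exponent, per unit of rate, in the
  generating function of the Poisson singletons.\<close>

definition singleton_loss :: "nat \<Rightarrow> (nat set \<Rightarrow> real) \<Rightarrow> real" where
  "singleton_loss m t = (\<Sum>n\<in>{1..m}. 1 - t {n})"

lemma finite_subsets_of_size [simp]: "finite (subsets_of_size N k)"
  by (rule finite_subset[of _ "Pow {1..N}"]) (auto simp: subsets_of_size_def)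

lemma card_subsets_of_size: "card (subsets_of_size N k) = N choose k"
  using n_subsets[of "{1..N}" k] by (simp add: subsets_of_size_def)

lemma unit_weightD: "unit_weight t \<Longrightarrow> t {} = 1" "unit_weight t \<Longrightarrow> 0 \<le> t A" "unit_weight t \<Longrightarrow> t A \<le> 1"
  by (auto simp: unit_weight_def)

lemma singleton_loss_bounds:
  assumes "unit_weight t"
  shows "0 \<le> singleton_loss m t" "singleton_loss m t \<le> m"
proof -
  show "0 \<le> singleton_loss m t"
    using assms by (auto simp: singleton_loss_def unit_weight_def intro!: sum_nonneg)
  have "singleton_loss m t \<le> real (card {1..m}) * 1"
    unfolding singleton_loss_def by (rule sum_bounded_above) (use assms in \<open>auto simp: unit_weight_def\<close>)
  then show "singleton_loss m t \<le> m" by simp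
qed

lemma sampled_weight_bounds:
  assumes "unit_weight t"
  shows "0 \<le> sampled_weight m t N k" "sampled_weight m t N k \<le> 1"
proof -
  have "(\<Sum>B\<in>subsets_of_size N k. t (B \<inter> {1..m})) \<le> real (card (subsets_of_size N k)) * 1"
    by (rule sum_bounded_above) (use assms in \<open>auto simp: unit_weight_def\<close>)
  then show "sampled_weight m t N k \<le> 1"
    by (cases "N choose k = 0") (simp_all add: sampled_weight_def card_subsets_of_size del: binomial_eq_0_iff)
  show "0 \<le> sampled_weight m t N k"
    using assms by (auto simp: sampled_weight_def unit_weight_def intro!: sum_nonneg divide_nonneg_nonneg)
qed

lemma card_subsets_of_size_containing:
  assumes D: "D \<subseteq> {1..N}"
  shows "card {B \<in> subsets_of_size N k. D \<subseteq> B} =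
    (if card D \<le> k then (N - card D) choose (k - card D) else 0)"
proof (cases "card D \<le> k")
  case True
  have finD: "finite D" using D finite_subset by blast
  have fin: "finite B" if "B \<subseteq> {1..N}" for B :: "nat set" using that finite_subset by blast
  have "bij_betw (\<lambda>B. B - D) {B \<in> subsets_of_size N k. D \<subseteq> B} {B. B \<subseteq> {1..N} - D \<and> card B = k - card D}"
  proof (rule bij_betw_byWitness[where f' = "\<lambda>B. B \<union> D"])
    show "(\<lambda>B. B - D) ` {B \<in> subsets_of_size N k. D \<subseteq> B} \<subseteq> {B. B \<subseteq> {1..N} - D \<and> card B = k - card D}"
      using finD by (auto simp: subsets_of_size_def card_Diff_subset)
    show "(\<lambda>B. B \<union> D) ` {B. B \<subseteq> {1..N} - D \<and> card B = k - card D} \<subseteq> {B \<in> subsets_of_size N k. D \<subseteq> B}"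
    proof (rule image_subsetI)
      fix B assume B: "B \<in> {B. B \<subseteq> {1..N} - D \<and> card B = k - card D}"
      then have "card (B \<union> D) = k"
        using True finD fin[of B] by (subst card_Un_disjoint) auto
      with B D show "B \<union> D \<in> {B \<in> subsets_of_size N k. D \<subseteq> B}"
        by (auto simp: subsets_of_size_def)
    qed
  qed auto
  then have "card {B \<in> subsets_of_size N k. D \<subseteq> B} = card ({1..N} - D) choose (k - card D)"
    by (simp add: bij_betw_same_card n_subsets)
  then show ?thesis using True D finD by (simp add: card_Diff_subset)
next
  case False
  have "card D \<le> card B" if "B \<in> subsets_of_size N k" "D \<subseteq> B" for B
    using that by (intro card_mono) (auto simp: subsets_of_size_def dest: finite_subset)
  then have "{B \<in> subsets_of_size N k. D \<subseteq> B} = {}"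
    using False by (auto simp: subsets_of_size_def)
  then show ?thesis using False by simp
qed

lemma binomial_absorb_real:
  "real (Suc j) * real (Suc n choose Suc j) = real (Suc n) * real (n choose j)"
proof -
  have "Suc j * (Suc n choose Suc j) = Suc n * (n choose j)"
    by (metis Suc_times_binomial_eq mult.commute)
  then show ?thesis by (simp only: of_nat_mult[symmetric])
qed

lemma inclusion_frequency:
  assumes n: "n \<in> {1..N}" and k: "k \<le> N"
  shows "card {B \<in> subsets_of_size N k. n \<in> B} / real (N choose k) = k / N"
proof (cases k)
  case 0
  then show ?thesis using card_subsets_of_size_containing[of "{n}" N k] n by simp
next
  case (Suc j)
  obtain K where "N = Suc K" using n by (cases N) auto
  then have "real k * real (N choose k) = real N * real ((N - 1) choose j)"
    using binomial_absorb_real[of j K] Suc by simp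
  moreover have "real (N choose k) \<noteq> 0" using k by simp
  ultimately show ?thesis
    using card_subsets_of_size_containing[of "{n}" N k] n Suc by (simp add: field_simps)
qed

text \<open>Sampling without replacement is negatively correlated: the exact frequency is
  \<open>k / N\<close> times \<open>(k - 1) / (N - 1)\<close>, and the second factor is at most
  \<open>k / N\<close> because \<open>k \<le> N\<close>.\<close>

lemma pair_inclusion_frequency:
  assumes n: "n \<in> {1..N}" "n' \<in> {1..N}" "n \<noteq> n'" and k: "k \<le> N"
  shows "card {B \<in> subsets_of_size N k. n \<in> B \<and> n' \<in> B} / real (N choose k) \<le> (k / N)\<^sup>2"
proof -
  have c: "card {B \<in> subsets_of_size N k. n \<in> B \<and> n' \<in> B} = (if 2 \<le> k then (N - 2) choose (k - 2) else 0)"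
    using card_subsets_of_size_containing[of "{n, n'}" N k] n by (simp add: numeral_2_eq_2)
  show ?thesis
  proof (cases "k < 2")
    case True
    then show ?thesis unfolding c by simp
  next
    case False
  \<comment> \<open>Lowering both numbers by two makes the absorption identity applicable
    twice.\<close>
  define j K where "j = k - 2" and "K = N - 2"
  with False k have j: "k = Suc (Suc j)" and K: "N = Suc (Suc K)" by simp_all
  have "real k * real (N choose k) = real N * real (Suc K choose Suc j)"
    unfolding j K by (rule binomial_absorb_real)
  then have 1: "real (Suc K choose Suc j) = real k / real N * real (N choose k)"
    using K by (simp add: field_simps del: binomial_Suc_Suc)
  have 2: "real (K choose j) = real (Suc j) / real (Suc K) * real (Suc K choose Suc j)"
    using binomial_absorb_real[of j K] by (simp add: field_simps del: binomial_Suc_Suc of_nat_Suc)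
  have "real (N choose k) \<noteq> 0" using k by simp
  then have "real (K choose j) / real (N choose k) = (real k / real N) * (real (Suc j) / real (Suc K))"
    unfolding 2 1 by (simp add: mult.commute del: of_nat_Suc)
  also have "\<dots> \<le> (real k / real N) * (real k / real N)"
    using k by (intro mult_left_mono) (auto simp: j K field_simps)
  finally show ?thesis
    unfolding c by (simp add: j K power2_eq_square del: binomial_Suc_Suc)
  qed
qed

text \<open>With at most one element in \<open>A\<close> the left side is 0. Otherwise it is at most
  \<open>m\<close>, and the sum on the right counts at least one ordered pair of distinct
  elements.\<close>

lemma weight_singleton_expansion:
  assumes t: "unit_weight t" and A: "A \<subseteq> {1..m}"
  shows "\<bar>1 - t A - (\<Sum>n\<in>A. 1 - t {n})\<bar> \<le> real m * (\<Sum>p\<in>{p\<in>{1..m}\<times>{1..m}. fst p \<noteq> snd p}.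
    if fst p \<in> A \<and> snd p \<in> A then 1 else 0 :: real)"
proof (cases "\<exists>n n'. n \<in> A \<and> n' \<in> A \<and> n \<noteq> n'")
  case True
  then obtain n n' where n: "n \<in> A" "n' \<in> A" "n \<noteq> n'" by blast
  let ?s = "\<Sum>n\<in>A. 1 - t {n}"
  have fin: "finite A" using A finite_subset by blast
  have "?s \<le> real (card A) * 1"
    by (rule sum_bounded_above) (use t in \<open>auto simp: unit_weight_def\<close>)
  moreover have "card A \<le> m" using card_mono[OF _ A] by simp
  moreover have "0 \<le> ?s" by (rule sum_nonneg) (use t in \<open>auto simp: unit_weight_def\<close>)
  moreover have "m \<ge> 1" using n(1) A by auto
  ultimately have "\<bar>1 - t A - ?s\<bar> \<le> m"
    using unit_weightD(2,3)[OF t, of A] by (auto simp: abs_le_iff)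
  also have "(\<Sum>p\<in>{(n, n')}. if fst p \<in> A \<and> snd p \<in> A then 1 else 0 :: real) \<le>
      (\<Sum>p\<in>{p\<in>{1..m}\<times>{1..m}. fst p \<noteq> snd p}. if fst p \<in> A \<and> snd p \<in> A then 1 else 0 :: real)"
    by (rule sum_mono2) (use n A in \<open>auto split: if_splits\<close>)
  then have "real m * 1 \<le> real m * (\<Sum>p\<in>{p\<in>{1..m}\<times>{1..m}. fst p \<noteq> snd p}. if fst p \<in> A \<and> snd p \<in> A then 1 else 0 :: real)"
    using n by (intro mult_left_mono) auto
  finally show ?thesis by simp
next
  case False
  then have "A = {} \<or> (\<exists>n. A = {n})" by blast
  then have "1 - t A - (\<Sum>n\<in>A. 1 - t {n}) = 0" using t by (auto simp: unit_weight_def)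
  then show ?thesis by (auto intro!: mult_nonneg_nonneg sum_nonneg)
qed

text \<open>The previous expansion is averaged over all \<open>k\<close>-subsets. The linear term is
  exact by \<open>inclusion_frequency\<close>; the remainder has a factor \<open>m\<close> and at
  most \<open>m * m\<close> pairs, each contributing at most the square of \<open>k / N\<close>,
  whence the cube of \<open>m\<close>.\<close>

lemma sampled_weight_first_order:
  assumes t: "unit_weight t" and k: "k \<le> N" and m: "m \<le> N"
  shows "\<bar>1 - sampled_weight m t N k - singleton_loss m t * (k / N)\<bar> \<le> real m ^ 3 * (k / N)\<^sup>2"
proof -
  let ?S = "subsets_of_size N k" and ?b = "real (N choose k)"
  let ?P = "{p\<in>{1..m}\<times>{1..m}. fst p \<noteq> snd p}"
  have b: "?b > 0" using k by simp
  have freq: "(\<Sum>B\<in>?S. if n \<in> B then 1 else 0) / ?b = k / N" if "n \<in> {1..m}" for n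
    using inclusion_frequency[of n N k] that k m by (simp add: sum.If_cases Int_def)
  have eq: "1 - sampled_weight m t N k - singleton_loss m t * (k / N) =
      (\<Sum>B\<in>?S. 1 - t (B \<inter> {1..m}) - (\<Sum>n\<in>B \<inter> {1..m}. 1 - t {n})) / ?b"
  proof -
    have "(\<Sum>B\<in>?S. \<Sum>n\<in>B \<inter> {1..m}. 1 - t {n}) = (\<Sum>B\<in>?S. \<Sum>n\<in>{1..m}. (1 - t {n}) * (if n \<in> B then 1 else 0))"
      by (rule sum.cong[OF refl], subst Int_commute, subst sum.inter_restrict) (auto intro!: sum.cong)
    also have "\<dots> = (\<Sum>n\<in>{1..m}. (1 - t {n}) * (\<Sum>B\<in>?S. if n \<in> B then 1 else 0))"
      by (subst sum.swap) (simp add: sum_distrib_left)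
    finally have "(\<Sum>B\<in>?S. \<Sum>n\<in>B \<inter> {1..m}. 1 - t {n}) / ?b =
        (\<Sum>n\<in>{1..m}. (1 - t {n}) * ((\<Sum>B\<in>?S. if n \<in> B then 1 else 0) / ?b))"
      by (simp only: sum_divide_distrib[of _ "{1..m}"] times_divide_eq_right)
    also have "\<dots> = singleton_loss m t * (k / N)"
      unfolding singleton_loss_def sum_distrib_right by (intro sum.cong refl) (simp only: freq)
    finally show ?thesis
      using b by (simp add: sum_subtractf sampled_weight_def card_subsets_of_size diff_divide_distrib)
  qed
  have "\<bar>\<Sum>B\<in>?S. 1 - t (B \<inter> {1..m}) - (\<Sum>n\<in>B \<inter> {1..m}. 1 - t {n})\<bar> \<le>
      (\<Sum>B\<in>?S. real m * (\<Sum>p\<in>?P. if fst p \<in> B \<inter> {1..m} \<and> snd p \<in> B \<inter> {1..m} then 1 else 0 :: real))"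
    by (rule order.trans[OF sum_abs], rule sum_mono, rule weight_singleton_expansion[OF t]) auto
  also have "\<dots> = real m * (\<Sum>p\<in>?P. \<Sum>B\<in>?S. if fst p \<in> B \<and> snd p \<in> B then 1 else 0 :: real)"
    unfolding sum_distrib_left[symmetric] by (subst sum.swap) (auto intro!: sum.cong)
  finally have "\<bar>1 - sampled_weight m t N k - singleton_loss m t * (k / N)\<bar> \<le>
      real m * (\<Sum>p\<in>?P. \<Sum>B\<in>?S. if fst p \<in> B \<and> snd p \<in> B then 1 else 0 :: real) / ?b"
    unfolding eq using b by (simp add: divide_right_mono)
  also have "\<dots> = real m * (\<Sum>p\<in>?P. card {B\<in>?S. fst p \<in> B \<and> snd p \<in> B} / ?b)"
    by (simp add: sum.If_cases Int_def sum_divide_distrib flip: times_divide_eq_right)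
  also have "\<dots> \<le> m * (\<Sum>p\<in>?P. (k / N)\<^sup>2)"
    using m k by (intro mult_left_mono sum_mono pair_inclusion_frequency) auto
  also have "\<dots> \<le> m * ((real m * real m) * (k / N)\<^sup>2)"
  proof -
    have "card ?P \<le> card ({1..m} \<times> {1..m})" by (intro card_mono) auto
    then have "real (card ?P) \<le> real m * real m" by (simp add: card_cartesian_product flip: of_nat_mult)
    then show ?thesis by (intro mult_left_mono) (auto intro!: mult_right_mono)
  qed
  finally show ?thesis by (simp add: power3_eq_cube mult_ac)
qed

lemma exp_minus_quadratic_bound:
  fixes y :: real
  assumes "0 \<le> y"
  shows "\<bar>exp (- y) - 1 + y\<bar> \<le> y\<^sup>2"
proof -
  have "exp (- y) \<le> 1 / (1 + y)"
    using exp_ge_add_one_self[of y] assms by (simp add: exp_minus inverse_eq_divide frac_le)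
  \<comment> \<open>The product of \<open>1 + y\<close> and the right side is
    \<open>1 + y ^ 3\<close>.\<close>
  also have "\<dots> \<le> 1 - y + y\<^sup>2"
    using assms by (simp add: field_simps power2_eq_square)
  finally show ?thesis
    using exp_ge_add_one_self[of "- y"] by (auto simp: abs_le_iff)
qed

text \<open>Both terms agree with \<open>1 - singleton_loss m t * (k / N)\<close> to first order.
  The cube of \<open>m\<close> is the sampling error and the square is the error of the exponential,
  as the loss is at most \<open>m\<close>.\<close>

lemma sampled_weight_exp:
  assumes t: "unit_weight t" and k: "k \<le> N" and m: "m \<le> N"
  shows "\<bar>sampled_weight m t N k - exp (- (singleton_loss m t * (k / N)))\<bar> \<le> (real m ^ 3 + real m ^ 2) * (k / N)\<^sup>2"
proof -
  note l = singleton_loss_bounds[OF t, of m]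
  have "(singleton_loss m t * (k / N))\<^sup>2 \<le> real m ^ 2 * (k / N)\<^sup>2"
    unfolding power_mult_distrib using l by (intro mult_right_mono power_mono) auto
  moreover have "\<bar>exp (- (singleton_loss m t * (k / N))) - 1 + singleton_loss m t * (k / N)\<bar> \<le>
      (singleton_loss m t * (k / N))\<^sup>2"
    using l by (intro exp_minus_quadratic_bound) auto
  ultimately show ?thesis
    using sampled_weight_first_order[OF t k m] by (simp add: distrib_right)
qed

text \<open>Probability that a uniform \<open>k\<close>-subset of \<open>{1..N}\<close> has one
  prescribed trace with \<open>c\<close> elements on \<open>{1..m}\<close>. The test
  \<open>c \<le> k\<close> guards against truncated subtraction.\<close>

definition trace_frequency :: "nat \<Rightarrow> nat \<Rightarrow> nat \<Rightarrow> nat \<Rightarrow> real" where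
  "trace_frequency N k m c = real (if c \<le> k then (N - m) choose (k - c) else 0) / real (N choose k)"

lemma card_subsets_of_size_trace:
  assumes C: "C \<subseteq> {1..m}" and m: "m \<le> N"
  shows "card {B \<in> subsets_of_size N k. B \<inter> {1..m} = C} = (if card C \<le> k then (N - m) choose (k - card C) else 0)"
proof (cases "card C \<le> k")
  case True
  have C': "x \<le> m" if "x \<in> C" for x using C that by auto
  have finC: "finite C" using C finite_subset by blast
  have fin: "finite B" if "B \<subseteq> {m<..N}" for B :: "nat set" using that finite_subset by blast
  have fin': "finite B" if "B \<subseteq> {1..N}" for B :: "nat set" using that finite_subset by blast
  have "bij_betw (\<lambda>B. B \<union> C) {B. B \<subseteq> {m<..N} \<and> card B = k - card C} {B \<in> subsets_of_size N k. B \<inter> {1..m} = C}"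
  proof (rule bij_betw_byWitness[where f' = "\<lambda>B. B - C"])
    show "(\<lambda>B. B \<union> C) ` {B. B \<subseteq> {m<..N} \<and> card B = k - card C} \<subseteq> {B \<in> subsets_of_size N k. B \<inter> {1..m} = C}"
    proof safe
      fix B assume B: "B \<subseteq> {m<..N}" "card B = k - card C"
      then have "B \<inter> C = {}" using C by fastforce
      then have "card (B \<union> C) = k"
        using B True by (simp add: card_Un_disjoint fin finC)
      then show "B \<union> C \<in> subsets_of_size N k"
        using B C m by (auto simp: subsets_of_size_def subset_eq)
    qed (use C in auto)
    show "(\<lambda>B. B - C) ` {B \<in> subsets_of_size N k. B \<inter> {1..m} = C} \<subseteq> {B. B \<subseteq> {m<..N} \<and> card B = k - card C}"
      using finC by (auto simp: subsets_of_size_def card_Diff_subset subset_eq)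
  next
    show "\<forall>B\<in>{B. B \<subseteq> {m<..N} \<and> card B = k - card C}. B \<union> C - C = B"
    proof (rule ballI)
      fix B assume "B \<in> {B. B \<subseteq> {m<..N} \<and> card B = k - card C}"
      then have "B \<inter> C = {}" using C' by fastforce
      then show "B \<union> C - C = B" by blast
    qed
  qed auto
  then have "card {B \<in> subsets_of_size N k. B \<inter> {1..m} = C} = card {B. B \<subseteq> {m<..N} \<and> card B = k - card C}"
    by (rule bij_betw_same_card[symmetric])
  then show ?thesis using True by (simp add: n_subsets)
next
  case False
  have "card C \<le> card B" if "B \<in> subsets_of_size N k" "B \<inter> {1..m} = C" for B
    using that by (intro card_mono) (auto simp: subsets_of_size_def dest: finite_subset)
  then have "{B \<in> subsets_of_size N k. B \<inter> {1..m} = C} = {}"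
    using False by (auto simp: subsets_of_size_def)
  then show ?thesis using False by simp
qed

lemma sampled_weight_trace_frequency:
  assumes m: "m \<le> N"
  shows "sampled_weight m t N k = (\<Sum>C\<in>Pow {1..m}. t C * trace_frequency N k m (card C))"
proof -
  let ?S = "subsets_of_size N k"
  have "(\<Sum>B\<in>?S. t (B \<inter> {1..m})) = (\<Sum>C\<in>Pow {1..m}. \<Sum>B | B \<in> ?S \<and> B \<inter> {1..m} = C. t (B \<inter> {1..m}))"
    by (rule sum.group[symmetric]) auto
  also have "\<dots> = (\<Sum>C\<in>Pow {1..m}. t C * card {B \<in> ?S. B \<inter> {1..m} = C})"
    by (intro sum.cong refl) (simp add: mult.commute)
  finally show ?thesis
    using card_subsets_of_size_trace[OF _ m, of _ k]
    by (simp add: sampled_weight_def trace_frequency_def sum_divide_distrib)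
qed

text \<open>Conditional probabilities for the next index: given a trace of \<open>c\<close> elements
  on the first \<open>m\<close> indices, \<open>k - c\<close> of the remaining \<open>N - m\<close>
  are chosen. The subtractions are real, so the identities also cover the degenerate cases.\<close>

lemma trace_frequency_Suc:
  assumes "m < N"
  shows "trace_frequency N k (Suc m) c =
      trace_frequency N k m c * ((real N - real m - (real k - real c)) / (real N - real m))"
    and "trace_frequency N k (Suc m) (Suc c) =
      trace_frequency N k m c * ((real k - real c) / (real N - real m))"
proof -
  obtain n where n: "N - m = Suc n" using assms by (metis Suc_diff_Suc)
  then have N: "real N - real m = Suc n" "N - Suc m = n" using assms by auto
  have "real (n choose j) * Suc n = real (Suc n choose j) * (real (Suc n) - real j)" for j
  proof (cases "j \<le> Suc n")
    case True
    have "real ((Suc n - j) * (Suc n choose j)) = real (Suc n * (n choose j))"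
      by (subst binomial_absorb_comp) simp
    then show ?thesis using True by (simp only: of_nat_mult of_nat_diff mult_ac)
  next
    case False
    then show ?thesis by (simp add: binomial_eq_0 del: binomial_Suc_Suc)
  qed
  then have *: "real (n choose j) = real (Suc n choose j) * (real (Suc n) - real j) / Suc n" for j
    by (simp add: field_simps del: binomial_Suc_Suc of_nat_Suc)
  show "trace_frequency N k (Suc m) c =
      trace_frequency N k m c * ((real N - real m - (real k - real c)) / (real N - real m))"
    unfolding trace_frequency_def N n using *[of "k - c"] by (auto simp: of_nat_diff simp del: binomial_Suc_Suc of_nat_Suc)
  have **: "real (n choose j) = real (Suc n choose Suc j) * real (Suc j) / Suc n" for j
    using binomial_absorb_real[of j n] by (simp add: field_simps del: binomial_Suc_Suc of_nat_Suc)
  show "trace_frequency N k (Suc m) (Suc c) =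
      trace_frequency N k m c * ((real k - real c) / (real N - real m))"
  proof (cases "Suc c \<le> k")
    case True
    define j where "j = k - Suc c"
    with True have "k = c + Suc j" by simp
    then have "real k - real c = real (Suc j)" "k - Suc c = j" "k - c = Suc j" by simp_all
    then show ?thesis using True
      unfolding trace_frequency_def N n using **[of j] by (simp del: binomial_Suc_Suc of_nat_Suc)
  qed (auto simp: trace_frequency_def not_le less_Suc_eq_le)
qed

text \<open>Each further index multiplies by a conditional probability tending to \<open>v\<close>
  or to \<open>1 - v\<close>; the fixed shifts by \<open>c\<close> and \<open>m\<close> are
  negligible against \<open>N j\<close>.\<close>

lemma trace_frequency_limit:
  fixes N k :: "nat \<Rightarrow> nat"
  assumes N: "filterlim N at_top sequentially" and k: "\<And>j. k j \<le> N j"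
    and v: "(\<lambda>j. real (k j) / real (N j)) \<longlonglongrightarrow> v" and c: "c \<le> m"
  shows "(\<lambda>j. trace_frequency (N j) (k j) m c) \<longlonglongrightarrow> v ^ c * (1 - v) ^ (m - c)"
  using c
proof (induction m arbitrary: c)
  case 0
  have "trace_frequency (N j) (k j) 0 0 = 1" for j
    using k[of j] by (simp add: trace_frequency_def)
  then show ?case using 0 by simp
next
  case (Suc m)
  have Nr: "filterlim (\<lambda>j. real (N j)) at_top sequentially"
    by (rule filterlim_compose[OF filterlim_real_sequentially N])
  have small: "(\<lambda>j. a / real (N j)) \<longlonglongrightarrow> 0" for a
    by (rule real_tendsto_divide_at_top[OF tendsto_const Nr])
  have pos: "eventually (\<lambda>j. m < N j) sequentially"
    using filterlim_at_top[THEN iffD1, OF N, rule_format, of "Suc m"] by (simp add: Suc_le_eq)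
  have lim: "(\<lambda>j. (real (k j) - a) / (real (N j) - real m)) \<longlonglongrightarrow> v" for a
  proof -
    have "(\<lambda>j. (real (k j) / real (N j) - a / real (N j)) / (1 - real m / real (N j))) \<longlonglongrightarrow> (v - 0) / (1 - 0)"
      by (intro tendsto_intros v small) auto
    then show ?thesis unfolding diff_zero div_by_1
      by (rule Lim_transform_eventually) (rule eventually_mono[OF pos], simp add: field_simps)
  qed
  have lim1: "(\<lambda>j. (real (N j) - real m - (real (k j) - a)) / (real (N j) - real m)) \<longlonglongrightarrow> 1 - v" for a
    using tendsto_diff[OF tendsto_const[of 1] lim[of a]]
    by (rule Lim_transform_eventually) (rule eventually_mono[OF pos], simp add: diff_divide_distrib)
  show ?case
  \<comment> \<open>The frequency depends on the trace only through its size, so the last index may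
    be taken as a non-member unless the trace is full.\<close>
  proof (cases "c = Suc m")
    case True
    have "(\<lambda>j. trace_frequency (N j) (k j) m m * ((real (k j) - real m) / (real (N j) - real m)))
        \<longlonglongrightarrow> v ^ m * (1 - v) ^ (m - m) * v"
      by (intro tendsto_mult Suc.IH lim) simp
    then have "(\<lambda>j. trace_frequency (N j) (k j) (Suc m) (Suc m)) \<longlonglongrightarrow> v ^ m * (1 - v) ^ (m - m) * v"
      by (rule Lim_transform_eventually) (rule eventually_mono[OF pos], simp add: trace_frequency_Suc(2))
    then show ?thesis unfolding True by (simp add: mult.commute)
  next
    case False
    with Suc.prems have c: "c \<le> m" by simp
    have "(\<lambda>j. trace_frequency (N j) (k j) m c *
        ((real (N j) - real m - (real (k j) - real c)) / (real (N j) - real m)))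
        \<longlonglongrightarrow> v ^ c * (1 - v) ^ (m - c) * (1 - v)"
      by (intro tendsto_mult Suc.IH lim1 c)
    then have "(\<lambda>j. trace_frequency (N j) (k j) (Suc m) c) \<longlonglongrightarrow> v ^ c * (1 - v) ^ (m - c) * (1 - v)"
      by (rule Lim_transform_eventually) (rule eventually_mono[OF pos], simp add: trace_frequency_Suc(1))
    then show ?thesis using c by (simp add: Suc_diff_le mult_ac)
  qed
qed

lemma sampled_weight_limit:
  fixes N k :: "nat \<Rightarrow> nat"
  assumes N: "filterlim N at_top sequentially" and k: "\<And>j. k j \<le> N j"
    and v: "(\<lambda>j. real (k j) / real (N j)) \<longlonglongrightarrow> v"
  shows "(\<lambda>j. sampled_weight m t (N j) (k j)) \<longlonglongrightarrow> bernoulli_weight m t v"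
proof -
  have "(\<lambda>j. \<Sum>C\<in>Pow {1..m}. t C * trace_frequency (N j) (k j) m (card C)) \<longlonglongrightarrow> bernoulli_weight m t v"
    unfolding bernoulli_weight_def
    by (intro tendsto_intros trace_frequency_limit[OF N k v]) (use card_mono[of "{1..m}"] in auto)
  moreover have "eventually (\<lambda>j. m \<le> N j) sequentially"
    using filterlim_at_top[THEN iffD1, OF N] by blast
  then have "eventually (\<lambda>j. (\<Sum>C\<in>Pow {1..m}. t C * trace_frequency (N j) (k j) m (card C)) =
      sampled_weight m t (N j) (k j)) sequentially"
    by (rule eventually_mono) (simp add: sampled_weight_trace_frequency)
  ultimately show ?thesis by (rule Lim_transform_eventually)
qed

lemma bernoulli_weight_bounds:
  assumes t: "unit_weight t" and v: "0 \<le> v" "v \<le> 1"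
  shows "0 \<le> bernoulli_weight m t v" "bernoulli_weight m t v \<le> 1"
proof -
  show "0 \<le> bernoulli_weight m t v"
    using t v by (auto simp: bernoulli_weight_def unit_weight_def intro!: sum_nonneg)
  have "bernoulli_weight m t v \<le> (\<Sum>C\<in>Pow {1..m}. 1 * (v ^ card C * (1 - v) ^ (m - card C)))"
    unfolding bernoulli_weight_def using t v by (intro sum_mono mult_right_mono) (auto simp: unit_weight_def)
  also have "\<dots> = (\<Prod>n\<in>{1..m}. v + (1 - v))"
    by (subst prod_add) (auto intro!: sum.cong simp: card_Diff_subset finite_subset)
  finally show "bernoulli_weight m t v \<le> 1" by simp
qed

section \<open>Ranked feature sizes\<close>

definition rank_sizes :: "nat set multiset \<Rightarrow> nat list" where
  "rank_sizes f = rev (sorted_list_of_multiset (image_mset card f))"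

text \<open>Padding with 0 turns a finite allocation into an infinite sequence of
  frequencies.\<close>

definition ranked_freq :: "nat \<Rightarrow> nat set multiset \<Rightarrow> nat \<Rightarrow> real" where
  "ranked_freq N f k = (if k < length (rank_sizes f) then rank_sizes f ! k / N else 0)"

definition top_mass :: "nat \<Rightarrow> nat \<Rightarrow> nat set multiset \<Rightarrow> real" where
  "top_mass r N f = sum_list (take r (rank_sizes f)) / N"

definition total_mass :: "nat \<Rightarrow> nat set multiset \<Rightarrow> real" where
  "total_mass N f = sum_list (rank_sizes f) / N"

lemma mset_rank_sizes [simp]: "mset (rank_sizes f) = image_mset card f"
  by (simp add: rank_sizes_def)

lemma sorted_rank_sizes: "sorted_wrt (\<ge>) (rank_sizes f)"
  by (simp add: rank_sizes_def sorted_wrt_rev)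

lemma sum_list_rank_sizes: "sum_list (rank_sizes f) = (\<Sum>A\<in>#f. card A)"
  by (metis mset_rank_sizes sum_mset_sum_list)

lemma rank_sizes_le:
  assumes "f \<in> feature_allocs N" "x \<in> set (rank_sizes f)"
  shows "x \<le> N"
proof -
  have "set (rank_sizes f) = card ` set_mset f"
    by (metis mset_rank_sizes set_mset_mset set_image_mset)
  then obtain A where "A \<in># f" "x = card A" using assms(2) by auto
  then show ?thesis using assms(1) card_mono[of "{1..N}" A] by (auto simp: feature_allocs_def)
qed

lemma top_mass_Suc: "top_mass (Suc k) N f = top_mass k N f + ranked_freq N f k"
  by (simp add: top_mass_def ranked_freq_def take_Suc_conv_app_nth add_divide_distrib)

lemma top_mass_0 [simp]: "top_mass 0 N f = 0"
  by (simp add: top_mass_def)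

lemma top_mass_eq_sum: "top_mass r N f = (\<Sum>k<r. ranked_freq N f k)"
  by (induction r) (simp_all add: top_mass_Suc)

lemma ranked_freq_bounds:
  assumes "f \<in> feature_allocs N"
  shows "0 \<le> ranked_freq N f k" "ranked_freq N f k \<le> 1"
  using rank_sizes_le[OF assms, OF nth_mem, of k] by (auto simp: ranked_freq_def divide_le_eq_1)

lemma ranked_freq_antimono: "k \<le> l \<Longrightarrow> ranked_freq N f l \<le> ranked_freq N f k"
  using sorted_wrt_nth_less[OF sorted_rank_sizes, of k l f]
  by (cases "k = l") (auto simp: ranked_freq_def intro!: divide_right_mono)

lemma top_mass_bounds:
  assumes "f \<in> feature_allocs N"
  shows "0 \<le> top_mass r N f" "top_mass r N f \<le> r"
proof -
  show "0 \<le> top_mass r N f" by (simp add: top_mass_def)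
  have "top_mass r N f \<le> (\<Sum>k<r. 1)"
    unfolding top_mass_eq_sum by (intro sum_mono ranked_freq_bounds[OF assms])
  then show "top_mass r N f \<le> r" by simp
qed

text \<open>Greedy exchange: remove the head \<open>x\<close> from \<open>g\<close> if it occurs
  there, and otherwise any element of \<open>g\<close>, which is at most \<open>x\<close>. What is
  left fits into the tail with one place fewer.\<close>

lemma sum_mset_le_take_sorted:
  fixes xs :: "nat list"
  assumes "sorted_wrt (\<ge>) xs" "g \<subseteq># mset xs" "size g \<le> r"
  shows "sum_mset g \<le> sum_list (take r xs)"
  using assms
proof (induction xs arbitrary: g r)
  case (Cons x xs)
  show ?case
  proof (cases "g = {#}")
    case False
    then have "size g \<noteq> 0" by simp
    with Cons.prems(3) obtain r' where r: "r = Suc r'" by (cases r) auto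
    obtain y g' where g: "g = add_mset y g'" "y \<le> x" "g' \<subseteq># mset xs"
    proof (cases "x \<in># g")
      case True
      then have "g = add_mset x (g - {#x#})" by simp
      moreover have "g - {#x#} \<subseteq># mset xs"
        using Cons.prems(2) by (simp add: subset_eq_diff_conv)
      ultimately show ?thesis using that[of x "g - {#x#}"] by simp
    next
      case x: False
      obtain y where y: "y \<in># g" using False by (meson multiset_nonemptyE)
      have "g \<subseteq># mset xs"
      proof (rule mset_subset_eqI)
        fix z
        show "count g z \<le> count (mset xs) z"
          using mset_subset_eq_count[OF Cons.prems(2), of z] x by (auto simp: not_in_iff split: if_splits)
      qed
      then have "y \<le> x" "g - {#y#} \<subseteq># mset xs"
        using Cons.prems(1) y mset_subset_eqD[OF _ y, of "mset xs"]
        by (auto intro: subset_mset.order_trans[OF diff_subset_eq_self])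
      moreover have "g = add_mset y (g - {#y#})" using y by simp
      ultimately show ?thesis using that by blast
    qed
    have "sum_mset g' \<le> sum_list (take r' xs)"
      using Cons.prems(1,3) g r by (intro Cons.IH) auto
    with g r show ?thesis by simp
  qed simp
qed simp

text \<open>With \<open>top_sizes_attained\<close> this exhibits the sum of the \<open>r\<close>
  largest sizes as a maximum over choices of at most \<open>r\<close> features, a form that can be
  followed through rotation and restriction.\<close>

lemma sum_sizes_le_top:
  assumes "g \<subseteq># f" "size g \<le> r"
  shows "(\<Sum>A\<in>#g. card A) \<le> sum_list (take r (rank_sizes f))"
  using assms by (intro sum_mset_le_take_sorted sorted_rank_sizes) (auto intro: image_mset_subseteq_mono)

text \<open>The maximiser consists of features and not merely of sizes, because its members are
  going to be rotated and restricted.\<close>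

lemma top_sizes_attained:
  obtains g where "g \<subseteq># f" "size g \<le> r" "(\<Sum>A\<in>#g. card A) = sum_list (take r (rank_sizes f))"
proof -
  obtain xs where xs: "mset xs = f" using ex_mset by blast
  define ys where "ys = rev (sort_key card xs)"
  have ys: "mset ys = f" by (simp add: ys_def xs)
  have "sort (map card xs) = map card (sort_key card xs)"
    by (rule properties_for_sort) simp_all
  then have "rank_sizes f = map card ys"
    unfolding rank_sizes_def ys_def rev_map[symmetric] xs[symmetric]
    by (simp flip: mset_map)
  moreover have "mset (take r ys) \<subseteq># f"
    by (metis ys append_take_drop_id mset_append mset_subset_eq_add_left)
  ultimately show ?thesis
    using that[of "mset (take r ys)"] by (simp add: take_map flip: mset_map sum_mset_sum_list)
qed

lemma total_mass_eq: "total_mass N f = (\<Sum>A\<in>#f. real (card A) / N)"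
proof -
  have "(\<Sum>A\<in>#f. real (card A) / N) = real (\<Sum>A\<in>#f. card A) / N"
    by (induction f) (auto simp: add_divide_distrib)
  then show ?thesis by (simp add: total_mass_def sum_list_rank_sizes)
qed

text \<open>Rotation by \<open>j\<close>; the \<open>n - 1\<close> and \<open>Suc\<close> pass
  between \<open>{1..N}\<close> and the residues modulo \<open>N\<close>. As \<open>j\<close> runs
  through \<open>{..<N}\<close>, every index visits every position exactly once, so \<open>N\<close>
  rotations average as well as all permutations would.\<close>

definition cyclic_shift :: "nat \<Rightarrow> nat \<Rightarrow> nat \<Rightarrow> nat" where
  "cyclic_shift N j n = (if n \<in> {1..N} then Suc ((n - 1 + j) mod N) else n)"

lemma mod_add_cancel_less:
  fixes a b j N :: nat
  assumes "a < N" "b < N" "(a + j) mod N = (b + j) mod N"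
  shows "a = b"
  using assms
proof (induction a b rule: linorder_wlog)
  case (le a b)
  then have "N dvd (b + j) - (a + j)"
    by (intro mod_eq_dvd_iff_nat[THEN iffD1]) auto
  with le show ?case using nat_dvd_not_less[of "b - a" N] by (cases "a = b") auto
qed auto

lemma cyclic_shift_permutes: "cyclic_shift N j permutes {1..N}"
proof (rule bij_imp_permutes)
  have "cyclic_shift N j ` {1..N} \<subseteq> {1..N}"
    by (auto simp: cyclic_shift_def Suc_le_eq)
  moreover have "inj_on (cyclic_shift N j) {1..N}"
  proof (rule inj_onI)
    fix a b assume ab: "a \<in> {1..N}" "b \<in> {1..N}" "cyclic_shift N j a = cyclic_shift N j b"
    then have "(a - 1 + j) mod N = (b - 1 + j) mod N" by (simp add: cyclic_shift_def)
    then have "a - 1 = b - 1"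
      by (rule mod_add_cancel_less[rotated 2]) (use ab in auto)
    with ab show "a = b" by auto
  qed
  ultimately show "bij_betw (cyclic_shift N j) {1..N} {1..N}"
    by (simp add: bij_betw_def endo_inj_surj)
qed (auto simp: cyclic_shift_def)

text \<open>For fixed \<open>a\<close> the position is a bijective function of \<open>j\<close> on
  the residues modulo \<open>N'\<close>, so each of the \<open>N\<close> initial positions is hit
  exactly once.\<close>

lemma card_shifts_into_initial:
  assumes a: "a \<in> {1..N'}" and N: "N \<le> N'"
  shows "card {j \<in> {..<N'}. cyclic_shift N' j a \<in> {1..N}} = N"
proof -
  let ?h = "\<lambda>j. (a - 1 + j) mod N'"
  have inj: "inj_on ?h {..<N'}"
  proof (rule inj_onI)
    fix i j assume ij: "i \<in> {..<N'}" "j \<in> {..<N'}" "?h i = ?h j"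
    from ij(3) have "(i + (a - 1)) mod N' = (j + (a - 1)) mod N'" by (simp only: add.commute)
    then show "i = j" by (rule mod_add_cancel_less[rotated 2]) (use ij in auto)
  qed
  moreover have "?h ` {..<N'} \<subseteq> {..<N'}" using a by auto
  ultimately have surj: "?h ` {..<N'} = {..<N'}" by (simp add: endo_inj_surj)
  have "bij_betw ?h {j \<in> {..<N'}. ?h j < N} {..<N}"
    unfolding bij_betw_def
  proof
    show "inj_on ?h {j \<in> {..<N'}. ?h j < N}" by (rule inj_on_subset[OF inj]) auto
    show "?h ` {j \<in> {..<N'}. ?h j < N} = {..<N}"
    proof (intro equalityI subsetI)
      fix y assume "y \<in> {..<N}"
      then have "y \<in> ?h ` {..<N'}" unfolding surj using N by simp
      then show "y \<in> ?h ` {j \<in> {..<N'}. ?h j < N}" using \<open>y \<in> {..<N}\<close> by auto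
    qed auto
  qed
  then have "card {j \<in> {..<N'}. ?h j < N} = N" by (simp add: bij_betw_same_card)
  moreover have "{j \<in> {..<N'}. cyclic_shift N' j a \<in> {1..N}} = {j \<in> {..<N'}. ?h j < N}"
    using a by (auto simp: cyclic_shift_def)
  ultimately show ?thesis by simp
qed

text \<open>Double counting of the pairs of an element of \<open>A\<close> and a rotation that
  carries it into \<open>{1..N}\<close>.\<close>

lemma sum_card_shifted_trace:
  assumes A: "A \<subseteq> {1..N'}" and N: "N \<le> N'"
  shows "(\<Sum>j<N'. card (cyclic_shift N' j ` A \<inter> {1..N})) = N * card A"
proof -
  have fin: "finite A" using A finite_subset by blast
  have trace: "card (cyclic_shift N' j ` A \<inter> {1..N}) = (\<Sum>a\<in>A. if cyclic_shift N' j a \<in> {1..N} then 1 else 0)" for j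
  proof -
    have "cyclic_shift N' j ` A \<inter> {1..N} = cyclic_shift N' j ` {a \<in> A. cyclic_shift N' j a \<in> {1..N}}" by auto
    then have "card (cyclic_shift N' j ` A \<inter> {1..N}) = card {a \<in> A. cyclic_shift N' j a \<in> {1..N}}"
      using permutes_inj[OF cyclic_shift_permutes[of N' j]] by (simp add: card_image inj_on_subset)
    then show ?thesis using fin by (simp add: sum.If_cases Int_def)
  qed
  have "(\<Sum>j<N'. card (cyclic_shift N' j ` A \<inter> {1..N})) =
      (\<Sum>a\<in>A. \<Sum>j<N'. if cyclic_shift N' j a \<in> {1..N} then 1 else 0)"
    unfolding trace by (rule sum.swap)
  also have "\<dots> = (\<Sum>a\<in>A. N)"
  proof (rule sum.cong[OF refl])
    fix a assume "a \<in> A"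
    then have "card {j \<in> {..<N'}. cyclic_shift N' j a \<in> {1..N}} = N"
      using A N by (intro card_shifts_into_initial) auto
    then show "(\<Sum>j<N'. if cyclic_shift N' j a \<in> {1..N} then 1 else 0) = N"
      by (simp add: sum.If_cases Int_def)
  qed
  finally show ?thesis by (simp add: mult.commute)
qed

abbreviation relabel :: "(nat \<Rightarrow> nat) \<Rightarrow> nat set multiset \<Rightarrow> nat set multiset" where
  "relabel \<sigma> f \<equiv> image_mset (\<lambda>A. \<sigma> ` A) f"

lemma relabel_in_feature_allocs:
  assumes s: "\<sigma> permutes {1..N}" and f: "f \<in> feature_allocs N"
  shows "relabel \<sigma> f \<in> feature_allocs N"
proof -
  have "\<sigma> ` A \<subseteq> {1..N}" if "A \<subseteq> {1..N}" for A
    using image_mono[OF that, of \<sigma>] permutes_image[OF s] by simp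
  then show ?thesis using f by (simp add: feature_allocs_def)
qed

lemma restrict_alloc_in_feature_allocs: "restrict_alloc m f \<in> feature_allocs m"
  by (auto simp: feature_allocs_def restrict_alloc_def)

lemma rank_sizes_relabel:
  assumes "\<sigma> permutes S"
  shows "rank_sizes (relabel \<sigma> f) = rank_sizes f"
proof -
  have "image_mset card (relabel \<sigma> f) = image_mset card f"
    using permutes_inj[OF assms]
    by (auto simp: image_mset.compositionality card_image inj_on_subset intro!: image_mset_cong)
  then show ?thesis by (simp add: rank_sizes_def)
qed

lemma sum_restrict_alloc: "(\<Sum>A\<in>#restrict_alloc m f. card A) = (\<Sum>A\<in>#f. card (A \<inter> {1..m}))"
  by (induction f) (auto simp: restrict_alloc_def)

lemma sum_shifted_sizes:
  assumes "\<forall>A\<in>#g. A \<subseteq> {1..N'}" "N \<le> N'"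
  shows "(\<Sum>j<N'. \<Sum>A\<in>#g. card (cyclic_shift N' j ` A \<inter> {1..N})) = N * (\<Sum>A\<in>#g. card A)"
  using assms(1)
  by (induction g) (simp_all add: sum.distrib sum_card_shifted_trace[OF _ assms(2)] distrib_left del: One_nat_def)

text \<open>Fix \<open>r\<close> features that attain the top mass of \<open>f\<close>. After each
  rotation and restriction at most \<open>r\<close> of them remain, so their sizes are bounded by
  the top mass there, while their total over all rotations is exact by
  \<open>sum_shifted_sizes\<close>.\<close>

lemma top_mass_average:
  assumes f: "f \<in> feature_allocs N'" and N: "1 \<le> N" "N \<le> N'"
  shows "real N' * top_mass r N' f \<le> (\<Sum>j<N'. top_mass r N (restrict_alloc N (relabel (cyclic_shift N' j) f)))"
proof -
  obtain g where g: "g \<subseteq># f" "size g \<le> r" "(\<Sum>A\<in>#g. card A) = sum_list (take r (rank_sizes f))"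
    by (rule top_sizes_attained)
  have gN: "\<forall>A\<in>#g. A \<subseteq> {1..N'}"
    using f g(1) by (auto simp: feature_allocs_def dest: mset_subset_eqD)
  have "real N * (real N' * top_mass r N' f) = real N * real (\<Sum>A\<in>#g. card A)"
    using N by (simp add: top_mass_def g(3))
  also have "\<dots> = real (\<Sum>j<N'. \<Sum>A\<in>#g. card (cyclic_shift N' j ` A \<inter> {1..N}))"
    unfolding sum_shifted_sizes[OF gN N(2)] by simp
  also have "\<dots> \<le> real (\<Sum>j<N'. sum_list (take r (rank_sizes (restrict_alloc N (relabel (cyclic_shift N' j) f)))))"
  proof (intro of_nat_mono sum_mono)
    fix j
    let ?s = "\<lambda>f. restrict_alloc N (relabel (cyclic_shift N' j) f)"
    have "?s g \<subseteq># ?s f"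
      unfolding restrict_alloc_def
      by (intro multiset_filter_mono image_mset_subseteq_mono g)
    moreover have "size (?s g) \<le> r"
      unfolding restrict_alloc_def
      by (rule order.trans[OF size_filter_mset_lesseq]) (simp add: g(2))
    ultimately have "(\<Sum>A\<in>#?s g. card A) \<le> sum_list (take r (rank_sizes (?s f)))"
      by (rule sum_sizes_le_top)
    then show "(\<Sum>A\<in>#g. card (cyclic_shift N' j ` A \<inter> {1..N})) \<le> sum_list (take r (rank_sizes (?s f)))"
      unfolding sum_restrict_alloc by (simp add: image_mset.compositionality o_def)
  qed
  also have "\<dots> = real N * (\<Sum>j<N'. top_mass r N (restrict_alloc N (relabel (cyclic_shift N' j) f)))"
    using N by (simp add: top_mass_def sum_distrib_left)
  finally show ?thesis using N by simp
qed

text \<open>The mean of the total masses of the rotated restrictions equals that of \<open>f\<close>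
  exactly; the convexity of \<open>exp (- x)\<close> then gives Jensen's inequality.\<close>

lemma exp_total_mass_average:
  assumes f: "f \<in> feature_allocs N'" and N: "1 \<le> N" "N \<le> N'"
  shows "real N' * exp (- total_mass N' f) \<le>
    (\<Sum>j<N'. exp (- total_mass N (restrict_alloc N (relabel (cyclic_shift N' j) f))))"
proof -
  let ?s = "total_mass N' f"
  let ?x = "\<lambda>j. total_mass N (restrict_alloc N (relabel (cyclic_shift N' j) f))"
  have "(\<Sum>j<N'. ?x j) = real (\<Sum>j<N'. \<Sum>A\<in>#f. card (cyclic_shift N' j ` A \<inter> {1..N})) / N"
    by (simp add: total_mass_def sum_list_rank_sizes sum_restrict_alloc image_mset.compositionality o_def
        flip: sum_divide_distrib)
  also have "\<dots> = real N' * ?s"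
    using f N by (subst sum_shifted_sizes) (auto simp: feature_allocs_def total_mass_def sum_list_rank_sizes)
  finally have sum_x: "(\<Sum>j<N'. ?x j) = real N' * ?s" .
  \<comment> \<open>the tangent of \<open>exp (- x)\<close> at \<open>?s\<close> lies below the graph\<close>
  have "exp (- ?s) * (1 - (?x j - ?s)) \<le> exp (- ?x j)" for j
  proof -
    have "exp (- ?s) * (1 + (?s - ?x j)) \<le> exp (- ?s) * exp (?s - ?x j)"
      by (intro mult_left_mono exp_ge_add_one_self) auto
    then show ?thesis by (simp add: algebra_simps flip: exp_add)
  qed
  then have "(\<Sum>j<N'. exp (- ?s) * (1 - (?x j - ?s))) \<le> (\<Sum>j<N'. exp (- ?x j))"
    by (intro sum_mono)
  moreover have "(\<Sum>j<N'. exp (- ?s) * (1 - (?x j - ?s))) = real N' * exp (- ?s)"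
    unfolding sum_distrib_left[symmetric] sum_subtractf sum_x by simp
  ultimately show ?thesis by simp
qed

section \<open>Convergence along one subsequence from decreasing second moments\<close>

context prob_space
begin

text \<open>The hypothesis on correlations is all that is used of a reverse submartingale. It bounds
  the expected squared difference by the difference of the second moments; these decrease and stay
  nonnegative, hence converge. Bounded summable first-moment steps along a subsequence then give
  almost sure convergence.\<close>

lemma L2_decreasing_convergent_subsequence:
  fixes X :: "nat \<Rightarrow> nat \<Rightarrow> 'a \<Rightarrow> real"
  assumes meas: "\<And>r N. 1 \<le> N \<Longrightarrow> X r N \<in> borel_measurable M"
    and bound: "\<And>r N \<omega>. 1 \<le> N \<Longrightarrow> \<omega> \<in> space M \<Longrightarrow> \<bar>X r N \<omega>\<bar> \<le> C r"
    and corr: "\<And>r N N'. 1 \<le> N \<Longrightarrow> N \<le> N' \<Longrightarrow>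
      expectation (\<lambda>\<omega>. X r N' \<omega> * X r N' \<omega>) \<le> expectation (\<lambda>\<omega>. X r N \<omega> * X r N' \<omega>)"
  obtains n :: "nat \<Rightarrow> nat" where "\<And>j. j < n j" "AE \<omega> in M. \<forall>r. convergent (\<lambda>j. X r (n j) \<omega>)"
proof -
  \<comment> \<open>The index is raised by one throughout, since the hypotheses start at 1.\<close>
  define a where "a r N = expectation (\<lambda>\<omega>. X r (Suc N) \<omega> * X r (Suc N) \<omega>)" for r N
  have int: "integrable M (\<lambda>\<omega>. X r N \<omega> * X r N' \<omega>)" if "1 \<le> N" "1 \<le> N'" for r N N'
  proof (rule integrable_const_bound[where B = "C r * C r"])
    show "AE \<omega> in M. norm (X r N \<omega> * X r N' \<omega>) \<le> C r * C r"
    proof (rule AE_I2)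
      fix \<omega> assume w: "\<omega> \<in> space M"
      have "0 \<le> C r" using bound[OF that(1) w, of r] by linarith
      then show "norm (X r N \<omega> * X r N' \<omega>) \<le> C r * C r"
        using bound[OF that(1) w, of r] bound[OF that(2) w, of r] by (auto simp: abs_mult intro!: mult_mono)
    qed
  qed (use meas that in measurable)
  have d2: "expectation (\<lambda>\<omega>. (X r (Suc N) \<omega> - X r (Suc N') \<omega>)\<^sup>2) \<le> a r N - a r N'" if "N \<le> N'" for r N N'
  proof -
    have "expectation (\<lambda>\<omega>. (X r (Suc N) \<omega> - X r (Suc N') \<omega>)\<^sup>2) =
        expectation (\<lambda>\<omega>. X r (Suc N) \<omega> * X r (Suc N) \<omega> + X r (Suc N') \<omega> * X r (Suc N') \<omega>
          - 2 * (X r (Suc N) \<omega> * X r (Suc N') \<omega>))"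
      by (intro Bochner_Integration.integral_cong refl) (simp add: power2_eq_square algebra_simps)
    also have "\<dots> = a r N + a r N' - 2 * expectation (\<lambda>\<omega>. X r (Suc N) \<omega> * X r (Suc N') \<omega>)"
      by (simp add: int a_def)
    also have "\<dots> \<le> a r N - a r N'"
      using corr[of "Suc N" "Suc N'" r] that by (simp add: a_def)
    finally show ?thesis .
  qed
  have dec: "decseq (a r)" for r
  proof (rule antimonoI)
    fix N N' :: nat assume "N \<le> N'"
    have "0 \<le> expectation (\<lambda>\<omega>. (X r (Suc N) \<omega> - X r (Suc N') \<omega>)\<^sup>2)"
      by (rule integral_nonneg_AE) simp
    with d2[OF \<open>N \<le> N'\<close>, of r] show "a r N' \<le> a r N" by linarith
  qed
  have "0 \<le> a r N" for r N
    unfolding a_def by (rule integral_nonneg_AE) simp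
  then have "Cauchy (a r)" for r
    using decseq_convergent[OF dec[of r], of 0] by (metis LIMSEQ_imp_Cauchy)
  then have "\<exists>K. \<forall>p\<ge>K. \<forall>q\<ge>K. \<bar>a r p - a r q\<bar> < (1/4) ^ j" for r j
    unfolding Cauchy_def dist_real_def by simp
  \<comment> \<open>The bound \<open>(1/4) ^ j\<close> on second moments leaves
    \<open>(1/2) ^ j\<close> for first moments, which is summable.\<close>
  then obtain K where K: "\<And>r j p q. K r j \<le> p \<Longrightarrow> K r j \<le> q \<Longrightarrow> \<bar>a r p - a r q\<bar> < (1/4) ^ j"
    by metis
  \<comment> \<open>A diagonal choice: \<open>n j\<close> exceeds all thresholds
    \<open>K r i\<close> with \<open>r\<close> and \<open>i\<close> up to \<open>j\<close>, so one
    sequence serves every \<open>r\<close>; the summand \<open>j\<close> forces it to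
    infinity.\<close>
  define n where "n j = (\<Sum>r\<le>j. \<Sum>i\<le>j. K r i) + j" for j
  have n_ge: "K r j \<le> n i" if "r \<le> j" "j \<le> i" for r j i
  proof -
    have "K r j \<le> (\<Sum>i\<le>i. K r i)" using that by (intro member_le_sum) auto
    also have "\<dots> \<le> (\<Sum>r\<le>i. \<Sum>i\<le>i. K r i)"
      using that by (intro member_le_sum[of r "{..i}" "\<lambda>r. \<Sum>i\<le>i. K r i"]) auto
    finally show ?thesis by (simp add: n_def)
  qed
  have n_mono: "n j \<le> n (Suc j)" for j
  proof -
    have "(\<Sum>r\<le>j. \<Sum>i\<le>j. K r i) \<le> (\<Sum>r\<le>j. \<Sum>i\<le>Suc j. K r i)"
      by (intro sum_mono) simp
    also have "\<dots> \<le> (\<Sum>r\<le>Suc j. \<Sum>i\<le>Suc j. K r i)" by simp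
    finally show ?thesis by (simp add: n_def)
  qed
  have step: "expectation (\<lambda>\<omega>. \<bar>X r (Suc (n (Suc j))) \<omega> - X r (Suc (n j)) \<omega>\<bar>) \<le> (1/2) ^ j"
    if "r \<le> j" for r j
  proof -
    let ?d = "\<lambda>\<omega>. X r (Suc (n j)) \<omega> - X r (Suc (n (Suc j))) \<omega>"
    have intd: "integrable M (\<lambda>\<omega>. (?d \<omega>)\<^sup>2)"
    proof -
      have "(\<lambda>\<omega>. (?d \<omega>)\<^sup>2) = (\<lambda>\<omega>. X r (Suc (n j)) \<omega> * X r (Suc (n j)) \<omega>
          + X r (Suc (n (Suc j))) \<omega> * X r (Suc (n (Suc j))) \<omega>
          - 2 * (X r (Suc (n j)) \<omega> * X r (Suc (n (Suc j))) \<omega>))"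
        by (auto simp: power2_eq_square algebra_simps)
      then show ?thesis by (simp add: int)
    qed
    have "expectation (\<lambda>\<omega>. (?d \<omega>)\<^sup>2) \<le> a r (n j) - a r (n (Suc j))"
      by (rule d2[OF n_mono])
    also have "\<dots> \<le> (1/4) ^ j"
      using K[of r j "n j" "n (Suc j)"] n_ge[of r j j] n_ge[of r j "Suc j"] that by simp
    finally have sq: "expectation (\<lambda>\<omega>. (?d \<omega>)\<^sup>2) \<le> (1/4) ^ j" .
    have "expectation (\<lambda>\<omega>. \<bar>X r (Suc (n (Suc j))) \<omega> - X r (Suc (n j)) \<omega>\<bar>) \<le>
        expectation (\<lambda>\<omega>. ((1/2) ^ j + 2 ^ j * (?d \<omega>)\<^sup>2) / 2)"
    proof (rule integral_mono_AE')
      show "AE \<omega> in M. \<bar>X r (Suc (n (Suc j))) \<omega> - X r (Suc (n j)) \<omega>\<bar> \<le> ((1/2) ^ j + 2 ^ j * (?d \<omega>)\<^sup>2) / 2"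
      proof (rule AE_I2)
        fix \<omega>
        \<comment> \<open>AM-GM: \<open>2 \<bar>d\<bar> \<le> c + d\<^sup>2 / c\<close> with \<open>c = 2^(-j)\<close>\<close>
        have "0 \<le> 2 ^ j * (\<bar>?d \<omega>\<bar> - (1/2) ^ j)\<^sup>2" by simp
        also have "\<dots> = 2 ^ j * (?d \<omega>)\<^sup>2 + (1/2) ^ j - 2 * \<bar>?d \<omega>\<bar>"
          by (simp add: power2_diff power_one_over field_simps power2_eq_square)
        finally show "\<bar>X r (Suc (n (Suc j))) \<omega> - X r (Suc (n j)) \<omega>\<bar> \<le> ((1/2) ^ j + 2 ^ j * (?d \<omega>)\<^sup>2) / 2"
          by (simp add: abs_minus_commute)
      qed
    qed (use intd in auto)
    also have "\<dots> = ((1/2) ^ j + 2 ^ j * expectation (\<lambda>\<omega>. (?d \<omega>)\<^sup>2)) / 2"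
      using intd by (simp add: prob_space)
    also have "\<dots> \<le> ((1/2) ^ j + 2 ^ j * (1/4) ^ j) / 2"
      using sq by (intro divide_right_mono add_left_mono mult_left_mono) auto
    also have "\<dots> = (1/2) ^ j"
    proof -
      have "(2::real) ^ j * (1/4) ^ j = (1/2) ^ j" by (simp flip: power_mult_distrib)
      then show ?thesis by simp
    qed
    finally show ?thesis .
  qed
  have "AE \<omega> in M. convergent (\<lambda>j. X r (Suc (n j)) \<omega>)" for r
  proof -
    \<comment> \<open>The step bound holds for \<open>j\<close> at least \<open>r\<close> only,
      hence the offset by \<open>r\<close>, which is removed again at the end.\<close>
    let ?e = "\<lambda>j \<omega>. \<bar>X r (Suc (n (Suc (j + r)))) \<omega> - X r (Suc (n (j + r))) \<omega>\<bar>"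
    have [measurable]: "X r (Suc N) \<in> borel_measurable M" for N by (simp add: meas)
    have inte: "integrable M (?e j)" for j
    proof (rule integrable_const_bound[where B = "C r + C r"])
      show "AE \<omega> in M. norm (?e j \<omega>) \<le> C r + C r"
      proof (rule AE_I2)
        fix \<omega> assume w: "\<omega> \<in> space M"
        show "norm (?e j \<omega>) \<le> C r + C r"
          using bound[OF _ w, of "Suc (n (Suc (j + r)))" r] bound[OF _ w, of "Suc (n (j + r))" r]
          by (simp only: real_norm_def abs_abs) linarith
      qed
    qed measurable
    have "(\<integral>\<^sup>+\<omega>. (\<Sum>j. ennreal (?e j \<omega>)) \<partial>M) = (\<Sum>j. \<integral>\<^sup>+\<omega>. ennreal (?e j \<omega>) \<partial>M)"
      by (rule nn_integral_suminf) measurable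
    also have "\<dots> \<le> (\<Sum>j. ennreal ((1/2) ^ j))"
    proof (rule suminf_le)
      fix j
      have "(\<integral>\<^sup>+\<omega>. ennreal (?e j \<omega>) \<partial>M) = ennreal (expectation (?e j))"
        by (rule nn_integral_eq_integral[OF inte]) simp
      also have "\<dots> \<le> ennreal ((1/2) ^ (j + r))"
        by (intro ennreal_leI step) simp
      also have "\<dots> \<le> ennreal ((1/2) ^ j)"
        by (intro ennreal_leI power_decreasing) auto
      finally show "(\<integral>\<^sup>+\<omega>. ennreal (?e j \<omega>) \<partial>M) \<le> ennreal ((1/2) ^ j)" .
    qed auto
    also have "\<dots> < \<infinity>"
      by (subst suminf_ennreal2) (auto simp: summable_geometric)
    finally have "AE \<omega> in M. (\<Sum>j. ennreal (?e j \<omega>)) \<noteq> \<infinity>"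
      by (intro nn_integral_PInf_AE) auto
    then show ?thesis
    proof (rule eventually_mono)
      fix \<omega> assume "(\<Sum>j. ennreal (?e j \<omega>)) \<noteq> \<infinity>"
      then have "summable (\<lambda>j. ?e j \<omega>)" by (intro summable_suminf_not_top) auto
      then have "summable (\<lambda>j. X r (Suc (n (Suc (j + r)))) \<omega> - X r (Suc (n (j + r))) \<omega>)"
        by (rule summable_rabs_cancel)
      then have "convergent (\<lambda>k. \<Sum>j<k. X r (Suc (n (Suc j + r))) \<omega> - X r (Suc (n (j + r))) \<omega>)"
        by (simp add: summable_iff_convergent)
      then have "convergent (\<lambda>k. X r (Suc (n (k + r))) \<omega> - X r (Suc (n (0 + r))) \<omega>)"
        unfolding sum_lessThan_telescope[of "\<lambda>j. X r (Suc (n (j + r))) \<omega>"] .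
      then have "convergent (\<lambda>k. X r (Suc (n (k + r))) \<omega>)"
        using convergent_diff_const_right_iff by blast
      then show "convergent (\<lambda>j. X r (Suc (n j)) \<omega>)"
        unfolding convergent_def using LIMSEQ_offset[where f = "\<lambda>j. X r (Suc (n j)) \<omega>" and k = r] by blast
    qed
  qed
  then have "AE \<omega> in M. \<forall>r. convergent (\<lambda>j. X r (Suc (n j)) \<omega>)"
    by (simp add: AE_all_countable)
  moreover have "j < Suc (n j)" for j by (simp add: n_def)
  ultimately show ?thesis using that[of "\<lambda>j. Suc (n j)"] by blast
qed

end

lemma exchangeable_expectation:
  fixes h :: "nat set multiset \<Rightarrow> real"
  assumes rfa: "random_feature_allocation M F" and ex: "exchangeable_alloc M F"
    and N: "1 \<le> N" and s: "\<sigma> permutes {1..N}"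
  shows "(\<integral>\<omega>. h (relabel \<sigma> (F N \<omega>)) \<partial>M) = (\<integral>\<omega>. h (F N \<omega>) \<partial>M)"
proof -
  have F: "F N \<in> M \<rightarrow>\<^sub>M alloc_space N" using rfa N by (auto simp: random_feature_allocation_def)
  have "(\<lambda>f. relabel \<sigma> f) \<in> alloc_space N \<rightarrow>\<^sub>M alloc_space N"
    by (auto intro: relabel_in_feature_allocs[OF s])
  then have F': "(\<lambda>\<omega>. relabel \<sigma> (F N \<omega>)) \<in> M \<rightarrow>\<^sub>M alloc_space N"
    by (rule measurable_compose[OF F])
  have "distr M (alloc_space N) (F N) = distr M (alloc_space N) (\<lambda>\<omega>. relabel \<sigma> (F N \<omega>))"
    using ex N s by (auto simp: exchangeable_alloc_def)
  then have "(\<integral>f. h f \<partial>distr M (alloc_space N) (F N)) =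
      (\<integral>f. h f \<partial>distr M (alloc_space N) (\<lambda>\<omega>. relabel \<sigma> (F N \<omega>)))" by simp
  then show ?thesis by (simp add: integral_distr[OF F] integral_distr[OF F'])
qed

text \<open>
  Only the cyclic shifts of \<open>{1..N'}\<close> are needed to turn the deterministic averaging inequality into
  the reverse submartingale property of \<open>\<phi> N (F N)\<close>.
\<close>

lemma reverse_submartingale_correlation:
  fixes \<phi> :: "nat \<Rightarrow> nat set multiset \<Rightarrow> real"
  assumes rfa: "random_feature_allocation M F" and ex: "exchangeable_alloc M F"
    and N: "1 \<le> N" "N \<le> N'"
    and bound: "\<And>N f. f \<in> feature_allocs N \<Longrightarrow> 0 \<le> \<phi> N f \<and> \<phi> N f \<le> C"
    and inv: "\<And>\<sigma> f. \<sigma> permutes {1..N'} \<Longrightarrow> \<phi> N' (relabel \<sigma> f) = \<phi> N' f"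
    and avg: "\<And>f. f \<in> feature_allocs N' \<Longrightarrow>
      real N' * \<phi> N' f \<le> (\<Sum>j<N'. \<phi> N (restrict_alloc N (relabel (cyclic_shift N' j) f)))"
  shows "(\<integral>\<omega>. \<phi> N' (F N' \<omega>) * \<phi> N' (F N' \<omega>) \<partial>M) \<le> (\<integral>\<omega>. \<phi> N (F N \<omega>) * \<phi> N' (F N' \<omega>) \<partial>M)"
proof (cases "N = N'")
  case False
  with N have N': "N < N'" "1 \<le> N'" by auto
  interpret prob_space M using rfa by (simp add: random_feature_allocation_def)
  have F: "F N' \<in> M \<rightarrow>\<^sub>M alloc_space N'" using rfa N' by (auto simp: random_feature_allocation_def)
  have FN': "F N' \<omega> \<in> feature_allocs N'" if "\<omega> \<in> space M" for \<omega>
    using measurable_space[OF F that] by simp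
  let ?r = "\<lambda>j f. \<phi> N (restrict_alloc N (relabel (cyclic_shift N' j) f))"
  have C: "0 \<le> C" using bound[OF restrict_alloc_in_feature_allocs, of N] by (meson order.trans)
  have int: "integrable M (\<lambda>\<omega>. \<phi> N (h (F N' \<omega>)) * \<phi> N' (F N' \<omega>))"
    if "\<And>f. h f \<in> feature_allocs N" for h
  proof (rule integrable_const_bound[where B = "C * C"])
    show "AE \<omega> in M. norm (\<phi> N (h (F N' \<omega>)) * \<phi> N' (F N' \<omega>)) \<le> C * C"
      using bound FN' that C by (intro AE_I2) (auto simp: abs_mult intro!: mult_mono)
  qed (rule measurable_mset_fun[OF F, of "\<lambda>f. \<phi> N (h f) * \<phi> N' f"])
  have "real N' * (\<integral>\<omega>. \<phi> N' (F N' \<omega>) * \<phi> N' (F N' \<omega>) \<partial>M) =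
      (\<integral>\<omega>. (real N' * \<phi> N' (F N' \<omega>)) * \<phi> N' (F N' \<omega>) \<partial>M)"
    by (simp add: mult.assoc)
  also have "\<dots> \<le> (\<integral>\<omega>. (\<Sum>j<N'. ?r j (F N' \<omega>)) * \<phi> N' (F N' \<omega>) \<partial>M)"
  proof (rule integral_mono_AE')
    show "integrable M (\<lambda>\<omega>. (\<Sum>j<N'. ?r j (F N' \<omega>)) * \<phi> N' (F N' \<omega>))"
      unfolding sum_distrib_right
      by (intro Bochner_Integration.integrable_sum int restrict_alloc_in_feature_allocs)
    show "AE \<omega> in M. real N' * \<phi> N' (F N' \<omega>) * \<phi> N' (F N' \<omega>) \<le> (\<Sum>j<N'. ?r j (F N' \<omega>)) * \<phi> N' (F N' \<omega>)"
      using avg[OF FN'] bound[OF FN'] by (intro AE_I2 mult_right_mono) auto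
    show "AE \<omega> in M. 0 \<le> (\<Sum>j<N'. ?r j (F N' \<omega>)) * \<phi> N' (F N' \<omega>)"
      using bound[OF FN'] bound[OF restrict_alloc_in_feature_allocs, of N]
      by (intro AE_I2 mult_nonneg_nonneg sum_nonneg) auto
  qed
  also have "\<dots> = (\<Sum>j<N'. \<integral>\<omega>. ?r j (F N' \<omega>) * \<phi> N' (F N' \<omega>) \<partial>M)"
    unfolding sum_distrib_right
    by (intro Bochner_Integration.integral_sum int restrict_alloc_in_feature_allocs)
  \<comment> \<open>The weight \<open>\<phi> N'\<close> is invariant under relabelling, so the
    rotation acts on the whole integrand and exchangeability removes it.\<close>
  also have "\<dots> = (\<Sum>j<N'. \<integral>\<omega>. \<phi> N (restrict_alloc N (F N' \<omega>)) * \<phi> N' (F N' \<omega>) \<partial>M)"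
  proof (rule sum.cong[OF refl])
    fix j
    have p: "cyclic_shift N' j permutes {1..N'}" by (rule cyclic_shift_permutes)
    show "(\<integral>\<omega>. ?r j (F N' \<omega>) * \<phi> N' (F N' \<omega>) \<partial>M) =
        (\<integral>\<omega>. \<phi> N (restrict_alloc N (F N' \<omega>)) * \<phi> N' (F N' \<omega>) \<partial>M)"
      using exchangeable_expectation[OF rfa ex N'(2) p, of "\<lambda>f. \<phi> N (restrict_alloc N f) * \<phi> N' f"]
      by (simp only: inv[OF p])
  qed
  also have "(\<integral>\<omega>. \<phi> N (restrict_alloc N (F N' \<omega>)) * \<phi> N' (F N' \<omega>) \<partial>M) =
      (\<integral>\<omega>. \<phi> N (F N \<omega>) * \<phi> N' (F N' \<omega>) \<partial>M)"
  proof (rule integral_cong_AE)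
    show "AE \<omega> in M. \<phi> N (restrict_alloc N (F N' \<omega>)) * \<phi> N' (F N' \<omega>) = \<phi> N (F N \<omega>) * \<phi> N' (F N' \<omega>)"
    proof -
      have "AE \<omega> in M. F N \<omega> = restrict_alloc N (F N' \<omega>)"
        using rfa N N' unfolding random_feature_allocation_def by blast
      then show ?thesis by (rule eventually_mono) simp
    qed
    have FN: "F N \<in> M \<rightarrow>\<^sub>M alloc_space N" using rfa N by (auto simp: random_feature_allocation_def)
    show "(\<lambda>\<omega>. \<phi> N (F N \<omega>) * \<phi> N' (F N' \<omega>)) \<in> borel_measurable M"
      by (intro borel_measurable_times measurable_mset_fun[OF FN] measurable_mset_fun[OF F])
  qed (rule measurable_mset_fun[OF F, of "\<lambda>f. \<phi> N (restrict_alloc N f) * \<phi> N' f"])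
  finally show ?thesis using N' by simp
qed simp

text \<open>The top mass of rank 0 is constantly 0, so index 0 is free to carry the exponential of
  the total mass; one subsequence then serves all statistics.\<close>

definition mass_statistic :: "nat \<Rightarrow> nat \<Rightarrow> nat set multiset \<Rightarrow> real" where
  "mass_statistic r N f = (if r = 0 then exp (- total_mass N f) else top_mass r N f)"

lemma total_mass_nonneg: "0 \<le> total_mass N f"
  by (simp add: total_mass_def)

lemma mass_statistic_bounds:
  assumes "f \<in> feature_allocs N"
  shows "0 \<le> mass_statistic r N f \<and> mass_statistic r N f \<le> real (max r 1)"
  using top_mass_bounds[OF assms, of r] total_mass_nonneg[of N f]
  by (auto simp: mass_statistic_def)

lemma mass_statistics_converge:
  assumes rfa: "random_feature_allocation M F" and ex: "exchangeable_alloc M F"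
  obtains n :: "nat \<Rightarrow> nat" where "\<And>j. j < n j"
    "AE \<omega> in M. \<forall>r. convergent (\<lambda>j. mass_statistic r (n j) (F (n j) \<omega>))"
proof -
  interpret prob_space M using rfa by (simp add: random_feature_allocation_def)
  have F: "F N \<in> M \<rightarrow>\<^sub>M alloc_space N" if "1 \<le> N" for N
    using rfa that by (auto simp: random_feature_allocation_def)
  show ?thesis
  proof (rule L2_decreasing_convergent_subsequence[of "\<lambda>r N \<omega>. mass_statistic r N (F N \<omega>)" "\<lambda>r. real (max r 1)"])
    fix r N \<omega> assume N: "1 \<le> (N :: nat)"
    show "(\<lambda>\<omega>. mass_statistic r N (F N \<omega>)) \<in> borel_measurable M"
      by (rule measurable_mset_fun[OF F[OF N]])
    assume "\<omega> \<in> space M"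
    then have "F N \<omega> \<in> feature_allocs N" using measurable_space[OF F[OF N]] by simp
    then show "\<bar>mass_statistic r N (F N \<omega>)\<bar> \<le> real (max r 1)"
      using mass_statistic_bounds[of "F N \<omega>" N r] by linarith
  next
    fix r N N' :: nat assume N: "1 \<le> N" "N \<le> N'"
    show "expectation (\<lambda>\<omega>. mass_statistic r N' (F N' \<omega>) * mass_statistic r N' (F N' \<omega>))
        \<le> expectation (\<lambda>\<omega>. mass_statistic r N (F N \<omega>) * mass_statistic r N' (F N' \<omega>))"
    proof (rule reverse_submartingale_correlation[OF rfa ex N mass_statistic_bounds])
      show "mass_statistic r N' (relabel \<sigma> f) = mass_statistic r N' f" if "\<sigma> permutes {1..N'}" for \<sigma> f
        by (simp add: mass_statistic_def top_mass_def total_mass_def rank_sizes_relabel[OF that])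
      show "real N' * mass_statistic r N' f \<le>
          (\<Sum>j<N'. mass_statistic r N (restrict_alloc N (relabel (cyclic_shift N' j) f)))"
        if "f \<in> feature_allocs N'" for f
        using exp_total_mass_average[OF that N] top_mass_average[OF that N, of r]
        by (cases "r = 0") (simp_all add: mass_statistic_def)
    qed
  qed (rule that)
qed

section \<open>The limiting generating function\<close>

text \<open>Conditional generating function of the model given frequencies \<open>v\<close> and rate
  \<open>l\<close>. For \<open>v\<close> in [0,1] and a unit weight the partial products decrease,
  so the limit exists even without summability.\<close>

definition ffm_pgf :: "nat \<Rightarrow> (nat set \<Rightarrow> real) \<Rightarrow> (nat \<Rightarrow> real) \<Rightarrow> real \<Rightarrow> real" where
  "ffm_pgf m t v l =
    lim (\<lambda>K. \<Prod>k<K. bernoulli_weight m t (v k)) * exp (- (singleton_loss m t * l))"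

lemma bernoulli_weight_prod_bounds:
  assumes t: "unit_weight t" and v: "\<And>k. 0 \<le> v k \<and> v k \<le> 1"
  shows "0 \<le> (\<Prod>k\<in>A. bernoulli_weight m t (v k))" "(\<Prod>k\<in>A. bernoulli_weight m t (v k)) \<le> 1"
proof -
  have b: "0 \<le> bernoulli_weight m t (v k) \<and> bernoulli_weight m t (v k) \<le> 1" for k
    using bernoulli_weight_bounds[OF t] v[of k] by blast
  show "0 \<le> (\<Prod>k\<in>A. bernoulli_weight m t (v k))" by (rule prod_nonneg) (simp add: b)
  show "(\<Prod>k\<in>A. bernoulli_weight m t (v k)) \<le> 1" by (rule prod_le_1) (simp add: b)
qed

lemma ffm_pgf_limit:
  assumes t: "unit_weight t" and v: "\<And>k. 0 \<le> v k \<and> v k \<le> 1"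
  shows "(\<lambda>K. (\<Prod>k<K. bernoulli_weight m t (v k)) * exp (- (singleton_loss m t * l))) \<longlonglongrightarrow> ffm_pgf m t v l"
proof -
  let ?p = "\<lambda>K. \<Prod>k<K. bernoulli_weight m t (v k)"
  note b = bernoulli_weight_prod_bounds[where v = v, OF t v]
  have "decseq ?p"
  proof (rule decseq_SucI)
    fix K
    show "?p (Suc K) \<le> ?p K"
      using b(1)[where A = "{..<K}" and m = m] bernoulli_weight_bounds(2)[OF t, of "v K" m] v[of K]
      by (simp add: mult_left_le)
  qed
  then obtain L where "?p \<longlonglongrightarrow> L"
    using b(1)[where m = m] by (elim decseq_convergent[of ?p 0]) auto
  then have "convergent ?p" by (rule convergentI)
  then show ?thesis unfolding ffm_pgf_def
    by (intro tendsto_mult tendsto_const) (simp add: convergent_LIMSEQ_iff)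
qed

lemma sampled_weight_0: "unit_weight t \<Longrightarrow> sampled_weight m t N 0 = 1"
proof -
  assume t: "unit_weight t"
  have "subsets_of_size N 0 = {{}}"
    by (auto simp: subsets_of_size_def dest: finite_subset)
  then show ?thesis using t by (simp add: sampled_weight_def unit_weight_def)
qed

section \<open>Separating the largest features from the small ones\<close>

definition ranked_size :: "nat set multiset \<Rightarrow> nat \<Rightarrow> nat" where
  "ranked_size f k = (if k < length (rank_sizes f) then rank_sizes f ! k else 0)"

lemma ranked_freq_eq: "ranked_freq N f k = real (ranked_size f k) / real N"
  by (simp add: ranked_freq_def ranked_size_def)

text \<open>The condition \<open>h 0 = 1\<close> makes the padding with size 0 harmless when there
  are fewer than \<open>r\<close> features.\<close>

lemma prod_take_rank_sizes:
  fixes h :: "nat \<Rightarrow> real"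
  assumes "h 0 = 1"
  shows "(\<Prod>x\<leftarrow>take r (rank_sizes f). h x) = (\<Prod>k<r. h (ranked_size f k))"
proof (induction r)
  case (Suc r)
  show ?case
    using Suc assms by (cases "r < length (rank_sizes f)") (simp_all add: take_Suc_conv_app_nth ranked_size_def)
qed simp

lemma prod_list_diff_le:
  fixes g h :: "'b \<Rightarrow> real"
  assumes "\<And>x. x \<in> set xs \<Longrightarrow> 0 \<le> g x \<and> g x \<le> 1 \<and> 0 \<le> h x \<and> h x \<le> 1"
  shows "\<bar>(\<Prod>x\<leftarrow>xs. g x) - (\<Prod>x\<leftarrow>xs. h x)\<bar> \<le> (\<Sum>x\<leftarrow>xs. \<bar>g x - h x\<bar>)"
  using assms
proof (induction xs)
  case (Cons x xs)
  let ?G = "\<Prod>x\<leftarrow>xs. g x" and ?H = "\<Prod>x\<leftarrow>xs. h x"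
  have "0 \<le> ?H \<and> ?H \<le> 1"
    using prod_mset_unit_interval[of "mset xs" h] Cons.prems by (simp flip: prod_mset_prod_list)
  have gx: "0 \<le> g x" "g x \<le> 1" using Cons.prems by auto
  have "g x * ?G - h x * ?H = g x * (?G - ?H) + (g x - h x) * ?H" by (simp add: algebra_simps)
  then have "\<bar>g x * ?G - h x * ?H\<bar> \<le> g x * \<bar>?G - ?H\<bar> + \<bar>g x - h x\<bar> * \<bar>?H\<bar>"
    using abs_triangle_ineq[of "g x * (?G - ?H)" "(g x - h x) * ?H"] gx by (simp add: abs_mult)
  moreover have "g x * \<bar>?G - ?H\<bar> \<le> 1 * \<bar>?G - ?H\<bar>" using gx by (intro mult_right_mono) auto
  moreover have "\<bar>g x - h x\<bar> * \<bar>?H\<bar> \<le> \<bar>g x - h x\<bar> * 1"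
    using \<open>0 \<le> ?H \<and> ?H \<le> 1\<close> by (intro mult_left_mono) auto
  ultimately have "\<bar>g x * ?G - h x * ?H\<bar> \<le> \<bar>?G - ?H\<bar> + \<bar>g x - h x\<bar>" by linarith
  with Cons show ?case by simp
qed simp

lemma total_mass_split:
  "total_mass N f = top_mass r N f + (\<Sum>x\<leftarrow>drop r (rank_sizes f). real x / real N)"
proof -
  have "real (sum_list (rank_sizes f)) =
      real (sum_list (take r (rank_sizes f))) + real (sum_list (drop r (rank_sizes f)))"
    by (metis append_take_drop_id of_nat_add sum_list_append)
  moreover have "(\<Sum>x\<leftarrow>xs. real x / real N) = real (sum_list xs) / N" for xs
    by (induction xs) (auto simp: add_divide_distrib)
  ultimately show ?thesis by (simp add: total_mass_def top_mass_def add_divide_distrib)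
qed

lemma top_mass_le_total: "top_mass r N f \<le> total_mass N f"
  unfolding total_mass_split[of N f r] by (auto intro!: sum_list_nonneg)

text \<open>Each of the \<open>Suc r\<close> largest frequencies is at least the one of rank
  \<open>r\<close>. This is the source of the error of order \<open>1 / r\<close>.\<close>

lemma ranked_freq_le_total: "real (Suc r) * ranked_freq N f r \<le> total_mass N f"
proof -
  have "real (Suc r) * ranked_freq N f r = (\<Sum>k<Suc r. ranked_freq N f r)" by simp
  also have "\<dots> \<le> (\<Sum>k<Suc r. ranked_freq N f k)"
    by (intro sum_mono ranked_freq_antimono) auto
  also have "\<dots> \<le> total_mass N f"
    unfolding top_mass_eq_sum[symmetric] by (rule top_mass_le_total)
  finally show ?thesis .
qed

lemma drop_rank_sizes_le:
  assumes "x \<in> set (drop r (rank_sizes f))"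
  shows "x \<le> ranked_size f r"
proof -
  obtain i where i: "r + i < length (rank_sizes f)" "x = rank_sizes f ! (r + i)"
  proof -
    from assms obtain i where "i < length (drop r (rank_sizes f))" "drop r (rank_sizes f) ! i = x"
      unfolding in_set_conv_nth by blast
    then show ?thesis using that[of i] by auto
  qed
  have "rank_sizes f ! (r + i) \<le> rank_sizes f ! r"
    using sorted_wrt_nth_less[OF sorted_rank_sizes, of r "r + i" f] i by (cases "i = 0") auto
  with i show ?thesis by (simp add: ranked_size_def)
qed

text \<open>
  All but the \<open>r\<close> largest features contribute Poisson singletons, up to an error of order \<open>1 / r\<close>.
\<close>

lemma prod_sampled_weight_approx:
  assumes t: "unit_weight t" and f: "f \<in> feature_allocs N" and m: "m \<le> N"
  shows "\<bar>(\<Prod>A\<in>#f. sampled_weight m t N (card A)) -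
      (\<Prod>k<r. sampled_weight m t N (ranked_size f k)) *
      exp (- (singleton_loss m t * (total_mass N f - top_mass r N f)))\<bar>
    \<le> (real m ^ 3 + real m ^ 2) * (total_mass N f)\<^sup>2 / real (Suc r)"
proof -
  let ?h = "sampled_weight m t N" and ?C = "real m ^ 3 + real m ^ 2"
  let ?xs = "rank_sizes f" and ?e = "\<lambda>x. exp (- (singleton_loss m t * (real x / real N)))"
  have le: "x \<le> N" if "x \<in> set ?xs" for x using rank_sizes_le[OF f that] .
  have "(\<Prod>A\<in>#f. ?h (card A)) = (\<Prod>x\<leftarrow>?xs. ?h x)"
    by (simp add: image_mset.compositionality o_def flip: prod_mset_prod_list)
  also have "\<dots> = (\<Prod>x\<leftarrow>take r ?xs. ?h x) * (\<Prod>x\<leftarrow>drop r ?xs. ?h x)"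
    by (metis append_take_drop_id map_append prod_list.append)
  finally have P: "(\<Prod>A\<in>#f. ?h (card A)) = (\<Prod>k<r. ?h (ranked_size f k)) * (\<Prod>x\<leftarrow>drop r ?xs. ?h x)"
    by (simp add: prod_take_rank_sizes sampled_weight_0[OF t])
  have E: "exp (- (singleton_loss m t * (total_mass N f - top_mass r N f))) = (\<Prod>x\<leftarrow>drop r ?xs. ?e x)"
  proof -
    have "(\<Prod>x\<leftarrow>xs. ?e x) = exp (- (singleton_loss m t * (\<Sum>x\<leftarrow>xs. real x / real N)))" for xs
      by (induction xs) (simp_all add: exp_add[symmetric] distrib_left)
    then show ?thesis using total_mass_split[of N f r] by simp
  qed
  have "\<bar>(\<Prod>x\<leftarrow>drop r ?xs. ?h x) - (\<Prod>x\<leftarrow>drop r ?xs. ?e x)\<bar> \<le> (\<Sum>x\<leftarrow>drop r ?xs. \<bar>?h x - ?e x\<bar>)"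
    using sampled_weight_bounds[OF t] singleton_loss_bounds[OF t, of m] by (intro prod_list_diff_le) auto
  \<comment> \<open>One factor of each square is replaced by the largest omitted frequency; the
    other factors then sum to at most the total mass.\<close>
  also have "\<dots> \<le> (\<Sum>x\<leftarrow>drop r ?xs. ?C * (ranked_freq N f r * (real x / real N)))"
  proof (rule sum_list_mono)
    fix x assume x: "x \<in> set (drop r ?xs)"
    have "\<bar>?h x - ?e x\<bar> \<le> ?C * (real x / real N)\<^sup>2"
      by (rule sampled_weight_exp[OF t le[OF in_set_dropD[OF x]] m])
    also have "\<dots> \<le> ?C * (ranked_freq N f r * (real x / real N))"
      unfolding power2_eq_square ranked_freq_eq using drop_rank_sizes_le[OF x]
      by (intro mult_left_mono mult_right_mono divide_right_mono) auto
    finally show "\<bar>?h x - ?e x\<bar> \<le> ?C * (ranked_freq N f r * (real x / real N))" .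
  qed
  also have "\<dots> = ?C * (ranked_freq N f r * (\<Sum>x\<leftarrow>drop r ?xs. real x / real N))"
    by (simp only: sum_list_const_mult)
  also have "\<dots> \<le> ?C * ((total_mass N f / real (Suc r)) * total_mass N f)"
  proof (intro mult_left_mono mult_mono)
    show "ranked_freq N f r \<le> total_mass N f / real (Suc r)"
      using ranked_freq_le_total[of r N f] by (simp add: field_simps)
    show "(\<Sum>x\<leftarrow>drop r ?xs. real x / real N) \<le> total_mass N f"
      using total_mass_split[of N f r] top_mass_bounds(1)[OF f, of r] by linarith
    show "0 \<le> (\<Sum>x\<leftarrow>drop r ?xs. real x / real N)" by (auto intro!: sum_list_nonneg)
  qed (auto intro!: divide_nonneg_nonneg total_mass_nonneg)
  finally have D: "\<bar>(\<Prod>x\<leftarrow>drop r ?xs. ?h x) - (\<Prod>x\<leftarrow>drop r ?xs. ?e x)\<bar> \<le> ?C * (total_mass N f)\<^sup>2 / real (Suc r)"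
    by (simp add: power2_eq_square)
  have "0 \<le> (\<Prod>k<r. ?h (ranked_size f k))" "(\<Prod>k<r. ?h (ranked_size f k)) \<le> 1"
    using sampled_weight_bounds[OF t] by (auto intro!: prod_nonneg prod_le_1)
  then have "\<bar>(\<Prod>k<r. ?h (ranked_size f k)) * ((\<Prod>x\<leftarrow>drop r ?xs. ?h x) - (\<Prod>x\<leftarrow>drop r ?xs. ?e x))\<bar>
      \<le> 1 * \<bar>(\<Prod>x\<leftarrow>drop r ?xs. ?h x) - (\<Prod>x\<leftarrow>drop r ?xs. ?e x)\<bar>"
    unfolding abs_mult by (intro mult_right_mono) auto
  with D show ?thesis unfolding P E by (simp add: right_diff_distrib)
qed

text \<open>For fixed \<open>r\<close> the approximation by \<open>r\<close> large features and an
  exponential converges in \<open>j\<close>, and its limit converges in \<open>r\<close>. The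
  approximation error is eventually bounded uniformly in \<open>j\<close>, so the limits may be
  interchanged. The frequencies can sum to less than \<open>s\<close>, and the deficit becomes the
  rate.\<close>

lemma prod_sampled_weight_limit:
  fixes n :: "nat \<Rightarrow> nat"
  assumes t: "unit_weight t" and n: "filterlim n at_top sequentially"
    and f: "\<And>j. f j \<in> feature_allocs (n j)"
    and top: "\<And>r. (\<lambda>j. top_mass r (n j) (f j)) \<longlonglongrightarrow> \<tau> r"
    and tot: "(\<lambda>j. total_mass (n j) (f j)) \<longlonglongrightarrow> s"
  defines "v \<equiv> \<lambda>k. \<tau> (Suc k) - \<tau> k"
  shows "\<And>k. 0 \<le> v k \<and> v k \<le> 1" "summable v" "suminf v \<le> s"
    "(\<lambda>j. \<Prod>A\<in>#f j. sampled_weight m t (n j) (card A)) \<longlonglongrightarrow> ffm_pgf m t v (s - suminf v)"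
proof -
  have freq: "(\<lambda>j. ranked_freq (n j) (f j) k) \<longlonglongrightarrow> v k" for k
    using tendsto_diff[OF top[of "Suc k"] top[of k]] by (simp add: top_mass_Suc v_def)
  show v01: "0 \<le> v k \<and> v k \<le> 1" for k
    using LIMSEQ_le_const[OF freq[of k], of 0] LIMSEQ_le_const2[OF freq[of k], of 1] ranked_freq_bounds[OF f]
    by blast
  have "\<tau> 0 = 0" using LIMSEQ_unique[OF top[of 0], of 0] by simp
  then have sum_v: "(\<Sum>k<r. v k) = \<tau> r" for r
    unfolding v_def by (induction r) auto
  have tau_le: "\<tau> r \<le> s" for r
    using LIMSEQ_le[OF top[of r] tot] top_mass_le_total by blast
  show sv: "summable v"
    using v01 sum_v tau_le by (intro summableI_nonneg_bounded[of _ s]) auto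
  show "suminf v \<le> s"
    using sv sum_v tau_le by (intro suminf_le_const) auto
  have tau_lim: "\<tau> \<longlonglongrightarrow> suminf v"
    using summable_LIMSEQ[OF sv] by (simp add: sum_v)
  let ?P = "\<lambda>j. \<Prod>A\<in>#f j. sampled_weight m t (n j) (card A)"
  let ?A = "\<lambda>r j. (\<Prod>k<r. sampled_weight m t (n j) (ranked_size (f j) k)) *
      exp (- (singleton_loss m t * (total_mass (n j) (f j) - top_mass r (n j) (f j))))"
  let ?a = "\<lambda>r. (\<Prod>k<r. bernoulli_weight m t (v k)) * exp (- (singleton_loss m t * (s - \<tau> r)))"
  let ?L = "ffm_pgf m t v (s - suminf v)"
  let ?C = "real m ^ 3 + real m ^ 2"
  have rs_le: "ranked_size (f j) k \<le> n j" for j k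
    using rank_sizes_le[OF f nth_mem] by (auto simp: ranked_size_def)
  have A_lim: "?A r \<longlonglongrightarrow> ?a r" for r
    using freq by (intro tendsto_intros top tot sampled_weight_limit[OF n rs_le]) (simp add: ranked_freq_eq)
  \<comment> \<open>The limiting exponential is multiplied in and divided out, so that the existence
    of the limiting product can be quoted from \<open>ffm_pgf_limit\<close>.\<close>
  have "(\<lambda>r. (\<Prod>k<r. bernoulli_weight m t (v k)) * exp (- (singleton_loss m t * (s - suminf v)))
      * (exp (- (singleton_loss m t * (s - \<tau> r))) / exp (- (singleton_loss m t * (s - suminf v))))) \<longlonglongrightarrow>
      ?L * (exp (- (singleton_loss m t * (s - suminf v))) / exp (- (singleton_loss m t * (s - suminf v))))"
    by (intro tendsto_mult[OF ffm_pgf_limit[OF t v01]] tendsto_intros tau_lim) auto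
  then have a_lim: "?a \<longlonglongrightarrow> ?L" by simp
  show "?P \<longlonglongrightarrow> ?L"
  proof (rule LIMSEQ_I)
    fix \<epsilon> :: real assume e: "0 < \<epsilon>"
    \<comment> \<open>The total mass is eventually below \<open>s + 1\<close>, so \<open>r\<close>
      can be chosen before \<open>j\<close>.\<close>
    have "(\<lambda>r. ?C * (s + 1)\<^sup>2 / real (Suc r)) \<longlonglongrightarrow> 0"
      using tendsto_mult_right_zero[OF LIMSEQ_inverse_real_of_nat, of "?C * (s + 1)\<^sup>2"]
      by (simp only: divide_inverse)
    then have "eventually (\<lambda>r. ?C * (s + 1)\<^sup>2 / real (Suc r) < \<epsilon> / 3) sequentially"
      using e by (intro order_tendstoD) auto
    moreover have "eventually (\<lambda>r. dist (?a r) ?L < \<epsilon> / 3) sequentially"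
      using e by (intro tendstoD[OF a_lim]) auto
    ultimately obtain r where r: "?C * (s + 1)\<^sup>2 / real (Suc r) < \<epsilon> / 3" "dist (?a r) ?L < \<epsilon> / 3"
      using eventually_happens[OF eventually_conj] trivial_limit_sequentially by blast
    have "eventually (\<lambda>j. dist (?A r j) (?a r) < \<epsilon> / 3) sequentially"
      using e by (intro tendstoD[OF A_lim]) auto
    moreover have "eventually (\<lambda>j. total_mass (n j) (f j) < s + 1) sequentially"
      by (intro order_tendstoD(2)[OF tot]) auto
    moreover have "eventually (\<lambda>j. m \<le> n j) sequentially"
      using filterlim_at_top[THEN iffD1, OF n] by blast
    ultimately have "eventually (\<lambda>j. norm (?P j - ?L) < \<epsilon>) sequentially"
    proof eventually_elim
      case (elim j)
      have "\<bar>?P j - ?A r j\<bar> \<le> ?C * (total_mass (n j) (f j))\<^sup>2 / real (Suc r)"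
        by (rule prod_sampled_weight_approx[OF t f elim(3)])
      also have "\<dots> \<le> ?C * (s + 1)\<^sup>2 / real (Suc r)"
        using elim(2) total_mass_nonneg[of "n j" "f j"]
        by (intro divide_right_mono mult_left_mono power_mono) auto
      finally have "\<bar>?P j - ?A r j\<bar> < \<epsilon> / 3" using r(1) by linarith
      then show ?case using r(2) elim(1) unfolding dist_real_def real_norm_def abs_less_iff by linarith
    qed
    then show "\<exists>no. \<forall>j\<ge>no. norm (?P j - ?L) < \<epsilon>"
      by (simp add: eventually_sequentially)
  qed
qed

section \<open>Consequences of an EFPF: the sampling identity, exchangeability and finite limiting
  mass\<close>

lemma prod_restrict_alloc:
  fixes t :: "nat set \<Rightarrow> real"
  assumes "t {} = 1"
  shows "(\<Prod>A\<in>#restrict_alloc m f. t A) = (\<Prod>A\<in>#f. t (A \<inter> {1..m}))"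
  using assms by (induction f) (auto simp: restrict_alloc_def)

lemma size_avg_trace:
  assumes A: "A \<noteq> {}" "A \<subseteq> {1..N}"
  shows "size_avg N (\<lambda>B. t (B \<inter> {1..m})) A = sampled_weight m t N (card A)"
proof -
  have "finite A" using A finite_subset by blast
  then have "card A \<noteq> 0" using A by simp
  then have "{B. B \<in> Pow {1..N} - {{}} \<and> card B = card A} = subsets_of_size N (card A)"
    by (auto simp: subsets_of_size_def)
  then show ?thesis
    by (simp add: class_avg_def sampled_weight_def card_subsets_of_size)
qed

text \<open>By consistency a feature of \<open>F N\<close> contributes the weight of its trace on
  \<open>{1..m}\<close>. The EFPF at level \<open>N\<close> permits averaging this weight over all
  subsets of the same size, which is the sampled weight.\<close>

lemma EFPF_pgf_sampling:
  assumes rfa: "random_feature_allocation M F" and ef: "has_EFPF M F"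
    and t: "unit_weight t" and m: "1 \<le> m" "m \<le> N"
  shows "(\<integral>\<omega>. (\<Prod>A\<in>#F m \<omega>. t A) \<partial>M) = (\<integral>\<omega>. (\<Prod>A\<in>#F N \<omega>. sampled_weight m t N (card A)) \<partial>M)"
proof -
  have M: "prob_space M" and F: "\<And>N. 1 \<le> N \<Longrightarrow> F N \<in> M \<rightarrow>\<^sub>M alloc_space N"
    using rfa by (auto simp: random_feature_allocation_def)
  have N: "1 \<le> N" using m by simp
  have FN: "F N \<omega> \<in> feature_allocs N" if "\<omega> \<in> space M" for \<omega>
    using measurable_space[OF F[OF N] that] by simp
  have "(\<integral>\<omega>. (\<Prod>A\<in>#F m \<omega>. t A) \<partial>M) = (\<integral>\<omega>. (\<Prod>A\<in>#F N \<omega>. t (A \<inter> {1..m})) \<partial>M)"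
  \<comment> \<open>Consistency is assumed for \<open>m < N\<close> only; at equality the traces are
    the features themselves.\<close>
  proof (cases "m = N")
    case True
    have "(\<Prod>A\<in>#F N \<omega>. t (A \<inter> {1..N})) = (\<Prod>A\<in>#F N \<omega>. t A)" if "\<omega> \<in> space M" for \<omega>
    proof -
      have "A \<inter> {1..N} = A" if "A \<in># F N \<omega>" for A
        using FN[OF \<open>\<omega> \<in> space M\<close>] that by (simp add: feature_allocs_def Int_absorb2)
      then show ?thesis by (intro arg_cong[where f = prod_mset] image_mset_cong) simp
    qed
    then show ?thesis unfolding True
      by (intro Bochner_Integration.integral_cong refl) simp
  next
    case False
    have "AE \<omega> in M. F m \<omega> = restrict_alloc m (F N \<omega>)"
      using rfa m False unfolding random_feature_allocation_def by simp
    then show ?thesis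
      using unit_weightD(1)[OF t]
      by (intro integral_cong_AE measurable_mset_fun[OF F[OF m(1)]] measurable_mset_fun[OF F[OF N]])
        (auto simp: prod_restrict_alloc elim!: eventually_mono)
  qed
  also have "\<dots> = (\<integral>\<omega>. (\<Prod>A\<in>#F N \<omega>. size_avg N (\<lambda>A. t (A \<inter> {1..m})) A) \<partial>M)"
    using has_EFPF_iff_pgf[where M = M and F = F, OF M F] ef N unit_weightD(2,3)[OF t] by simp
  also have "\<dots> = (\<integral>\<omega>. (\<Prod>A\<in>#F N \<omega>. sampled_weight m t N (card A)) \<partial>M)"
  proof (intro Bochner_Integration.integral_cong refl arg_cong[where f = prod_mset])
    fix \<omega> assume "\<omega> \<in> space M"
    then have "\<forall>A\<in>#F N \<omega>. A \<noteq> {} \<and> A \<subseteq> {1..N}" using FN by (simp add: feature_allocs_def)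
    then show "image_mset (size_avg N (\<lambda>A. t (A \<inter> {1..m}))) (F N \<omega>) =
        image_mset (\<lambda>A. sampled_weight m t N (card A)) (F N \<omega>)"
      by (intro image_mset_cong size_avg_trace) auto
  qed
  finally show ?thesis .
qed

text \<open>Relabelling changes neither the sizes of the features nor the number of orderings, and
  these two determine the mass of an allocation.\<close>

lemma EFPF_imp_exchangeable:
  assumes rfa: "random_feature_allocation M F" and ef: "has_EFPF M F"
  shows "exchangeable_alloc M F"
  unfolding exchangeable_alloc_def
proof (intro allI impI)
  fix N \<sigma> assume N: "1 \<le> (N::nat)" and s: "\<sigma> permutes {1..N}"
  have M: "prob_space M" and F: "\<And>N. 1 \<le> N \<Longrightarrow> F N \<in> M \<rightarrow>\<^sub>M alloc_space N"
    using rfa by (auto simp: random_feature_allocation_def)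
  interpret prob_space M by (rule M)
  note FN = F[OF N]
  let ?G = "\<lambda>\<omega>. relabel \<sigma> (F N \<omega>)"
  have "(\<lambda>f. relabel \<sigma> f) \<in> alloc_space N \<rightarrow>\<^sub>M alloc_space N"
    by (auto intro: relabel_in_feature_allocs[OF s])
  then have G: "?G \<in> M \<rightarrow>\<^sub>M alloc_space N"
    by (rule measurable_compose[OF FN])
  obtain q :: "nat multiset \<Rightarrow> real" where q: "\<And>f. f \<in> feature_allocs N \<Longrightarrow>
      prob {\<omega>\<in>space M. F N \<omega> = f} = card (permutations_of_multiset f) * q (image_mset card f)"
    using has_EFPF_iff_symmetric_weights[where M = M and F = F, OF M F] ef N by blast
  have inj: "inj \<sigma>" by (rule permutes_inj[OF s])
  have prob_eq: "prob {\<omega>\<in>space M. F N \<omega> = f} = prob {\<omega>\<in>space M. ?G \<omega> = f}" if f: "f \<in> feature_allocs N" for f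
  proof -
    let ?g = "relabel (inv \<sigma>) f"
    have "{\<omega>\<in>space M. ?G \<omega> = f} = {\<omega>\<in>space M. F N \<omega> = ?g}"
      by (auto simp: image_mset.compositionality o_def image_comp inv_o_cancel[OF inj]
          image_image inv_f_f[OF inj] permutes_inverses[OF s])
    moreover have g: "?g \<in> feature_allocs N"
      by (rule relabel_in_feature_allocs[OF permutes_inv[OF s] f])
    moreover have "image_mset card ?g = image_mset card f"
      using permutes_inj[OF permutes_inv[OF s]]
      by (auto simp: image_mset.compositionality card_image inj_on_subset intro!: image_mset_cong)
    moreover have "card (permutations_of_multiset ?g) = card (permutations_of_multiset f)"
    proof -
      have "inj (\<lambda>A. inv \<sigma> ` A)"
        by (rule injI) (simp add: inj_image_eq_iff[OF permutes_inj[OF permutes_inv[OF s]]])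
      then show ?thesis
        by (subst permutations_of_multiset_image) (intro card_image, auto intro!: inj_onI dest: map_injective)
    qed
    ultimately show ?thesis using q[OF f] q[OF g] by simp
  qed
  show "distr M (alloc_space N) (F N) = distr M (alloc_space N) ?G"
  proof (rule measure_eqI_countable[OF _ _ countable_feature_allocs])
    fix f assume f: "f \<in> feature_allocs N"
    have "F N -` {f} \<inter> space M = {\<omega>\<in>space M. F N \<omega> = f}" "?G -` {f} \<inter> space M = {\<omega>\<in>space M. ?G \<omega> = f}"
      by auto
    then show "emeasure (distr M (alloc_space N) (F N)) {f} = emeasure (distr M (alloc_space N) ?G) {f}"
      using f FN G prob_eq[OF f] by (simp add: emeasure_distr emeasure_eq_measure)
  qed simp_all
qed

text \<open>\<open>W\<close> is the exponential of minus the limiting total mass. The generating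
  function at \<open>z\<close> of the number of features containing index 1 is at most the
  expectation of \<open>W\<close> to the power \<open>1 - z\<close>, hence at most the probability
  that \<open>W\<close> is positive. That number is finite, so the generating function tends to 1 as
  \<open>z\<close> increases to 1.\<close>

lemma limit_mass_finite:
  fixes n :: "nat \<Rightarrow> nat" and W :: "'a \<Rightarrow> real"
  assumes rfa: "random_feature_allocation M F" and ef: "has_EFPF M F"
    and n: "\<And>j. 1 \<le> n j" and W: "W \<in> borel_measurable M"
    and lim: "AE \<omega> in M. (\<lambda>j. exp (- total_mass (n j) (F (n j) \<omega>))) \<longlonglongrightarrow> W \<omega>"
  shows "AE \<omega> in M. 0 < W \<omega>"
proof -
  have F: "F N \<in> M \<rightarrow>\<^sub>M alloc_space N" if "1 \<le> N" for N
    using rfa that by (auto simp: random_feature_allocation_def)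
  interpret prob_space M using rfa by (simp add: random_feature_allocation_def)
  have FN: "F N \<omega> \<in> feature_allocs N" if "1 \<le> N" "\<omega> \<in> space M" for N \<omega>
    using measurable_space[OF F[OF that(1)] that(2)] by simp
  have W01: "AE \<omega> in M. 0 \<le> W \<omega> \<and> W \<omega> \<le> 1"
    using lim
  proof (rule eventually_mono)
    fix \<omega> assume l: "(\<lambda>j. exp (- total_mass (n j) (F (n j) \<omega>))) \<longlonglongrightarrow> W \<omega>"
    show "0 \<le> W \<omega> \<and> W \<omega> \<le> 1"
      using LIMSEQ_le_const[OF l, of 0] LIMSEQ_le_const2[OF l, of 1] total_mass_nonneg by auto
  qed
  have pos_event: "{\<omega>\<in>space M. 0 < W \<omega>} \<in> events" using W by measurable
  have bound: "expectation (\<lambda>\<omega>. z ^ size (F 1 \<omega>)) \<le> prob {\<omega>\<in>space M. 0 < W \<omega>}" if z: "0 \<le> z" "z < 1" for z :: real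
  proof -
    \<comment> \<open>With this weight and \<open>m = 1\<close> the product is \<open>z\<close> to
      the number of features, and the first-order formula for the sampled weight is exact.\<close>
    let ?t = "\<lambda>A :: nat set. if A = {} then 1 else z"
    have t: "unit_weight ?t" using z by (auto simp: unit_weight_def)
    have nonneg: "0 \<le> (\<Prod>A\<in>#g. sampled_weight 1 ?t N (card A))" for g :: "nat set multiset" and N
      by (rule prod_mset_unit_interval(1)) (use sampled_weight_bounds[OF t] in blast)
    have sw: "sampled_weight 1 ?t N k = 1 - (1 - z) * (k / N)" if "1 \<le> N" "k \<le> N" for N k
    proof -
      have "(\<Sum>B\<in>subsets_of_size N k. ?t (B \<inter> {1..1})) =
          (\<Sum>B\<in>subsets_of_size N k. 1 - (1 - z) * (if 1 \<in> B then 1 else 0))"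
        by (intro sum.cong refl) auto
      also have "\<dots> = real (N choose k) - (1 - z) * card {B\<in>subsets_of_size N k. 1 \<in> B}"
        by (simp add: sum_subtractf card_subsets_of_size sum.If_cases Int_def flip: sum_distrib_left)
      finally have "sampled_weight 1 ?t N k = real (N choose k) / real (N choose k) -
          (1 - z) * (card {B\<in>subsets_of_size N k. 1 \<in> B} / real (N choose k))"
        by (simp only: sampled_weight_def diff_divide_distrib times_divide_eq_right)
      also have "card {B\<in>subsets_of_size N k. 1 \<in> B} / real (N choose k) = k / N"
        using that by (intro inclusion_frequency) auto
      finally show ?thesis using that by simp
    qed
    have le: "(\<Prod>A\<in>#f. sampled_weight 1 ?t N (card A)) \<le> exp (- total_mass N f) powr (1 - z)"
      if N: "1 \<le> N" and f: "f \<in> feature_allocs N" for N f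
    proof -
      have "(\<Prod>A\<in>#g. sampled_weight 1 ?t N (card A)) \<le> exp (- ((1 - z) * (\<Sum>A\<in>#g. real (card A) / N)))"
        if "\<forall>A\<in>#g. A \<subseteq> {1..N}" for g
        using that
      proof (induction g)
        case (add A g)
        have "card A \<le> N" using card_mono[of "{1..N}" A] add.prems by auto
        then have "sampled_weight 1 ?t N (card A) \<le> exp (- ((1 - z) * (real (card A) / N)))"
          unfolding sw[OF N \<open>card A \<le> N\<close>]
          using exp_ge_add_one_self[of "- ((1 - z) * (real (card A) / N))"] by simp
        then have "sampled_weight 1 ?t N (card A) * (\<Prod>A\<in>#g. sampled_weight 1 ?t N (card A)) \<le>
            exp (- ((1 - z) * (real (card A) / N))) * exp (- ((1 - z) * (\<Sum>A\<in>#g. real (card A) / N)))"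
          using add nonneg by (intro mult_mono) auto
        then show ?case by (simp add: exp_add[symmetric] algebra_simps)
      qed simp
      from this[of f] f show ?thesis
        by (simp add: feature_allocs_def total_mass_eq powr_def algebra_simps)
    qed
    have "(\<lambda>j. expectation (\<lambda>\<omega>. exp (- total_mass (n j) (F (n j) \<omega>)) powr (1 - z))) \<longlonglongrightarrow>
        expectation (\<lambda>\<omega>. W \<omega> powr (1 - z))"
    proof (rule integral_dominated_convergence[where w = "\<lambda>_. 1"])
      show "AE \<omega> in M. (\<lambda>j. exp (- total_mass (n j) (F (n j) \<omega>)) powr (1 - z)) \<longlonglongrightarrow> W \<omega> powr (1 - z)"
        using lim W01
      proof eventually_elim
        case (elim \<omega>)
        then show ?case using z by (intro tendsto_powr'[OF elim(1) tendsto_const]) auto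
      qed
      show "AE \<omega> in M. norm (exp (- total_mass (n j) (F (n j) \<omega>)) powr (1 - z)) \<le> 1" for j
        using z by (intro AE_I2) (auto intro!: powr_le1 total_mass_nonneg)
      show "(\<lambda>\<omega>. exp (- total_mass (n j) (F (n j) \<omega>)) powr (1 - z)) \<in> borel_measurable M" for j
        by (rule measurable_mset_fun[OF F[OF n]])
      show "(\<lambda>\<omega>. W \<omega> powr (1 - z)) \<in> borel_measurable M" using W by measurable
    qed simp
    moreover have "expectation (\<lambda>\<omega>. z ^ size (F 1 \<omega>)) \<le>
        expectation (\<lambda>\<omega>. exp (- total_mass (n j) (F (n j) \<omega>)) powr (1 - z))" for j
    proof -
      have "expectation (\<lambda>\<omega>. z ^ size (F 1 \<omega>)) = expectation (\<lambda>\<omega>. \<Prod>A\<in>#F 1 \<omega>. ?t A)"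
      proof (intro Bochner_Integration.integral_cong refl)
        fix \<omega> assume "\<omega> \<in> space M"
        then have "{} \<notin># F 1 \<omega>" using FN[of 1 \<omega>] by (auto simp: feature_allocs_def)
        then have "(\<Prod>A\<in>#F 1 \<omega>. ?t A) = (\<Prod>A\<in>#F 1 \<omega>. z)"
          by (intro arg_cong[where f = prod_mset] image_mset_cong) auto
        then show "z ^ size (F 1 \<omega>) = (\<Prod>A\<in>#F 1 \<omega>. ?t A)" by simp
      qed
      also have "\<dots> = expectation (\<lambda>\<omega>. \<Prod>A\<in>#F (n j) \<omega>. sampled_weight 1 ?t (n j) (card A))"
        by (rule EFPF_pgf_sampling[OF rfa ef t _ n]) simp
      also have "\<dots> \<le> expectation (\<lambda>\<omega>. exp (- total_mass (n j) (F (n j) \<omega>)) powr (1 - z))"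
      proof (rule integral_mono_AE')
        show "integrable M (\<lambda>\<omega>. exp (- total_mass (n j) (F (n j) \<omega>)) powr (1 - z))"
          using z by (intro integrable_const_bound[where B = 1] AE_I2 measurable_mset_fun[OF F[OF n]])
            (auto intro!: powr_le1 total_mass_nonneg)
      qed (use le[OF n FN[OF n]] nonneg in \<open>auto intro!: AE_I2\<close>)
      finally show ?thesis .
    qed
    ultimately have "expectation (\<lambda>\<omega>. z ^ size (F 1 \<omega>)) \<le> expectation (\<lambda>\<omega>. W \<omega> powr (1 - z))"
      by (intro LIMSEQ_le_const) auto
    \<comment> \<open>The exponent \<open>1 - z\<close> is positive and 0 to a positive power is 0,
      so the event that \<open>W\<close> vanishes contributes nothing.\<close>
    also have "\<dots> \<le> expectation (indicator {\<omega>\<in>space M. 0 < W \<omega>})"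
    proof (rule integral_mono_AE')
      show "AE \<omega> in M. W \<omega> powr (1 - z) \<le> indicator {\<omega>\<in>space M. 0 < W \<omega>} \<omega>"
        using W01 AE_space
      proof eventually_elim
        case (elim \<omega>)
        then show ?case using z by (auto simp: indicator_def intro: powr_le1)
      qed
    qed (use pos_event in \<open>auto intro!: integrable_real_indicator simp: less_top[symmetric]\<close>)
    finally show ?thesis using pos_event by simp
  qed
  \<comment> \<open>The values \<open>z = 1 - 1 / (i + 1)\<close> lie in [0,1) and increase to
    1.\<close>
  have "(\<lambda>i. expectation (\<lambda>\<omega>. (1 - inverse (real (Suc i))) ^ size (F 1 \<omega>))) \<longlonglongrightarrow> expectation (\<lambda>\<omega>. 1)"
  proof (rule integral_dominated_convergence[where w = "\<lambda>_. 1"])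
    have "(\<lambda>i. (1 - inverse (real (Suc i))) ^ k) \<longlonglongrightarrow> (1 - 0) ^ k" for k
      by (intro tendsto_intros LIMSEQ_inverse_real_of_nat)
    then show "AE \<omega> in M. (\<lambda>i. (1 - inverse (real (Suc i))) ^ size (F 1 \<omega>)) \<longlonglongrightarrow> 1" by simp
    have "0 \<le> 1 - inverse (real (Suc i))" "1 - inverse (real (Suc i)) \<le> 1" for i
      by (auto simp: field_simps)
    then show "AE \<omega> in M. norm ((1 - inverse (real (Suc i))) ^ size (F 1 \<omega>)) \<le> 1" for i
      by (intro AE_I2) (simp add: power_le_one)
  qed (auto intro!: measurable_mset_fun[OF F])
  then have "expectation (\<lambda>\<omega>. 1) \<le> prob {\<omega>\<in>space M. 0 < W \<omega>}"
    by (rule LIMSEQ_le_const2) (intro exI[of _ 0] allI impI bound, auto simp: field_simps)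
  then have "prob {\<omega>\<in>space M. 0 < W \<omega>} = 1" using measure_le_1 by (auto simp: prob_space intro: antisym)
  then show ?thesis using pos_event by (simp add: prob_Collect_eq_1)
qed

lemma random_paramsD:
  assumes "random_params M V L"
  shows "prob_space M" "V k \<in> borel_measurable M" "L \<in> borel_measurable M"
    "AE \<omega> in M. summable (\<lambda>k. V k \<omega>)"
    "\<omega> \<in> space M \<Longrightarrow> 0 \<le> V k \<omega>" "\<omega> \<in> space M \<Longrightarrow> V k \<omega> \<le> 1" "\<omega> \<in> space M \<Longrightarrow> 0 \<le> L \<omega>"
  using assms by (auto simp: random_params_def)

lemma EFPF_imp_params:
  assumes rfa: "random_feature_allocation M F" and ef: "has_EFPF M F"
  obtains V L where "random_params M V L"
    "\<And>m t. 1 \<le> m \<Longrightarrow> unit_weight t \<Longrightarrow>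
      (\<integral>\<omega>. (\<Prod>A\<in>#F m \<omega>. t A) \<partial>M) = (\<integral>\<omega>. ffm_pgf m t (\<lambda>k. V k \<omega>) (L \<omega>) \<partial>M)"
proof -
  interpret prob_space M using rfa by (simp add: random_feature_allocation_def)
  have F: "F N \<in> M \<rightarrow>\<^sub>M alloc_space N" if "1 \<le> N" for N
    using rfa that by (auto simp: random_feature_allocation_def)
  have FN: "F N \<omega> \<in> feature_allocs N" if "1 \<le> N" "\<omega> \<in> space M" for N \<omega>
    using measurable_space[OF F[OF that(1)] that(2)] by simp
  obtain n :: "nat \<Rightarrow> nat" where n: "\<And>j. j < n j"
    and conv: "AE \<omega> in M. \<forall>r. convergent (\<lambda>j. mass_statistic r (n j) (F (n j) \<omega>))"
    using mass_statistics_converge[OF rfa EFPF_imp_exchangeable[OF rfa ef]] by blast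
  have n1: "1 \<le> n j" for j using n[of j] by simp
  have n_lim: "filterlim n at_top sequentially"
    by (rule filterlim_at_top_mono[OF filterlim_ident]) (use n in \<open>auto intro!: always_eventually less_imp_le\<close>)
  define \<tau> where "\<tau> r \<omega> = lim (\<lambda>j. top_mass r (n j) (F (n j) \<omega>))" for r \<omega>
  define W where "W \<omega> = lim (\<lambda>j. exp (- total_mass (n j) (F (n j) \<omega>)))" for \<omega>
  \<comment> \<open>\<open>random_params\<close> asks for the bounds at every point, while the
    limits obey them almost surely only. The clamps here and in \<open>L\<close> are inactive almost
    surely; \<open>- ln (W \<omega>)\<close> is the limiting total mass.\<close>
  define V where "V k \<omega> = max 0 (min 1 (\<tau> (Suc k) \<omega> - \<tau> k \<omega>))" for k \<omega>
  define L where "L \<omega> = max 0 (- ln (W \<omega>) - suminf (\<lambda>k. V k \<omega>))" for \<omega>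
  have [measurable]: "\<tau> r \<in> borel_measurable M" for r
    unfolding \<tau>_def by (intro borel_measurable_lim_metric measurable_mset_fun[OF F[OF n1]])
  have W [measurable]: "W \<in> borel_measurable M"
    unfolding W_def by (intro borel_measurable_lim_metric measurable_mset_fun[OF F[OF n1]])
  have [measurable]: "V k \<in> borel_measurable M" for k unfolding V_def by measurable
  have [measurable]: "L \<in> borel_measurable M" unfolding L_def by measurable
  have tau: "AE \<omega> in M. \<forall>r. (\<lambda>j. top_mass r (n j) (F (n j) \<omega>)) \<longlonglongrightarrow> \<tau> r \<omega>"
    using conv
  proof (rule eventually_mono, intro allI)
    fix \<omega> r assume c: "\<forall>r. convergent (\<lambda>j. mass_statistic r (n j) (F (n j) \<omega>))"
    show "(\<lambda>j. top_mass r (n j) (F (n j) \<omega>)) \<longlonglongrightarrow> \<tau> r \<omega>"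
    proof (cases "r = 0")
      case True
      then show ?thesis by (simp add: \<tau>_def lim_const)
    next
      case False
      with c[rule_format, of r] show ?thesis
        by (simp add: mass_statistic_def \<tau>_def convergent_LIMSEQ_iff)
    qed
  qed
  have Wlim: "AE \<omega> in M. (\<lambda>j. exp (- total_mass (n j) (F (n j) \<omega>))) \<longlonglongrightarrow> W \<omega>"
    using conv
  proof (rule eventually_mono)
    fix \<omega> assume c: "\<forall>r. convergent (\<lambda>j. mass_statistic r (n j) (F (n j) \<omega>))"
    show "(\<lambda>j. exp (- total_mass (n j) (F (n j) \<omega>))) \<longlonglongrightarrow> W \<omega>"
      using c[rule_format, of 0] by (simp add: mass_statistic_def W_def convergent_LIMSEQ_iff)
  qed
  have Wpos: "AE \<omega> in M. 0 < W \<omega>"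
    by (rule limit_mass_finite[OF rfa ef n1 W Wlim])
  \<comment> \<open>The exceptional set comes from the mass statistics alone, so the uncountably
    many weights \<open>t\<close> may be quantified inside.\<close>
  have limits: "AE \<omega> in M. summable (\<lambda>k. V k \<omega>) \<and> (\<forall>m t. unit_weight t \<longrightarrow>
      (\<lambda>j. \<Prod>A\<in>#F (n j) \<omega>. sampled_weight m t (n j) (card A)) \<longlonglongrightarrow> ffm_pgf m t (\<lambda>k. V k \<omega>) (L \<omega>))"
    using tau Wlim Wpos AE_space
  proof eventually_elim
    case (elim \<omega>)
    have top: "(\<lambda>j. top_mass r (n j) (F (n j) \<omega>)) \<longlonglongrightarrow> \<tau> r \<omega>" for r using elim(1) by blast
    have "(\<lambda>j. - ln (exp (- total_mass (n j) (F (n j) \<omega>)))) \<longlonglongrightarrow> - ln (W \<omega>)"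
      using elim(2,3) by (intro tendsto_intros) auto
    then have tot: "(\<lambda>j. total_mass (n j) (F (n j) \<omega>)) \<longlonglongrightarrow> - ln (W \<omega>)" by simp
    note * = prod_sampled_weight_limit[OF _ n_lim FN[OF n1 elim(4)] top tot]
    \<comment> \<open>Some unit weight is needed to extract the conclusions that do not mention
      \<open>t\<close>.\<close>
    have one: "unit_weight (\<lambda>_. 1)" by (simp add: unit_weight_def)
    have V: "(\<lambda>k. V k \<omega>) = (\<lambda>k. \<tau> (Suc k) \<omega> - \<tau> k \<omega>)"
      using *(1)[OF one] by (auto simp: V_def)
    have L: "L \<omega> = - ln (W \<omega>) - suminf (\<lambda>k. V k \<omega>)"
      using *(3)[OF one] by (simp add: L_def V)
    show ?case unfolding L unfolding V using *(2)[OF one] *(4) by simp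
  qed
  have V01: "0 \<le> V k \<omega>" "V k \<omega> \<le> 1" for k \<omega> by (auto simp: V_def)
  have rp: "random_params M V L"
    unfolding random_params_def
    using limits V01 prob_space_axioms by (auto simp: L_def elim: eventually_mono)
  have pgf: "(\<integral>\<omega>. (\<Prod>A\<in>#F m \<omega>. t A) \<partial>M) = (\<integral>\<omega>. ffm_pgf m t (\<lambda>k. V k \<omega>) (L \<omega>) \<partial>M)"
    if m: "1 \<le> m" and t: "unit_weight t" for m t
  proof -
    have "(\<lambda>j. \<integral>\<omega>. (\<Prod>A\<in>#F (n j) \<omega>. sampled_weight m t (n j) (card A)) \<partial>M) \<longlonglongrightarrow>
        (\<integral>\<omega>. ffm_pgf m t (\<lambda>k. V k \<omega>) (L \<omega>) \<partial>M)"
    proof (rule integral_dominated_convergence[where w = "\<lambda>_. 1"])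
      show "AE \<omega> in M. (\<lambda>j. \<Prod>A\<in>#F (n j) \<omega>. sampled_weight m t (n j) (card A)) \<longlonglongrightarrow> ffm_pgf m t (\<lambda>k. V k \<omega>) (L \<omega>)"
        using limits by (rule eventually_mono) (use t in blast)
      show "AE \<omega> in M. norm (\<Prod>A\<in>#F (n j) \<omega>. sampled_weight m t (n j) (card A)) \<le> 1" for j
      proof (rule AE_I2)
        fix \<omega>
        have "0 \<le> (\<Prod>A\<in>#F (n j) \<omega>. sampled_weight m t (n j) (card A)) \<and>
            (\<Prod>A\<in>#F (n j) \<omega>. sampled_weight m t (n j) (card A)) \<le> 1"
          using prod_mset_unit_interval[of "F (n j) \<omega>" "\<lambda>A. sampled_weight m t (n j) (card A)"]
            sampled_weight_bounds[OF t] by blast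
        then show "norm (\<Prod>A\<in>#F (n j) \<omega>. sampled_weight m t (n j) (card A)) \<le> 1" by simp
      qed
      show "(\<lambda>\<omega>. ffm_pgf m t (\<lambda>k. V k \<omega>) (L \<omega>)) \<in> borel_measurable M"
        unfolding ffm_pgf_def bernoulli_weight_def by measurable
    qed (auto intro!: measurable_mset_fun[OF F[OF n1]])
    \<comment> \<open>From \<open>n j \<ge> m\<close> on, the sampling identity makes this sequence
      constant.\<close>
    moreover have "eventually (\<lambda>j. (\<integral>\<omega>. (\<Prod>A\<in>#F (n j) \<omega>. sampled_weight m t (n j) (card A)) \<partial>M) =
        (\<integral>\<omega>. (\<Prod>A\<in>#F m \<omega>. t A) \<partial>M)) sequentially"
      using filterlim_at_top[THEN iffD1, OF n_lim, rule_format, of m]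
      by (rule eventually_mono) (rule EFPF_pgf_sampling[OF rfa ef t m, symmetric])
    then have "(\<lambda>j. \<integral>\<omega>. (\<Prod>A\<in>#F (n j) \<omega>. sampled_weight m t (n j) (card A)) \<partial>M) \<longlonglongrightarrow>
        (\<integral>\<omega>. (\<Prod>A\<in>#F m \<omega>. t A) \<partial>M)"
      by (rule tendsto_eventually)
    ultimately show ?thesis by (rule LIMSEQ_unique[symmetric])
  qed
  show ?thesis by (rule that[OF rp pgf])
qed

section \<open>The feature frequency model\<close>

abbreviation trace_set :: "(nat \<Rightarrow> nat \<Rightarrow> 'w \<Rightarrow> bool) \<Rightarrow> nat \<Rightarrow> nat \<Rightarrow> 'w \<Rightarrow> nat set" where
  "trace_set B m k \<omega> \<equiv> feature_set B k \<omega> \<inter> {1..m}"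

lemma params_measurable:
  assumes "random_params M V L"
  shows "params V L \<in> M \<rightarrow>\<^sub>M param_space"
  using random_paramsD(2,3)[OF assms] by (intro measurable_Pair measurable_PiM_single') auto

lemma params_subalgebra:
  assumes rp: "random_params M V L"
  shows "finite_measure_subalgebra M (vimage_algebra (space M) (params V L) param_space)"
proof -
  interpret prob_space M by (rule random_paramsD(1)[OF rp])
  have "sets (vimage_algebra (space M) (params V L) param_space) \<subseteq> sets M"
    using params_measurable[OF rp] by (intro sets_image_in_sets) auto
  then show ?thesis
    by unfold_locales (auto simp: subalgebra_def)
qed

lemma conditional_drawsD:
  assumes "conditional_draws M V L B Y"
  shows "1 \<le> n \<Longrightarrow> B n k \<in> M \<rightarrow>\<^sub>M count_space UNIV"
    "1 \<le> n \<Longrightarrow> Y n \<in> M \<rightarrow>\<^sub>M count_space UNIV"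
  using assms by (auto simp: conditional_draws_def)

lemma draws_event_sets:
  assumes cd: "conditional_draws M V L B Y"
    and I: "finite I" "I \<subseteq> {1..} \<times> UNIV" and J: "finite J" "J \<subseteq> {1..}"
  shows "{\<omega> \<in> space M. (\<forall>(n, k)\<in>I. B n k \<omega> = b n k) \<and> (\<forall>n\<in>J. Y n \<omega> = y n)} \<in> sets M"
proof -
  have "{\<omega> \<in> space M. B (fst p) (snd p) \<omega> = b (fst p) (snd p)} \<in> sets M" if "p \<in> I" for p
    using measurable_sets[OF conditional_drawsD(1)[OF cd, of "fst p" "snd p"], of "{b (fst p) (snd p)}"] that I
    by (force simp: vimage_def Int_def conj_commute)
  moreover have "{\<omega> \<in> space M. Y n \<omega> = y n} \<in> sets M" if "n \<in> J" for n
    using measurable_sets[OF conditional_drawsD(2)[OF cd, of n], of "{y n}"] that J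
    by (force simp: vimage_def Int_def conj_commute)
  ultimately have "{\<omega> \<in> space M. (\<forall>p\<in>I. B (fst p) (snd p) \<omega> = b (fst p) (snd p)) \<and> (\<forall>n\<in>J. Y n \<omega> = y n)} \<in> sets M"
    by (intro sets.sets_Collect_conj sets.sets_Collect_finite_All I J)
  then show ?thesis by (simp add: case_prod_beta)
qed

text \<open>The mass functions are replaced by explicit expressions in \<open>V\<close> and
  \<open>L\<close>; the two agree for parameters in the admissible range.\<close>

lemma draws_mass_measurable:
  assumes rp: "random_params M V L"
  shows "(\<lambda>\<omega>. (\<Prod>(n, k)\<in>I. pmf (bernoulli_pmf (V k \<omega>)) (b n k)) *
    (\<Prod>n\<in>J. pmf (poisson_law (L \<omega>)) (y n))) \<in> borel_measurable M"
proof -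
  have [measurable]: "V k \<in> borel_measurable M" "L \<in> borel_measurable M" for k
    using random_paramsD(2,3)[OF rp] .
  let ?q = "\<lambda>\<omega>. (\<Prod>(n, k)\<in>I. if b n k then V k \<omega> else 1 - V k \<omega>) *
    (\<Prod>n\<in>J. L \<omega> ^ y n / fact (y n) * exp (- L \<omega>))"
  have "?q \<in> borel_measurable M"
    by (intro borel_measurable_times borel_measurable_prod) (auto simp: case_prod_beta)
  moreover have "(\<Prod>(n, k)\<in>I. pmf (bernoulli_pmf (V k \<omega>)) (b n k)) *
      (\<Prod>n\<in>J. pmf (poisson_law (L \<omega>)) (y n)) = ?q \<omega>" if "\<omega> \<in> space M" for \<omega>
    using random_paramsD(5-7)[OF rp that]
    by (intro arg_cong2[where f = "(*)"] prod.cong refl) (auto simp: pmf_poisson_law)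
  ultimately show ?thesis by (subst measurable_cong) auto
qed

lemma draws_prob:
  assumes rp: "random_params M V L" and cd: "conditional_draws M V L B Y"
    and I: "finite I" "I \<subseteq> {1..} \<times> UNIV" and J: "finite J" "J \<subseteq> {1..}"
  shows "measure M {\<omega> \<in> space M. (\<forall>(n, k)\<in>I. B n k \<omega> = b n k) \<and> (\<forall>n\<in>J. Y n \<omega> = y n)} =
    (\<integral>\<omega>. (\<Prod>(n, k)\<in>I. pmf (bernoulli_pmf (V k \<omega>)) (b n k)) * (\<Prod>n\<in>J. pmf (poisson_law (L \<omega>)) (y n)) \<partial>M)"
    (is "measure M ?E = (\<integral>\<omega>. ?p \<omega> \<partial>M)")
proof -
  let ?G = "vimage_algebra (space M) (params V L) param_space"
  interpret prob_space M by (rule random_paramsD(1)[OF rp])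
  interpret G: finite_measure_subalgebra M ?G by (rule params_subalgebra[OF rp])
  have E: "?E \<in> events" by (rule draws_event_sets[OF cd I J])
  have ae: "AE \<omega> in M. real_cond_exp M ?G (indicator ?E) \<omega> = ?p \<omega>"
    using cd I J unfolding conditional_draws_def by blast
  have int: "integrable M (indicator ?E :: _ \<Rightarrow> real)"
    using E by (intro integrable_real_indicator) (auto simp: less_top[symmetric])
  have "?p \<in> borel_measurable M" by (rule draws_mass_measurable[OF rp])
  then have "(\<integral>\<omega>. real_cond_exp M ?G (indicator ?E) \<omega> \<partial>M) = (\<integral>\<omega>. ?p \<omega> \<partial>M)"
    using ae G.real_cond_exp_int(1)[OF int] by (intro integral_cong_AE) auto
  then show ?thesis using G.real_cond_exp_int(2)[OF int] E by simp
qed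

lemma bernoulli_trace_prod:
  assumes v: "0 \<le> v" "v \<le> 1" and C: "C \<subseteq> {1..m}"
  shows "(\<Prod>n\<in>{1..m}. pmf (bernoulli_pmf v) (n \<in> C)) = v ^ card C * (1 - v) ^ (m - card C)"
proof -
  have "finite C" using C finite_subset by blast
  have "(\<Prod>n\<in>{1..m}. pmf (bernoulli_pmf v) (n \<in> C)) = (\<Prod>n\<in>{1..m}. if n \<in> C then v else 1 - v)"
    using v by (intro prod.cong) auto
  also have "\<dots> = (\<Prod>n\<in>{1..m} \<inter> C. v) * (\<Prod>n\<in>{1..m} \<inter> - C. 1 - v)"
    by (subst prod.If_cases) (auto simp: Int_def)
  also have "{1..m} \<inter> C = C" using C by auto
  also have "{1..m} \<inter> - C = {1..m} - C" by auto
  finally show ?thesis using C \<open>finite C\<close> by (simp add: card_Diff_subset)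
qed

lemma poisson_law_sums:
  assumes "0 \<le> l"
  shows "(\<lambda>y. s ^ y * pmf (poisson_law l) y) sums exp (- (l * (1 - s)))"
proof -
  have "(\<lambda>y. exp (- l) * ((l * s) ^ y /\<^sub>R fact y)) sums (exp (- l) * exp (l * s))"
    by (intro sums_mult exp_converges)
  then show ?thesis
    using assms by (simp add: pmf_poisson_law power_mult_distrib divide_inverse mult_ac exp_add[symmetric] algebra_simps)
qed

lemma integral_double_sum:
  fixes h :: "'b \<Rightarrow> 'c \<Rightarrow> 'a \<Rightarrow> real"
  assumes "\<And>x y. integrable M (h x y)"
  shows "(\<integral>\<omega>. (\<Sum>x\<in>X. \<Sum>y\<in>Y. w x y * h x y \<omega>) \<partial>M) = (\<Sum>x\<in>X. \<Sum>y\<in>Y. w x y * (\<integral>\<omega>. h x y \<omega> \<partial>M))"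
  by (subst Bochner_Integration.integral_sum; (intro Bochner_Integration.integrable_sum integrable_mult_right assms)?)
    (intro sum.cong refl, subst Bochner_Integration.integral_sum; simp add: assms)

text \<open>Cutting at \<open>K\<close> features and at counts up to \<open>R\<close> leaves
  finitely many configurations, each an event about finitely many draws. Both sides are expanded
  over these configurations and matched term by term through \<open>draws_prob\<close>.\<close>

lemma draws_pgf_truncated:
  assumes rp: "random_params M V L" and cd: "conditional_draws M V L B Y"
  shows "(\<integral>\<omega>. (\<Prod>k<K. t (trace_set B m k \<omega>)) *
      (\<Prod>n\<in>{1..m}. \<Sum>y\<le>R. if Y n \<omega> = y then t {n} ^ y else 0) \<partial>M) =
    (\<integral>\<omega>. (\<Prod>k<K. bernoulli_weight m t (V k \<omega>)) *
      (\<Prod>n\<in>{1..m}. \<Sum>y\<le>R. t {n} ^ y * pmf (poisson_law (L \<omega>)) y) \<partial>M)"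
proof -
  interpret prob_space M by (rule random_paramsD(1)[OF rp])
  \<comment> \<open>A configuration assigns a trace to each of the \<open>K\<close> features and a
    count to each index; distributing products over sums yields exactly these choice
    functions.\<close>
  let ?PC = "PiE {..<K} (\<lambda>_. Pow {1..m})" and ?PY = "PiE {1..m} (\<lambda>_. {..R})"
  let ?a = "\<lambda>c. \<Prod>k<K. t (c k)" and ?b = "\<lambda>y. \<Prod>n\<in>{1..m}. t {n} ^ y n"
  let ?I = "{1..m} \<times> {..<K}" and ?J = "{1..m}"
  let ?E = "\<lambda>c y. {\<omega> \<in> space M. (\<forall>(n, k)\<in>?I. B n k \<omega> = (n \<in> c k)) \<and> (\<forall>n\<in>?J. Y n \<omega> = y n)}"
  let ?p = "\<lambda>c y \<omega>. (\<Prod>(n, k)\<in>?I. pmf (bernoulli_pmf (V k \<omega>)) (n \<in> c k)) * (\<Prod>n\<in>?J. pmf (poisson_law (L \<omega>)) (y n))"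
  have IJ: "finite ?I" "?I \<subseteq> {1..} \<times> UNIV" "finite ?J" "?J \<subseteq> {1..}" by auto
  note E = draws_event_sets[OF cd IJ]
  have ite: "(\<Prod>x\<in>A. if P x then g x else 0) = (\<Prod>x\<in>A. g x) * (if \<forall>x\<in>A. P x then 1 else 0)"
    if "finite A" for A :: "nat set" and P and g :: "nat \<Rightarrow> real"
    using that by (induction A rule: finite_induct) auto
  have lhs: "(\<Prod>k<K. t (trace_set B m k \<omega>)) * (\<Prod>n\<in>{1..m}. \<Sum>y\<le>R. if Y n \<omega> = y then t {n} ^ y else 0) =
      (\<Sum>c\<in>?PC. \<Sum>y\<in>?PY. ?a c * ?b y * indicator (?E c y) \<omega>)" if w: "\<omega> \<in> space M" for \<omega>
  proof -
    have "(\<Prod>k<K. t (trace_set B m k \<omega>)) = (\<Prod>k<K. \<Sum>C\<in>Pow {1..m}. if trace_set B m k \<omega> = C then t C else 0)"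
      by (intro prod.cong refl) (auto simp: sum.delta)
    also have "\<dots> = (\<Sum>c\<in>?PC. \<Prod>k<K. if trace_set B m k \<omega> = c k then t (c k) else 0)"
      by (rule prod_sum_PiE) auto
    finally have 1: "(\<Prod>k<K. t (trace_set B m k \<omega>)) =
        (\<Sum>c\<in>?PC. ?a c * (if \<forall>k\<in>{..<K}. trace_set B m k \<omega> = c k then 1 else 0))"
      by (simp only: ite finite_lessThan)
    have "(\<Prod>n\<in>{1..m}. \<Sum>y\<le>R. if Y n \<omega> = y then t {n} ^ y else 0) =
        (\<Sum>y\<in>?PY. \<Prod>n\<in>{1..m}. if Y n \<omega> = y n then t {n} ^ y n else 0)"
      by (rule prod_sum_PiE) auto
    then have 2: "(\<Prod>n\<in>{1..m}. \<Sum>y\<le>R. if Y n \<omega> = y then t {n} ^ y else 0) =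
        (\<Sum>y\<in>?PY. ?b y * (if \<forall>n\<in>?J. Y n \<omega> = y n then 1 else 0))"
      by (simp only: ite finite_atLeastAtMost)
    have "(\<forall>k\<in>{..<K}. trace_set B m k \<omega> = c k) \<longleftrightarrow> (\<forall>(n, k)\<in>?I. B n k \<omega> = (n \<in> c k))"
      if c: "c \<in> ?PC" for c
    proof -
      have "c k \<subseteq> {1..m}" if "k < K" for k using PiE_mem[OF c] that by auto
      then have "trace_set B m k \<omega> = c k \<longleftrightarrow> (\<forall>n\<in>{1..m}. B n k \<omega> = (n \<in> c k))" if "k < K" for k
        using that by (fastforce simp: feature_set_def)
      then show ?thesis by auto
    qed
    then show ?thesis
      unfolding 1 2 sum_product using w by (intro sum.cong refl) (auto simp: indicator_def)
  qed
  have rhs: "(\<Prod>k<K. bernoulli_weight m t (V k \<omega>)) * (\<Prod>n\<in>{1..m}. \<Sum>y\<le>R. t {n} ^ y * pmf (poisson_law (L \<omega>)) y) =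
      (\<Sum>c\<in>?PC. \<Sum>y\<in>?PY. ?a c * ?b y * ?p c y \<omega>)" if w: "\<omega> \<in> space M" for \<omega>
  proof -
    have "(\<Prod>k<K. bernoulli_weight m t (V k \<omega>)) =
        (\<Prod>k<K. \<Sum>C\<in>Pow {1..m}. t C * (\<Prod>n\<in>{1..m}. pmf (bernoulli_pmf (V k \<omega>)) (n \<in> C)))"
      unfolding bernoulli_weight_def using random_paramsD(5,6)[OF rp w]
      by (intro prod.cong sum.cong refl) (simp only: bernoulli_trace_prod Pow_iff)
    also have "\<dots> = (\<Sum>c\<in>?PC. \<Prod>k<K. t (c k) * (\<Prod>n\<in>{1..m}. pmf (bernoulli_pmf (V k \<omega>)) (n \<in> c k)))"
      by (rule prod_sum_PiE) auto
    also have "\<dots> = (\<Sum>c\<in>?PC. ?a c * (\<Prod>(n, k)\<in>?I. pmf (bernoulli_pmf (V k \<omega>)) (n \<in> c k)))"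
      by (subst prod.cartesian_product[symmetric], subst prod.swap) (simp add: prod.distrib)
    finally have 1: "(\<Prod>k<K. bernoulli_weight m t (V k \<omega>)) =
        (\<Sum>c\<in>?PC. ?a c * (\<Prod>(n, k)\<in>?I. pmf (bernoulli_pmf (V k \<omega>)) (n \<in> c k)))" .
    have "(\<Prod>n\<in>{1..m}. \<Sum>y\<le>R. t {n} ^ y * pmf (poisson_law (L \<omega>)) y) =
        (\<Sum>y\<in>?PY. \<Prod>n\<in>{1..m}. t {n} ^ y n * pmf (poisson_law (L \<omega>)) (y n))"
      by (rule prod_sum_PiE) auto
    then have 2: "(\<Prod>n\<in>{1..m}. \<Sum>y\<le>R. t {n} ^ y * pmf (poisson_law (L \<omega>)) y) =
        (\<Sum>y\<in>?PY. ?b y * (\<Prod>n\<in>?J. pmf (poisson_law (L \<omega>)) (y n)))"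
      by (simp only: prod.distrib)
    show ?thesis
      unfolding 1 2 sum_product by (intro sum.cong refl) (simp only: mult_ac)
  qed
  have pint: "integrable M (?p c y)" for c y
  proof -
    have "?p c y \<in> borel_measurable M" by (rule draws_mass_measurable[OF rp])
    moreover have "0 \<le> ?p c y \<omega>" "?p c y \<omega> \<le> 1" for \<omega>
      by (auto intro!: mult_nonneg_nonneg prod_nonneg mult_le_one prod_le_1 simp: pmf_le_1)
    ultimately show ?thesis by (intro integrable_const_bound[where B = 1]) auto
  qed
  have eint: "integrable M (indicator (?E c y) :: _ \<Rightarrow> real)" for c y
    using E by (intro integrable_real_indicator) (auto simp: less_top[symmetric])
  have "(\<integral>\<omega>. (\<Prod>k<K. t (trace_set B m k \<omega>)) *
      (\<Prod>n\<in>{1..m}. \<Sum>y\<le>R. if Y n \<omega> = y then t {n} ^ y else 0) \<partial>M) =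
      (\<integral>\<omega>. (\<Sum>c\<in>?PC. \<Sum>y\<in>?PY. ?a c * ?b y * indicator (?E c y) \<omega>) \<partial>M)"
    by (rule Bochner_Integration.integral_cong[OF refl lhs])
  also have "\<dots> = (\<Sum>c\<in>?PC. \<Sum>y\<in>?PY. ?a c * ?b y * (\<integral>\<omega>. indicator (?E c y) \<omega> \<partial>M))"
    by (rule integral_double_sum[OF eint])
  also have "\<dots> = (\<Sum>c\<in>?PC. \<Sum>y\<in>?PY. ?a c * ?b y * (\<integral>\<omega>. ?p c y \<omega> \<partial>M))"
    using E by (intro sum.cong refl arg_cong2[where f = "(*)"])
      (subst draws_prob[OF rp cd IJ, symmetric], simp)
  also have "\<dots> = (\<integral>\<omega>. (\<Sum>c\<in>?PC. \<Sum>y\<in>?PY. ?a c * ?b y * ?p c y \<omega>) \<partial>M)"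
    by (rule integral_double_sum[OF pint, symmetric])
  also have "\<dots> = (\<integral>\<omega>. (\<Prod>k<K. bernoulli_weight m t (V k \<omega>)) *
      (\<Prod>n\<in>{1..m}. \<Sum>y\<le>R. t {n} ^ y * pmf (poisson_law (L \<omega>)) y) \<partial>M)"
    by (rule Bochner_Integration.integral_cong[OF refl rhs[symmetric]])
  finally show ?thesis .
qed

lemma trace_weight_measurable:
  fixes t :: "nat set \<Rightarrow> real"
  assumes cd: "conditional_draws M V L B Y"
  shows "(\<lambda>\<omega>. t (trace_set B m k \<omega>)) \<in> borel_measurable M"
proof -
  have [measurable]: "B n k \<in> M \<rightarrow>\<^sub>M count_space UNIV" if "n \<in> {1..m}" for n
    using conditional_drawsD(1)[OF cd, of n] that by auto
  have eq: "trace_set B m k \<omega> = {n \<in> {1..m}. B n k \<omega>}" for \<omega>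
    by (auto simp: feature_set_def)
  have "(\<lambda>\<omega>. \<Sum>C\<in>Pow {1..m}. t C * (\<Prod>n\<in>{1..m}. if B n k \<omega> = (n \<in> C) then 1 else 0)) \<in> borel_measurable M"
    by (intro borel_measurable_sum borel_measurable_times borel_measurable_prod borel_measurable_const measurable_If)
      measurable
  moreover have sum_eq: "(\<Sum>C\<in>Pow {1..m}. t C * (\<Prod>n\<in>{1..m}. if B n k \<omega> = (n \<in> C) then 1 else 0)) =
      t (trace_set B m k \<omega>)" for \<omega>
  proof -
    have "(\<Prod>n\<in>{1..m}. if B n k \<omega> = (n \<in> C) then 1 else 0 :: real) = (if C = trace_set B m k \<omega> then 1 else 0)"
      if "C \<subseteq> {1..m}" for C
      unfolding eq using that by (auto simp: prod_zero_iff)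
    then have "(\<Sum>C\<in>Pow {1..m}. t C * (\<Prod>n\<in>{1..m}. if B n k \<omega> = (n \<in> C) then 1 else 0)) =
        (\<Sum>C\<in>Pow {1..m}. if C = trace_set B m k \<omega> then t C else 0)"
      by (intro sum.cong refl) auto
    then show ?thesis by simp
  qed
  ultimately show ?thesis by (simp only: sum_eq)
qed

text \<open>The limit \<open>R\<close> to infinity of the truncated identity, by dominated
  convergence on both sides. On the right the Poisson sums become
  \<open>exp (- (L \<omega> * (1 - t {n})))\<close>.\<close>

lemma draws_pgf:
  assumes rp: "random_params M V L" and cd: "conditional_draws M V L B Y" and t: "unit_weight t"
  shows "(\<integral>\<omega>. (\<Prod>k<K. t (trace_set B m k \<omega>)) * (\<Prod>n\<in>{1..m}. t {n} ^ Y n \<omega>) \<partial>M) =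
    (\<integral>\<omega>. (\<Prod>k<K. bernoulli_weight m t (V k \<omega>)) * exp (- (singleton_loss m t * L \<omega>)) \<partial>M)"
proof -
  interpret prob_space M by (rule random_paramsD(1)[OF rp])
  note tb = unit_weightD(2,3)[OF t]
  have [measurable]: "V k \<in> borel_measurable M" "L \<in> borel_measurable M" for k
    using random_paramsD(2,3)[OF rp] .
  have [measurable]: "B n k \<in> M \<rightarrow>\<^sub>M count_space UNIV" "Y n \<in> M \<rightarrow>\<^sub>M count_space UNIV" if "n \<in> {1..m}" for n k
    using conditional_drawsD[OF cd, of n] that by auto
  note trace_meas = trace_weight_measurable[OF cd]
  have [measurable]: "bernoulli_weight m t \<in> borel_measurable borel"
    unfolding bernoulli_weight_def by measurable
  have prod01: "0 \<le> (\<Prod>k<K. t (trace_set B m k \<omega>))" "(\<Prod>k<K. t (trace_set B m k \<omega>)) \<le> 1" for \<omega>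
    using tb by (auto intro!: prod_nonneg prod_le_1)
  have norm_le: "norm (a * b) \<le> (1::real)" if "0 \<le> a" "a \<le> 1" "0 \<le> b" "b \<le> 1" for a b :: real
    using that by (simp add: abs_mult mult_le_one)
  have "(\<lambda>R. \<integral>\<omega>. (\<Prod>k<K. t (trace_set B m k \<omega>)) *
        (\<Prod>n\<in>{1..m}. \<Sum>y\<le>R. if Y n \<omega> = y then t {n} ^ y else 0) \<partial>M) \<longlonglongrightarrow>
      (\<integral>\<omega>. (\<Prod>k<K. t (trace_set B m k \<omega>)) * (\<Prod>n\<in>{1..m}. t {n} ^ Y n \<omega>) \<partial>M)"
  proof (rule integral_dominated_convergence[where w = "\<lambda>_. 1"])
    have "(\<lambda>R. \<Sum>y\<le>R. if Y n \<omega> = y then t {n} ^ y else 0) \<longlonglongrightarrow> t {n} ^ Y n \<omega>" for n \<omega>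
      by (intro tendsto_eventually eventually_mono[OF eventually_ge_at_top[of "Y n \<omega>"]]) simp
    then show "AE \<omega> in M. (\<lambda>R. (\<Prod>k<K. t (trace_set B m k \<omega>)) *
        (\<Prod>n\<in>{1..m}. \<Sum>y\<le>R. if Y n \<omega> = y then t {n} ^ y else 0)) \<longlonglongrightarrow>
        (\<Prod>k<K. t (trace_set B m k \<omega>)) * (\<Prod>n\<in>{1..m}. t {n} ^ Y n \<omega>)"
      by (intro AE_I2 tendsto_intros)
    show "AE \<omega> in M. norm ((\<Prod>k<K. t (trace_set B m k \<omega>)) *
        (\<Prod>n\<in>{1..m}. \<Sum>y\<le>R. if Y n \<omega> = y then t {n} ^ y else 0)) \<le> 1" for R
      using tb prod01 by (intro AE_I2 norm_le prod_nonneg prod_le_1) (auto simp: sum.delta power_le_one)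
    show "(\<lambda>\<omega>. (\<Prod>k<K. t (trace_set B m k \<omega>)) * (\<Prod>n\<in>{1..m}. t {n} ^ Y n \<omega>)) \<in> borel_measurable M"
      by (intro borel_measurable_times borel_measurable_prod trace_meas) measurable
    show "(\<lambda>\<omega>. (\<Prod>k<K. t (trace_set B m k \<omega>)) *
        (\<Prod>n\<in>{1..m}. \<Sum>y\<le>R. if Y n \<omega> = y then t {n} ^ y else 0)) \<in> borel_measurable M" for R
      by (intro borel_measurable_times borel_measurable_prod borel_measurable_sum trace_meas) measurable
  qed simp
  moreover have "(\<lambda>R. \<integral>\<omega>. (\<Prod>k<K. bernoulli_weight m t (V k \<omega>)) *
        (\<Prod>n\<in>{1..m}. \<Sum>y\<le>R. t {n} ^ y * pmf (poisson_law (L \<omega>)) y) \<partial>M) \<longlonglongrightarrow>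
      (\<integral>\<omega>. (\<Prod>k<K. bernoulli_weight m t (V k \<omega>)) * exp (- (singleton_loss m t * L \<omega>)) \<partial>M)"
  proof (rule integral_dominated_convergence[where w = "\<lambda>_. 1"])
    show "AE \<omega> in M. (\<lambda>R. (\<Prod>k<K. bernoulli_weight m t (V k \<omega>)) *
        (\<Prod>n\<in>{1..m}. \<Sum>y\<le>R. t {n} ^ y * pmf (poisson_law (L \<omega>)) y)) \<longlonglongrightarrow>
        (\<Prod>k<K. bernoulli_weight m t (V k \<omega>)) * exp (- (singleton_loss m t * L \<omega>))"
    proof (rule AE_I2)
      fix \<omega> assume "\<omega> \<in> space M"
      then have "(\<lambda>R. \<Sum>y\<le>R. t {n} ^ y * pmf (poisson_law (L \<omega>)) y) \<longlonglongrightarrow> exp (- (L \<omega> * (1 - t {n})))" for n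
        using poisson_law_sums[OF random_paramsD(7)[OF rp]] by (simp add: sums_def_le)
      then have "(\<lambda>R. (\<Prod>k<K. bernoulli_weight m t (V k \<omega>)) *
          (\<Prod>n\<in>{1..m}. \<Sum>y\<le>R. t {n} ^ y * pmf (poisson_law (L \<omega>)) y)) \<longlonglongrightarrow>
          (\<Prod>k<K. bernoulli_weight m t (V k \<omega>)) * (\<Prod>n\<in>{1..m}. exp (- (L \<omega> * (1 - t {n}))))"
        by (intro tendsto_intros)
      also have "(\<Prod>n\<in>{1..m}. exp (- (L \<omega> * (1 - t {n})))) = exp (- (singleton_loss m t * L \<omega>))"
        by (subst exp_sum[symmetric]) (simp_all add: singleton_loss_def sum_negf sum_distrib_left sum_distrib_right mult.commute)
      finally show "(\<lambda>R. (\<Prod>k<K. bernoulli_weight m t (V k \<omega>)) *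
          (\<Prod>n\<in>{1..m}. \<Sum>y\<le>R. t {n} ^ y * pmf (poisson_law (L \<omega>)) y)) \<longlonglongrightarrow>
          (\<Prod>k<K. bernoulli_weight m t (V k \<omega>)) * exp (- (singleton_loss m t * L \<omega>))" .
    qed
    have pois01: "0 \<le> (\<Sum>y\<le>R. t {n} ^ y * pmf (poisson_law l) y)" "(\<Sum>y\<le>R. t {n} ^ y * pmf (poisson_law l) y) \<le> 1" for R n l
    proof -
      show "0 \<le> (\<Sum>y\<le>R. t {n} ^ y * pmf (poisson_law l) y)" using tb by (auto intro!: sum_nonneg)
      have "(\<Sum>y\<le>R. t {n} ^ y * pmf (poisson_law l) y) \<le> (\<Sum>y\<le>R. 1 * pmf (poisson_law l) y)"
        using tb by (intro sum_mono mult_right_mono power_le_one) auto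
      also have "\<dots> \<le> 1"
        using measure_pmf.prob_le_1[of "poisson_law l" "{..R}"] by (simp add: measure_measure_pmf_finite)
      finally show "(\<Sum>y\<le>R. t {n} ^ y * pmf (poisson_law l) y) \<le> 1" .
    qed
    show "AE \<omega> in M. norm ((\<Prod>k<K. bernoulli_weight m t (V k \<omega>)) *
        (\<Prod>n\<in>{1..m}. \<Sum>y\<le>R. t {n} ^ y * pmf (poisson_law (L \<omega>)) y)) \<le> 1" for R
      using random_paramsD(5,6)[OF rp] pois01
      by (intro AE_I2 norm_le prod_nonneg prod_le_1 bernoulli_weight_prod_bounds[OF t]) (auto intro!: bernoulli_weight_bounds[OF t])
    show "(\<lambda>\<omega>. (\<Prod>k<K. bernoulli_weight m t (V k \<omega>)) *
        (\<Prod>n\<in>{1..m}. \<Sum>y\<le>R. t {n} ^ y * pmf (poisson_law (L \<omega>)) y)) \<in> borel_measurable M" for R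
    proof -
      have "(\<lambda>\<omega>. (\<Prod>k<K. bernoulli_weight m t (V k \<omega>)) *
          (\<Prod>n\<in>{1..m}. \<Sum>y\<le>R. t {n} ^ y * (L \<omega> ^ y / fact y * exp (- L \<omega>)))) \<in> borel_measurable M" by measurable
      then show ?thesis
        by (rule measurable_cong[THEN iffD1, rotated]) (simp add: pmf_poisson_law random_paramsD(7)[OF rp])
    qed
  qed simp_all
  ultimately show ?thesis
    unfolding draws_pgf_truncated[OF rp cd] by (rule LIMSEQ_unique)
qed

section \<open>Only finitely many features meet a finite set of indices\<close>

lemma no_feature_prob:
  assumes rp: "random_params M V L" and cd: "conditional_draws M V L B Y"
  shows "measure M {\<omega>\<in>space M. \<forall>n\<in>{1..m}. \<forall>k\<in>{i..<j}. \<not> B n k \<omega>} =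
    (\<integral>\<omega>. (\<Prod>k\<in>{i..<j}. 1 - V k \<omega>) ^ m \<partial>M)"
proof -
  have "measure M {\<omega>\<in>space M. \<forall>n\<in>{1..m}. \<forall>k\<in>{i..<j}. \<not> B n k \<omega>} =
      measure M {\<omega> \<in> space M. (\<forall>(n, k)\<in>{1..m} \<times> {i..<j}. B n k \<omega> = False) \<and> (\<forall>n\<in>{}. Y n \<omega> = 0)}"
    by (intro arg_cong[where f = "measure M"]) auto
  also have "\<dots> = (\<integral>\<omega>. (\<Prod>(n, k)\<in>{1..m} \<times> {i..<j}. pmf (bernoulli_pmf (V k \<omega>)) False) \<partial>M)"
    by (subst draws_prob[OF rp cd]) auto
  also have "\<dots> = (\<integral>\<omega>. (\<Prod>k\<in>{i..<j}. 1 - V k \<omega>) ^ m \<partial>M)"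
  proof (rule Bochner_Integration.integral_cong[OF refl])
    fix \<omega> assume "\<omega> \<in> space M"
    then show "(\<Prod>(n, k)\<in>{1..m} \<times> {i..<j}. pmf (bernoulli_pmf (V k \<omega>)) False) = (\<Prod>k\<in>{i..<j}. 1 - V k \<omega>) ^ m"
      using random_paramsD(5,6)[OF rp] by (subst prod.cartesian_product[symmetric]) simp
  qed
  finally show ?thesis .
qed

text \<open>A Borel-Cantelli argument made conditional on the frequencies: the probability that no
  feature from \<open>i\<close> on meets \<open>{1..m}\<close> is bounded below in terms of the tail
  sum of the frequencies, and the tail vanishes. The tail need not be integrable, so the bound
  \<open>1 - m * \<rho> i \<omega>\<close> is cut off at 0 before taking expectations.\<close>

lemma eventually_no_features:
  assumes rp: "random_params M V L" and cd: "conditional_draws M V L B Y"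
  shows "AE \<omega> in M. \<exists>i. \<forall>n\<in>{1..m}. \<forall>k\<ge>i. \<not> B n k \<omega>"
proof -
  interpret prob_space M by (rule random_paramsD(1)[OF rp])
  let ?A = "\<lambda>i. {\<omega>\<in>space M. \<forall>n\<in>{1..m}. \<forall>k\<ge>i. \<not> B n k \<omega>}"
  \<comment> \<open>The conditional law covers finite families of draws only, so a finite window of
    features is treated first and then extended to infinity.\<close>
  let ?A' = "\<lambda>i j. {\<omega>\<in>space M. \<forall>n\<in>{1..m}. \<forall>k\<in>{i..<j}. \<not> B n k \<omega>}"
  have [measurable]: "V k \<in> borel_measurable M" for k using random_paramsD(2)[OF rp] .
  have Bm: "{\<omega>\<in>space M. \<not> B n k \<omega>} \<in> events" if "n \<in> {1..m}" for n k
    using measurable_sets[OF conditional_drawsD(1)[OF cd, of n k], of "{False}"] that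
    by (simp add: vimage_def Int_def conj_commute)
  have A': "?A' i j \<in> events" for i j
    by (intro sets.sets_Collect_finite_All' sets.sets_Collect_finite_All Bm) auto
  have Int: "(\<Inter>j. ?A' i j) = ?A i" for i
  proof (intro equalityI subsetI)
    fix \<omega> assume w: "\<omega> \<in> (\<Inter>j. ?A' i j)"
    have "\<not> B n k \<omega>" if "n \<in> {1..m}" "i \<le> k" for n k
    proof -
      have "\<omega> \<in> ?A' i (Suc k)" using w by blast
      then show ?thesis using that by simp
    qed
    then show "\<omega> \<in> ?A i" using w by simp
  qed auto
  have A: "?A i \<in> events" for i
    unfolding Int[symmetric] using A' by (intro sets.countable_INT) auto
  define \<rho> where "\<rho> i \<omega> = (\<Sum>k. V (k + i) \<omega>)" for i \<omega>
  have [measurable]: "\<rho> i \<in> borel_measurable M" for i unfolding \<rho>_def by measurable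
  have lower: "expectation (\<lambda>\<omega>. max 0 (1 - m * \<rho> i \<omega>)) \<le> prob (?A i)" for i
  proof -
    have "(\<lambda>j. prob (?A' i j)) \<longlonglongrightarrow> prob (\<Inter>j. ?A' i j)"
    proof (rule finite_Lim_measure_decseq)
      show "range (\<lambda>j. ?A' i j) \<subseteq> events" using A' by auto
      show "decseq (\<lambda>j. ?A' i j)" by (auto simp: decseq_def)
    qed
    then have lim: "(\<lambda>j. prob (?A' i j)) \<longlonglongrightarrow> prob (?A i)" unfolding Int .
    have "expectation (\<lambda>\<omega>. max 0 (1 - m * \<rho> i \<omega>)) \<le> prob (?A' i j)" for j
      unfolding no_feature_prob[OF rp cd]
    proof (rule integral_mono_AE')
      show "integrable M (\<lambda>\<omega>. (\<Prod>k\<in>{i..<j}. 1 - V k \<omega>) ^ m)"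
        using random_paramsD(5,6)[OF rp]
        by (intro integrable_const_bound[where B = 1] AE_I2)
          (auto simp: abs_prod power_abs intro!: power_le_one prod_le_1 prod_nonneg)
      show "AE \<omega> in M. max 0 (1 - m * \<rho> i \<omega>) \<le> (\<Prod>k\<in>{i..<j}. 1 - V k \<omega>) ^ m"
        using random_paramsD(4)[OF rp] AE_space
      proof eventually_elim
        case (elim \<omega>)
        note v = random_paramsD(5,6)[OF rp elim(2)]
        have sm: "summable (\<lambda>k. V (k + i) \<omega>)" using elim(1) by (rule summable_ignore_initial_segment)
        have "(\<Sum>k\<in>{i..<j}. V k \<omega>) = (\<Sum>k<j - i. V (k + i) \<omega>)"
          by (rule sum.reindex_bij_witness[of _ "\<lambda>k. k + i" "\<lambda>k. k - i"]) auto
        also have "\<dots> \<le> \<rho> i \<omega>" unfolding \<rho>_def using sm v by (intro sum_le_suminf) auto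
        finally have s: "(\<Sum>k\<in>{i..<j}. V k \<omega>) \<le> \<rho> i \<omega>" .
        have "1 - m * \<rho> i \<omega> \<le> 1 - (\<Sum>n\<in>{1..m}. \<Sum>k\<in>{i..<j}. V k \<omega>)"
          using s by (simp add: mult_left_mono)
        also have "\<dots> = 1 - (\<Sum>p\<in>{1..m} \<times> {i..<j}. V (snd p) \<omega>)"
          by (simp only: sum.cartesian_product case_prod_unfold)
        \<comment> \<open>Weierstrass: a product of factors \<open>1 - x\<close> is at least 1 minus
          the sum of the \<open>x\<close>, for \<open>x\<close> in [0,1].\<close>
        also have "\<dots> \<le> (\<Prod>p\<in>{1..m} \<times> {i..<j}. 1 - V (snd p) \<omega>)"
          using v by (intro Weierstrass_prod_ineq) auto
        also have "\<dots> = (\<Prod>k\<in>{i..<j}. 1 - V k \<omega>) ^ m"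
          using prod.cartesian_product[of "\<lambda>n k. 1 - V k \<omega>" "{i..<j}" "{1..m}"] by (simp add: case_prod_beta)
        finally show ?case using v by (auto intro!: zero_le_power prod_nonneg)
      qed
      show "AE \<omega> in M. 0 \<le> (\<Prod>k\<in>{i..<j}. 1 - V k \<omega>) ^ m"
        using random_paramsD(6)[OF rp] by (intro AE_I2 zero_le_power prod_nonneg) auto
    qed
    then show ?thesis by (intro LIMSEQ_le_const[OF lim]) auto
  qed
  have tail_lim: "(\<lambda>i. expectation (\<lambda>\<omega>. max 0 (1 - m * \<rho> i \<omega>))) \<longlonglongrightarrow> expectation (\<lambda>\<omega>. 1)"
  proof (rule integral_dominated_convergence[where w = "\<lambda>_. 1"])
    show "AE \<omega> in M. (\<lambda>i. max 0 (1 - m * \<rho> i \<omega>)) \<longlonglongrightarrow> 1"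
      using random_paramsD(4)[OF rp]
    proof (rule eventually_mono)
      fix \<omega> assume "summable (\<lambda>k. V k \<omega>)"
      then have "(\<lambda>i. \<rho> i \<omega>) \<longlonglongrightarrow> 0" unfolding \<rho>_def by (rule suminf_exist_split2)
      then have "(\<lambda>i. max 0 (1 - m * \<rho> i \<omega>)) \<longlonglongrightarrow> max 0 (1 - real m * 0)"
        by (intro tendsto_intros)
      then show "(\<lambda>i. max 0 (1 - m * \<rho> i \<omega>)) \<longlonglongrightarrow> 1" by simp
    qed
    show "AE \<omega> in M. norm (max 0 (1 - m * \<rho> i \<omega>)) \<le> 1" for i
      using random_paramsD(4)[OF rp] AE_space
    proof eventually_elim
      case (elim \<omega>)
      have "0 \<le> \<rho> i \<omega>" unfolding \<rho>_def
        using summable_ignore_initial_segment[OF elim(1), of i] random_paramsD(5)[OF rp elim(2)]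
        by (intro suminf_nonneg) auto
      then show ?case by simp
    qed
  qed auto
  have le: "expectation (\<lambda>\<omega>. max 0 (1 - m * \<rho> i \<omega>)) \<le> prob (\<Union>i. ?A i)" for i
  proof -
    have "prob (?A i) \<le> prob (\<Union>i. ?A i)"
    proof (rule finite_measure_mono)
      show "?A i \<subseteq> (\<Union>i. ?A i)" by (rule UN_upper) simp
      show "(\<Union>i. ?A i) \<in> events" by (rule sets.countable_UN) (use A in blast)
    qed
    with lower[of i] show ?thesis by (rule order.trans)
  qed
  have "expectation (\<lambda>\<omega>. 1) \<le> prob (\<Union>i. ?A i)"
    by (rule LIMSEQ_le_const2[OF tail_lim]) (use le in blast)
  then have "1 \<le> prob (\<Union>i. ?A i)" by (simp add: prob_space)
  then have "prob (\<Union>i. ?A i) = 1" by (rule antisym[OF prob_le_1])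
  then have "AE \<omega> in M. \<omega> \<in> (\<Union>i. ?A i)" by (rule AE_prob_1)
  then show ?thesis by (rule eventually_mono) auto
qed

lemma finitely_many_traces:
  assumes rp: "random_params M V L" and cd: "conditional_draws M V L B Y"
  shows "AE \<omega> in M. \<forall>m. finite {k. trace_set B m k \<omega> \<noteq> {}}"
  unfolding AE_all_countable
proof
  fix m
  show "AE \<omega> in M. finite {k. trace_set B m k \<omega> \<noteq> {}}"
    using eventually_no_features[OF rp cd, of m]
  proof (rule eventually_mono)
    fix \<omega> assume "\<exists>i. \<forall>n\<in>{1..m}. \<forall>k\<ge>i. \<not> B n k \<omega>"
    then obtain i where "\<forall>n\<in>{1..m}. \<forall>k\<ge>i. \<not> B n k \<omega>" by blast
    then have "{k. trace_set B m k \<omega> \<noteq> {}} \<subseteq> {..<i}"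
      by (auto simp: feature_set_def)
    then show "finite {k. trace_set B m k \<omega> \<noteq> {}}" using finite_subset by blast
  qed
qed

section \<open>The generated allocation: generating function, measurability and consistency\<close>

lemma prod_mset_image_sum:
  fixes t :: "'b \<Rightarrow> real"
  assumes "finite S"
  shows "(\<Prod>x\<in>#(\<Sum>n\<in>S. f n). t x) = (\<Prod>n\<in>S. \<Prod>x\<in>#f n. t x)"
  using assms by (induction S rule: finite_induct) auto

text \<open>This holds even if infinitely many traces are non-empty: then \<open>mset_set\<close> is
  empty and the product over the infinite set is 1.\<close>

lemma prod_generated_alloc:
  fixes t :: "nat set \<Rightarrow> real"
  shows "(\<Prod>A\<in>#generated_alloc B Y m \<omega>. t A) =
    (\<Prod>k\<in>{k. trace_set B m k \<omega> \<noteq> {}}. t (trace_set B m k \<omega>)) * (\<Prod>n\<in>{1..m}. t {n} ^ Y n \<omega>)"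
  unfolding generated_alloc_def image_mset_union prod_mset.union
  by (subst prod_mset_image_sum) (simp_all add: prod_unfold_prod_mset image_mset.compositionality o_def)

lemma generated_alloc_in_feature_allocs: "generated_alloc B Y N \<omega> \<in> feature_allocs N"
proof (cases "finite {k. trace_set B N k \<omega> \<noteq> {}}")
  case True
  then show ?thesis
    by (auto simp: feature_allocs_def generated_alloc_def set_mset_sum in_replicate_mset split: if_splits)
next
  case False
  then show ?thesis
    by (auto simp: feature_allocs_def generated_alloc_def set_mset_sum in_replicate_mset split: if_splits)
qed

text \<open>On the left the product over the first \<open>K\<close> features is almost surely
  constant from some \<open>K\<close> on, by the finiteness of the traces. On the right the partial
  products converge by monotonicity.\<close>

lemma generated_alloc_pgf:
  assumes rp: "random_params M V L" and cd: "conditional_draws M V L B Y" and t: "unit_weight t"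
    and meas: "generated_alloc B Y m \<in> M \<rightarrow>\<^sub>M alloc_space m"
  shows "(\<integral>\<omega>. (\<Prod>A\<in>#generated_alloc B Y m \<omega>. t A) \<partial>M) = (\<integral>\<omega>. ffm_pgf m t (\<lambda>k. V k \<omega>) (L \<omega>) \<partial>M)"
proof -
  interpret prob_space M by (rule random_paramsD(1)[OF rp])
  note tb = unit_weightD(2,3)[OF t]
  let ?P = "\<lambda>K \<omega>. (\<Prod>k<K. t (trace_set B m k \<omega>)) * (\<Prod>n\<in>{1..m}. t {n} ^ Y n \<omega>)"
  let ?Q = "\<lambda>K \<omega>. (\<Prod>k<K. bernoulli_weight m t (V k \<omega>)) * exp (- (singleton_loss m t * L \<omega>))"
  have [measurable]: "V k \<in> borel_measurable M" "L \<in> borel_measurable M" for k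
    using random_paramsD(2,3)[OF rp] .
  have [measurable]: "bernoulli_weight m t \<in> borel_measurable borel"
    unfolding bernoulli_weight_def by measurable
  have v01: "0 \<le> V k \<omega> \<and> V k \<omega> \<le> 1" if "\<omega> \<in> space M" for k \<omega>
    using random_paramsD(5,6)[OF rp that] by blast
  have "(\<lambda>K. \<integral>\<omega>. ?P K \<omega> \<partial>M) \<longlonglongrightarrow> (\<integral>\<omega>. (\<Prod>A\<in>#generated_alloc B Y m \<omega>. t A) \<partial>M)"
  proof -
    have eq: "(\<integral>\<omega>. ?P K \<omega> \<partial>M) = (\<integral>\<omega>. ?Q K \<omega> \<partial>M)" for K
      by (rule draws_pgf[OF rp cd t])
    have tr: "(\<lambda>\<omega>. t (trace_set B m k \<omega>)) \<in> borel_measurable M" for k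
      by (rule trace_weight_measurable[OF cd])
    have Ym: "Y n \<in> M \<rightarrow>\<^sub>M count_space UNIV" if "n \<in> {1..m}" for n
      using conditional_drawsD(2)[OF cd] that by simp
    show ?thesis
    proof (rule integral_dominated_convergence[where w = "\<lambda>_. 1"])
      show "AE \<omega> in M. (\<lambda>K. ?P K \<omega>) \<longlonglongrightarrow> (\<Prod>A\<in>#generated_alloc B Y m \<omega>. t A)"
        using finitely_many_traces[OF rp cd]
      proof (rule eventually_mono)
        fix \<omega> assume "\<forall>m. finite {k. trace_set B m k \<omega> \<noteq> {}}"
        then have fin: "finite {k. trace_set B m k \<omega> \<noteq> {}}" by blast
        then obtain K0 where K0: "{k. trace_set B m k \<omega> \<noteq> {}} \<subseteq> {..<K0}"
          using finite_nat_iff_bounded by blast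
        have "?P K \<omega> = (\<Prod>A\<in>#generated_alloc B Y m \<omega>. t A)" if "K0 \<le> K" for K
        proof -
          have "(\<Prod>k\<in>{k. trace_set B m k \<omega> \<noteq> {}}. t (trace_set B m k \<omega>)) = (\<Prod>k<K. t (trace_set B m k \<omega>))"
            using K0 that unit_weightD(1)[OF t] by (intro prod.mono_neutral_left) auto
          then show ?thesis by (simp only: prod_generated_alloc)
        qed
        then show "(\<lambda>K. ?P K \<omega>) \<longlonglongrightarrow> (\<Prod>A\<in>#generated_alloc B Y m \<omega>. t A)"
          by (intro tendsto_eventually eventually_mono[OF eventually_ge_at_top[of K0]])
      qed
      show "AE \<omega> in M. norm (?P K \<omega>) \<le> 1" for K
      proof (rule AE_I2)
        fix \<omega>
        have "0 \<le> (\<Prod>k<K. t (trace_set B m k \<omega>))" "(\<Prod>k<K. t (trace_set B m k \<omega>)) \<le> 1"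
          "0 \<le> (\<Prod>n\<in>{1..m}. t {n} ^ Y n \<omega>)" "(\<Prod>n\<in>{1..m}. t {n} ^ Y n \<omega>) \<le> 1"
          using tb by (auto intro!: prod_nonneg prod_le_1 power_le_one)
        then show "norm (?P K \<omega>) \<le> 1" by (simp add: abs_mult mult_le_one)
      qed
      show "?P K \<in> borel_measurable M" for K
        using measurable_compose[OF Ym, of _ "\<lambda>y. t {_} ^ y" borel]
        by (intro borel_measurable_times borel_measurable_prod tr) auto
    qed (auto intro!: measurable_mset_fun[OF meas])
  qed
  moreover have "(\<lambda>K. \<integral>\<omega>. ?Q K \<omega> \<partial>M) \<longlonglongrightarrow> (\<integral>\<omega>. ffm_pgf m t (\<lambda>k. V k \<omega>) (L \<omega>) \<partial>M)"
  proof (rule integral_dominated_convergence[where w = "\<lambda>_. 1"])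
    show "AE \<omega> in M. (\<lambda>K. ?Q K \<omega>) \<longlonglongrightarrow> ffm_pgf m t (\<lambda>k. V k \<omega>) (L \<omega>)"
      by (intro AE_I2 ffm_pgf_limit[OF t] v01)
    show "AE \<omega> in M. norm (?Q K \<omega>) \<le> 1" for K
    proof (rule AE_I2)
      fix \<omega> assume w: "\<omega> \<in> space M"
      have "0 \<le> (\<Prod>k<K. bernoulli_weight m t (V k \<omega>))" "(\<Prod>k<K. bernoulli_weight m t (V k \<omega>)) \<le> 1"
        using bernoulli_weight_prod_bounds[where v = "\<lambda>k. V k \<omega>", OF t v01[OF w]] by auto
      moreover have "exp (- (singleton_loss m t * L \<omega>)) \<le> 1"
        using singleton_loss_bounds(1)[OF t] random_paramsD(7)[OF rp w] by simp
      ultimately show "norm (?Q K \<omega>) \<le> 1" by (simp add: abs_mult mult_le_one)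
    qed
    show "(\<lambda>\<omega>. ffm_pgf m t (\<lambda>k. V k \<omega>) (L \<omega>)) \<in> borel_measurable M"
      unfolding ffm_pgf_def by measurable
  qed simp_all
  ultimately show ?thesis
    unfolding draws_pgf[OF rp cd t] by (rule LIMSEQ_unique)
qed

text \<open>The target is countable, so preimages of points suffice, and an allocation is determined
  by the multiplicities of finitely many possible features. Each multiplicity is a cardinality of a
  random set of labels plus at most one Poisson count.\<close>

lemma generated_alloc_measurable:
  assumes cd: "conditional_draws M V L B Y"
  shows "generated_alloc B Y N \<in> M \<rightarrow>\<^sub>M alloc_space N"
proof -
  have [measurable]: "B n k \<in> M \<rightarrow>\<^sub>M count_space UNIV" if "1 \<le> n" for n k
    using conditional_drawsD(1)[OF cd that] .
  have Ym: "Y n \<in> M \<rightarrow>\<^sub>M count_space UNIV" if "1 \<le> n" for n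
    using conditional_drawsD(2)[OF cd that] .
  have tr: "{\<omega>\<in>space M. trace_set B N k \<omega> = A} \<in> sets M" for k A
  proof (cases "A \<subseteq> {1..N}")
    case True
    have "trace_set B N k \<omega> = A \<longleftrightarrow> (\<forall>n\<in>{1..N}. B n k \<omega> = (n \<in> A))" for \<omega>
      using True by (fastforce simp: feature_set_def)
    then have "{\<omega>\<in>space M. trace_set B N k \<omega> = A} = {\<omega>\<in>space M. \<forall>n\<in>{1..N}. B n k \<omega> = (n \<in> A)}"
      by auto
    also have "\<dots> \<in> sets M"
    proof (rule sets.sets_Collect_finite_All)
      fix n assume "n \<in> {1..N}"
      then have [measurable]: "B n k \<in> M \<rightarrow>\<^sub>M count_space UNIV" by simp
      show "{\<omega> \<in> space M. B n k \<omega> = (n \<in> A)} \<in> sets M" by measurable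
    qed simp
    finally show ?thesis .
  next
    case False
    then have "{\<omega>\<in>space M. trace_set B N k \<omega> = A} = {}" by auto
    then show ?thesis by (simp only: sets.empty_sets)
  qed
  let ?S = "\<lambda>\<omega>. {k. trace_set B N k \<omega> \<noteq> {}}"
  have cnt: "count (generated_alloc B Y N \<omega>) A =
      (if finite (?S \<omega>) then card {k. trace_set B N k \<omega> = A} else 0) +
      (\<Sum>n\<in>{1..N}. if A = {n} then Y n \<omega> else 0)" if "A \<noteq> {}" for A \<omega>
  proof -
    have "count (image_mset (\<lambda>k. trace_set B N k \<omega>) (mset_set (?S \<omega>))) A =
        (if finite (?S \<omega>) then card {k. trace_set B N k \<omega> = A} else 0)"
    proof (cases "finite (?S \<omega>)")
      case True
      let ?T = "(\<lambda>k. trace_set B N k \<omega>) -` {A} \<inter> ?S \<omega>"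
      have "count (image_mset (\<lambda>k. trace_set B N k \<omega>) (mset_set (?S \<omega>))) A = (\<Sum>k\<in>?T. count (mset_set (?S \<omega>)) k)"
        by (simp only: count_image_mset finite_set_mset_mset_set[OF True])
      also have "\<dots> = (\<Sum>k\<in>?T. 1)"
        by (rule sum.cong[OF refl], rule count_mset_set(1)[OF True]) blast
      also have "\<dots> = card ?T" by simp
      also have "?T = {k. trace_set B N k \<omega> = A}" using that by blast
      finally show ?thesis using True by simp
    qed simp
    then show ?thesis
      by (simp add: generated_alloc_def count_sum)
  qed
  \<comment> \<open>On the complement \<open>mset_set\<close> takes its default value, so this event
    enters the formula for the multiplicities.\<close>
  have fin_meas: "{\<omega>\<in>space M. finite (?S \<omega>)} \<in> sets M"
  proof -
    have "Measurable.pred M (\<lambda>\<omega>. finite (?S \<omega>))"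
    proof (rule measurable_finite)
      fix k
      have "{\<omega>\<in>space M. k \<in> ?S \<omega>} = space M - {\<omega>\<in>space M. trace_set B N k \<omega> = {}}" by auto
      then show "{\<omega>\<in>space M. k \<in> ?S \<omega>} \<in> sets M" using tr[of k "{}"] by (simp only: sets.compl_sets)
    qed
    then show ?thesis by (simp add: pred_def)
  qed
  have cnt_meas: "(\<lambda>\<omega>. count (generated_alloc B Y N \<omega>) A) \<in> M \<rightarrow>\<^sub>M count_space UNIV" if "A \<noteq> {}" for A
  proof -
    have [measurable]: "(\<lambda>\<omega>. card {k. trace_set B N k \<omega> = A}) \<in> M \<rightarrow>\<^sub>M count_space UNIV"
      by (rule measurable_card) (simp only: mem_Collect_eq tr)
    have [measurable]: "Measurable.pred M (\<lambda>\<omega>. finite (?S \<omega>))"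
      using fin_meas by (simp add: pred_def)
    have sing: "(\<lambda>\<omega>. \<Sum>n\<in>{1..N}. if A = {n} then Y n \<omega> else 0) \<in> M \<rightarrow>\<^sub>M count_space UNIV"
    proof (cases "\<exists>n\<in>{1..N}. A = {n}")
      case True
      then obtain n where "n \<in> {1..N}" "A = {n}" by blast
      then show ?thesis using Ym[of n] by simp
    next
      case False
      then have "(\<lambda>\<omega>. \<Sum>n\<in>{1..N}. if A = {n} then Y n \<omega> else 0) = (\<lambda>\<omega>. 0)" by (intro ext sum.neutral) auto
      then show ?thesis by simp
    qed
    then show ?thesis unfolding cnt[OF that] by measurable
  qed
  show ?thesis
  proof (rule measurable_count_space_eq_countable[THEN iffD2, OF countable_feature_allocs], intro conjI ballI)
    show "generated_alloc B Y N \<in> space M \<rightarrow> feature_allocs N"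
      by (simp add: generated_alloc_in_feature_allocs)
    fix f assume f: "f \<in> feature_allocs N"
    let ?T = "Pow {1..N} - {{}}"
    have "generated_alloc B Y N \<omega> = f \<longleftrightarrow> (\<forall>A\<in>?T. count (generated_alloc B Y N \<omega>) A = count f A)" for \<omega>
    proof
      assume eq: "\<forall>A\<in>?T. count (generated_alloc B Y N \<omega>) A = count f A"
      show "generated_alloc B Y N \<omega> = f"
      proof (rule multiset_eqI)
        fix A
        show "count (generated_alloc B Y N \<omega>) A = count f A"
        proof (cases "A \<in> ?T")
          case False
          then have "A \<notin># f" "A \<notin># generated_alloc B Y N \<omega>"
            using f generated_alloc_in_feature_allocs[of B Y N \<omega>] by (auto simp: feature_allocs_def)
          then show ?thesis by (simp add: not_in_iff)
        qed (use eq in blast)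
      qed
    qed simp
    then have "generated_alloc B Y N -` {f} \<inter> space M =
        {\<omega>\<in>space M. \<forall>A\<in>?T. count (generated_alloc B Y N \<omega>) A = count f A}" by blast
    also have "\<dots> \<in> sets M"
    proof (rule sets.sets_Collect_finite_All)
      fix A assume "A \<in> ?T"
      then have [measurable]: "(\<lambda>\<omega>. count (generated_alloc B Y N \<omega>) A) \<in> M \<rightarrow>\<^sub>M count_space UNIV"
        by (intro cnt_meas) auto
      show "{\<omega> \<in> space M. count (generated_alloc B Y N \<omega>) A = count f A} \<in> sets M" by measurable
    qed simp
    finally show "generated_alloc B Y N -` {f} \<inter> space M \<in> sets M" .
  qed
qed

lemma restrict_alloc_union: "restrict_alloc m (f + g) = restrict_alloc m f + restrict_alloc m g"
  by (simp add: restrict_alloc_def)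

lemma restrict_alloc_sum: "finite S \<Longrightarrow> restrict_alloc m (\<Sum>n\<in>S. f n) = (\<Sum>n\<in>S. restrict_alloc m (f n))"
  by (induction S rule: finite_induct) (simp_all add: restrict_alloc_union, simp add: restrict_alloc_def)

text \<open>Finiteness at level \<open>N\<close> excludes the default value of
  \<open>mset_set\<close>, under which level \<open>N\<close> would forget features that level
  \<open>m\<close> may still record.\<close>

lemma restrict_generated_alloc:
  assumes fin: "finite {k. trace_set B N k \<omega> \<noteq> {}}" and m: "m \<le> N"
  shows "restrict_alloc m (generated_alloc B Y N \<omega>) = generated_alloc B Y m \<omega>"
proof -
  have tr: "trace_set B N k \<omega> \<inter> {1..m} = trace_set B m k \<omega>" for k using m by auto
  have "restrict_alloc m (image_mset (\<lambda>k. trace_set B N k \<omega>) (mset_set {k. trace_set B N k \<omega> \<noteq> {}})) =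
      image_mset (\<lambda>k. trace_set B m k \<omega>)
        (mset_set {k \<in> {k. trace_set B N k \<omega> \<noteq> {}}. trace_set B m k \<omega> \<noteq> {}})"
    using fin unfolding restrict_alloc_def image_mset.compositionality o_def tr filter_mset_image_mset by simp
  also have "{k \<in> {k. trace_set B N k \<omega> \<noteq> {}}. trace_set B m k \<omega> \<noteq> {}} = {k. trace_set B m k \<omega> \<noteq> {}}"
    using m by fastforce
  finally have 1: "restrict_alloc m (image_mset (\<lambda>k. trace_set B N k \<omega>) (mset_set {k. trace_set B N k \<omega> \<noteq> {}})) =
      image_mset (\<lambda>k. trace_set B m k \<omega>) (mset_set {k. trace_set B m k \<omega> \<noteq> {}})" .
  have "restrict_alloc m (\<Sum>n\<in>{1..N}. replicate_mset (Y n \<omega>) {n}) =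
      (\<Sum>n\<in>{1..N}. if n \<in> {1..m} then replicate_mset (Y n \<omega>) {n} else {#})"
  proof (subst restrict_alloc_sum, simp, intro sum.cong refl)
    fix n assume "n \<in> {1..N}"
    then have "restrict_alloc m (replicate_mset y {n}) = (if n \<in> {1..m} then replicate_mset y {n} else {#})" for y
      by (induction y) (auto simp: restrict_alloc_def)
    then show "restrict_alloc m (replicate_mset (Y n \<omega>) {n}) =
        (if n \<in> {1..m} then replicate_mset (Y n \<omega>) {n} else {#})" .
  qed
  also have "\<dots> = (\<Sum>n\<in>{1..m}. replicate_mset (Y n \<omega>) {n})"
    using m by (intro sum.mono_neutral_cong_right) auto
  finally have 2: "restrict_alloc m (\<Sum>n\<in>{1..N}. replicate_mset (Y n \<omega>) {n}) =
      (\<Sum>n\<in>{1..m}. replicate_mset (Y n \<omega>) {n})" .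
  show ?thesis unfolding generated_alloc_def restrict_alloc_union 1 2 ..
qed

lemma generated_alloc_random_feature_allocation:
  assumes rp: "random_params M V L" and cd: "conditional_draws M V L B Y"
  shows "random_feature_allocation M (generated_alloc B Y)"
  unfolding random_feature_allocation_def
proof (intro conjI allI impI)
  show "prob_space M" by (rule random_paramsD(1)[OF rp])
  show "generated_alloc B Y N \<in> M \<rightarrow>\<^sub>M alloc_space N" for N
    by (rule generated_alloc_measurable[OF cd])
  fix m N :: nat assume "m < N"
  then show "AE \<omega> in M. generated_alloc B Y m \<omega> = restrict_alloc m (generated_alloc B Y N \<omega>)"
    using finitely_many_traces[OF rp cd]
    by (auto elim!: eventually_mono simp: restrict_generated_alloc)
qed

text \<open>Averaging preserves the sum of the weights over the non-empty sets of each size. The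
  empty set lies outside these classes and is split off.\<close>

lemma sum_by_size_size_avg:
  assumes t: "t {} = (1::real)" and h: "t' = (\<lambda>A. if A = {} then 1 else size_avg m t A)"
  shows "(\<Sum>C\<in>Pow {1..m}. t' C * w (card C)) = (\<Sum>C\<in>Pow {1..m}. t C * w (card C))"
proof -
  let ?S = "Pow {1..m} - {{}} :: nat set set"
  have S: "finite ?S" by simp
  have group: "(\<Sum>C\<in>?S. u C * w (card C)) = (\<Sum>k\<in>card ` ?S. (\<Sum>C | C \<in> ?S \<and> card C = k. u C) * w k)"
    for u :: "nat set \<Rightarrow> real"
  proof -
    have "(\<Sum>C\<in>?S. u C * w (card C)) = (\<Sum>k\<in>card ` ?S. \<Sum>C | C \<in> ?S \<and> card C = k. u C * w (card C))"
      by (rule sum.group[symmetric]) auto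
    then show ?thesis by (simp add: sum_distrib_right)
  qed
  have "(\<Sum>C\<in>?S. t' C * w (card C)) = (\<Sum>C\<in>?S. size_avg m t C * w (card C))"
    by (intro sum.cong) (auto simp: h)
  also have "\<dots> = (\<Sum>C\<in>?S. t C * w (card C))"
    unfolding group by (intro sum.cong refl arg_cong2[where f = "(*)"] sum_class_avg[OF S])
  finally have *: "(\<Sum>C\<in>?S. t' C * w (card C)) = (\<Sum>C\<in>?S. t C * w (card C))" .
  have "(\<Sum>C\<in>Pow {1..m}. u C * w (card C)) = u {} * w 0 + (\<Sum>C\<in>?S. u C * w (card C))" for u :: "nat set \<Rightarrow> real"
    by (subst sum.remove[of _ "{}"]) auto
  with * t h show ?thesis by simp
qed

lemma generated_alloc_EFPF:
  assumes rp: "random_params M V L" and cd: "conditional_draws M V L B Y"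
  shows "has_EFPF M (generated_alloc B Y)"
proof (subst has_EFPF_iff_pgf[OF random_paramsD(1)[OF rp] generated_alloc_measurable[OF cd]], intro allI impI)
  fix N :: nat and t :: "nat set \<Rightarrow> real" assume N: "1 \<le> N" and t: "\<forall>A. 0 \<le> t A \<and> t A \<le> 1"
  \<comment> \<open>The given weight is arbitrary at the empty set; resetting it there does not
    affect products over non-empty features.\<close>
  let ?t = "\<lambda>A. if A = {} then 1 else t A"
  let ?s = "\<lambda>A. if A = {} then 1 else size_avg N ?t A"
  have ut: "unit_weight ?t" using t by (auto simp: unit_weight_def)
  have us: "unit_weight ?s"
    using class_avg_unit_interval[of "Pow {1..N} - {{}}" ?t card] t by (auto simp: unit_weight_def)
  have bw: "bernoulli_weight N ?s v = bernoulli_weight N ?t v" for v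
    unfolding bernoulli_weight_def
    using sum_by_size_size_avg[of ?t ?s N "\<lambda>c. v ^ c * (1 - v) ^ (N - c)"] by simp
  have sl: "singleton_loss N ?s = singleton_loss N ?t"
  proof -
    \<comment> \<open>A sum over indices becomes a sum over all subsets with a coefficient that
      depends on the size alone, the form required by \<open>sum_by_size_size_avg\<close>.\<close>
    have one: "(\<Sum>C\<in>Pow {1..N}. u C * (if card C = 1 then 1 else 0)) = (\<Sum>n\<in>{1..N}. u {n})"
      for u :: "nat set \<Rightarrow> real"
    proof -
      have "(\<Sum>C\<in>Pow {1..N}. u C * (if card C = 1 then 1 else 0)) = (\<Sum>C\<in>(\<lambda>n. {n}) ` {1..N}. u C)"
        by (intro sum.mono_neutral_cong_right) (auto simp: card_1_singleton_iff)
      then show ?thesis by (simp add: sum.reindex)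
    qed
    show ?thesis
      using sum_by_size_size_avg[of ?t ?s N "\<lambda>c. if c = 1 then 1 else 0"]
      unfolding one singleton_loss_def by (simp add: sum_subtractf)
  qed
  have nonempty: "A \<noteq> {}" if "A \<in># generated_alloc B Y N \<omega>" for A \<omega>
    using generated_alloc_in_feature_allocs[of B Y N \<omega>] that by (auto simp: feature_allocs_def)
  have congr: "(\<Prod>A\<in>#generated_alloc B Y N \<omega>. u A) = (\<Prod>A\<in>#generated_alloc B Y N \<omega>. u' A)"
    if "\<And>A. A \<noteq> {} \<Longrightarrow> u A = u' A" for u u' :: "nat set \<Rightarrow> real" and \<omega>
    using that nonempty by (intro arg_cong[where f = prod_mset] image_mset_cong) auto
  have avg: "size_avg N t A = ?s A" if "A \<noteq> {}" for A
    using that by (auto simp: class_avg_def intro!: arg_cong2[where f = "(/)"] sum.cong)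
  note pgf = generated_alloc_pgf[OF rp cd _ generated_alloc_measurable[OF cd]]
  have "(\<integral>\<omega>. (\<Prod>A\<in>#generated_alloc B Y N \<omega>. t A) \<partial>M) = (\<integral>\<omega>. (\<Prod>A\<in>#generated_alloc B Y N \<omega>. ?t A) \<partial>M)"
    by (intro Bochner_Integration.integral_cong refl congr) simp
  also have "\<dots> = (\<integral>\<omega>. (\<Prod>A\<in>#generated_alloc B Y N \<omega>. ?s A) \<partial>M)"
    unfolding pgf[OF ut] pgf[OF us] ffm_pgf_def bw sl ..
  also have "\<dots> = (\<integral>\<omega>. (\<Prod>A\<in>#generated_alloc B Y N \<omega>. size_avg N t A) \<partial>M)"
    by (intro Bochner_Integration.integral_cong refl congr) (rule avg[symmetric])
  finally show "(\<integral>\<omega>. (\<Prod>A\<in>#generated_alloc B Y N \<omega>. t A) \<partial>M) =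
      (\<integral>\<omega>. (\<Prod>A\<in>#generated_alloc B Y N \<omega>. size_avg N t A) \<partial>M)" .
qed

section \<open>Existence of the model\<close>

text \<open>The interval is half-open so that a seed stays strictly below 1, the supremum of the
  Poisson distribution function, and every quantile exists.\<close>

abbreviation unit_interval_measure :: "real measure" where
  "unit_interval_measure \<equiv> uniform_measure lborel {0..<1}"

lemma prob_space_unit_interval: "prob_space unit_interval_measure"
  by (rule prob_space_uniform_measure) auto

lemma measure_unit_interval_atLeastLessThan:
  assumes "0 \<le> c" "c \<le> d" "d \<le> 1" and S: "S \<in> sets borel" "{0..<1} \<inter> S = {c..<d}"
  shows "measure unit_interval_measure S = d - c"
  using assms by (subst measure_uniform_measure) auto

lemma unit_interval_bernoulli:
  assumes p: "0 \<le> p" "p \<le> 1"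
  shows "measure unit_interval_measure {x. (x < p) = b} = pmf (bernoulli_pmf p) b"
proof (cases b)
  case True
  have "measure unit_interval_measure {x. x < p} = p - 0"
    by (rule measure_unit_interval_atLeastLessThan) (use p in auto)
  then show ?thesis using True p by simp
next
  case False
  have "measure unit_interval_measure {x. \<not> x < p} = 1 - p"
    by (rule measure_unit_interval_atLeastLessThan) (use p in auto)
  then show ?thesis using False p by simp
qed

text \<open>The mass strictly below \<open>y\<close>, written out explicitly so that it is visibly
  measurable in the rate.\<close>

definition poisson_cdf :: "real \<Rightarrow> nat \<Rightarrow> real" where
  "poisson_cdf l y = (\<Sum>i<y. l ^ i / fact i * exp (- l))"

text \<open>Inverse distribution function; \<open>Suc y\<close> occurs because
  \<open>poisson_cdf\<close> counts values strictly below its argument.\<close>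

definition poisson_quantile :: "real \<Rightarrow> real \<Rightarrow> nat" where
  "poisson_quantile l x = (LEAST y. x < poisson_cdf l (Suc y))"

text \<open>Among seeds in [0,1), those with quantile \<open>y\<close> form the interval from
  \<open>poisson_cdf l y\<close> to \<open>poisson_cdf l (Suc y)\<close>, whose length is the mass
  at \<open>y\<close>.\<close>

lemma unit_interval_poisson:
  assumes l: "0 \<le> l"
  shows "measure unit_interval_measure {x. poisson_quantile l x = y} = pmf (poisson_law l) y"
    "{x. poisson_quantile l x = y} \<in> sets borel"
proof -
  have cdf: "poisson_cdf l y = (\<Sum>i<y. pmf (poisson_law l) i)" for y
    using l by (simp add: poisson_cdf_def pmf_poisson_law)
  have mono: "poisson_cdf l i \<le> poisson_cdf l j" if "i \<le> j" for i j
    unfolding cdf using that by (intro sum_mono2) auto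
  have le1: "poisson_cdf l y \<le> 1" for y
    unfolding cdf using measure_pmf.prob_le_1[of "poisson_law l" "{..<y}"] by (simp add: measure_measure_pmf_finite)
  have "(\<lambda>i. pmf (poisson_law l) i) sums 1"
    using poisson_law_sums[OF l, of 1] by simp
  then have lim: "(\<lambda>y. poisson_cdf l y) \<longlonglongrightarrow> 1" by (simp add: sums_def cdf)
  have ex: "\<exists>y. x < poisson_cdf l (Suc y)" if "x < 1" for x
  proof -
    have "eventually (\<lambda>y. x < poisson_cdf l y) sequentially" using lim that by (rule order_tendstoD(1))
    then obtain y where "x < poisson_cdf l y" by (auto simp: eventually_sequentially)
    also have "\<dots> \<le> poisson_cdf l (Suc y)" by (rule mono) simp
    finally show ?thesis by blast
  qed
  have quant: "poisson_quantile l x = y \<longleftrightarrow> poisson_cdf l y \<le> x \<and> x < poisson_cdf l (Suc y)"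
    if x: "0 \<le> x" "x < 1" for x
  proof
    assume y: "poisson_quantile l x = y"
    have "x < poisson_cdf l (Suc y)"
      unfolding y[symmetric] poisson_quantile_def using ex[OF x(2)] by (rule LeastI_ex)
    moreover have "poisson_cdf l y \<le> x"
    proof (cases y)
      case 0
      then show ?thesis using x by (simp add: poisson_cdf_def)
    next
      case (Suc z)
      then have "z < poisson_quantile l x" using y by simp
      then have "\<not> x < poisson_cdf l (Suc z)" unfolding poisson_quantile_def by (rule not_less_Least)
      then show ?thesis using Suc by simp
    qed
    ultimately show "poisson_cdf l y \<le> x \<and> x < poisson_cdf l (Suc y)" by simp
  next
    assume y: "poisson_cdf l y \<le> x \<and> x < poisson_cdf l (Suc y)"
    show "poisson_quantile l x = y"
      unfolding poisson_quantile_def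
    proof (rule Least_equality)
      fix z assume z: "x < poisson_cdf l (Suc z)"
      show "y \<le> z"
      proof (rule ccontr)
        assume "\<not> y \<le> z"
        then have "poisson_cdf l (Suc z) \<le> poisson_cdf l y" by (intro mono) simp
        with y z show False by simp
      qed
    qed (use y in blast)
  qed
  have cdf0: "0 \<le> poisson_cdf l y"
    using mono[of 0 y] by (simp add: poisson_cdf_def[of l 0])
  have eq: "{0..<1} \<inter> {x. poisson_quantile l x = y} = {poisson_cdf l y..<poisson_cdf l (Suc y)}"
  proof (rule set_eqI)
    fix x
    show "x \<in> {0..<1} \<inter> {x. poisson_quantile l x = y} \<longleftrightarrow> x \<in> {poisson_cdf l y..<poisson_cdf l (Suc y)}"
      using quant[of x] le1[of "Suc y"] cdf0 by (cases "0 \<le> x \<and> x < 1") auto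
  qed
  have "(\<lambda>x. poisson_quantile l x) \<in> borel \<rightarrow>\<^sub>M count_space UNIV"
    unfolding poisson_quantile_def by measurable
  from measurable_sets[OF this, of "{y}"]
  show S: "{x. poisson_quantile l x = y} \<in> sets borel" by (simp add: vimage_def)
  have "measure unit_interval_measure {x. poisson_quantile l x = y} = poisson_cdf l (Suc y) - poisson_cdf l y"
    by (rule measure_unit_interval_atLeastLessThan[OF cdf0 mono le1 S eq]) simp
  then show "measure unit_interval_measure {x. poisson_quantile l x = y} = pmf (poisson_law l) y"
    by (simp add: cdf)
qed

abbreviation uniform_seeds :: "(nat \<times> nat + nat \<Rightarrow> real) measure" where
  "uniform_seeds \<equiv> PiM UNIV (\<lambda>_. unit_interval_measure)"

lemma uniform_seeds_draws:
  assumes v: "\<And>k. 0 \<le> v k \<and> v k \<le> 1" and l: "0 \<le> l" and I: "finite I" and J: "finite J"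
  shows "measure uniform_seeds {x \<in> space uniform_seeds. (\<forall>(n, k)\<in>I. (x (Inl (n, k)) < v k) = b n k) \<and>
      (\<forall>n\<in>J. poisson_quantile l (x (Inr n)) = y n)} =
    (\<Prod>(n, k)\<in>I. pmf (bernoulli_pmf (v k)) (b n k)) * (\<Prod>n\<in>J. pmf (poisson_law l) (y n))"
proof -
  interpret product_prob_space "\<lambda>_ :: nat \<times> nat + nat. unit_interval_measure" UNIV
    by (intro product_prob_spaceI prob_space_unit_interval)
  let ?X = "case_sum (\<lambda>(n, k). {x. (x < v k) = b n k}) (\<lambda>n. {x. poisson_quantile l x = y n})"
  let ?K = "Inl ` I \<union> Inr ` J"
  have X: "?X i \<in> sets unit_interval_measure" for i
    using unit_interval_poisson(2)[OF l] by (auto split: sum.split)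
  have "{x \<in> space uniform_seeds. (\<forall>(n, k)\<in>I. (x (Inl (n, k)) < v k) = b n k) \<and>
      (\<forall>n\<in>J. poisson_quantile l (x (Inr n)) = y n)} = {x \<in> space uniform_seeds. \<forall>i\<in>?K. x i \<in> ?X i}"
    by (auto simp: ball_Un)
  then have "measure uniform_seeds {x \<in> space uniform_seeds. (\<forall>(n, k)\<in>I. (x (Inl (n, k)) < v k) = b n k) \<and>
      (\<forall>n\<in>J. poisson_quantile l (x (Inr n)) = y n)} = (\<Prod>i\<in>?K. measure unit_interval_measure (?X i))"
    using emeasure_PiM_Collect[of ?K ?X] I J X
    by (simp add: emeasure_eq_measure M.emeasure_eq_measure prod_ennreal measure_nonneg prod_nonneg)
  also have "\<dots> = (\<Prod>i\<in>Inl ` I. measure unit_interval_measure (?X i)) * (\<Prod>i\<in>Inr ` J. measure unit_interval_measure (?X i))"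
    using I J by (intro prod.union_disjoint) auto
  also have "(\<Prod>i\<in>Inl ` I. measure unit_interval_measure (?X i)) = (\<Prod>(n, k)\<in>I. pmf (bernoulli_pmf (v k)) (b n k))"
    using v by (subst prod.reindex) (auto simp: unit_interval_bernoulli simp del: measure_uniform_measure intro!: prod.cong)
  also have "(\<Prod>i\<in>Inr ` J. measure unit_interval_measure (?X i)) = (\<Prod>n\<in>J. pmf (poisson_law l) (y n))"
    using unit_interval_poisson(1)[OF l] by (subst prod.reindex) (auto simp del: measure_uniform_measure)
  finally show ?thesis .
qed

text \<open>Independent uniform seeds are adjoined to \<open>M\<close>, and draws are read off by
  thresholds and quantiles. The result is pushed forward to the space of all values of parameters
  and draws, so its type does not depend on that of \<open>M\<close>.\<close>

lemma exists_conditional_draws: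
  fixes M :: "'a measure"
  assumes rp: "random_params M V L"
  obtains M' :: "((nat \<Rightarrow> real) \<times> real \<times> (nat \<Rightarrow> nat \<Rightarrow> bool) \<times> (nat \<Rightarrow> nat)) measure" and V' L' B Y
  where "random_params M' V' L'" "distr M' param_space (params V' L') = distr M param_space (params V L)"
    "conditional_draws M' V' L' B Y"
proof -
  interpret M: prob_space M by (rule random_paramsD(1)[OF rp])
  interpret U: product_prob_space "\<lambda>_ :: nat \<times> nat + nat. unit_interval_measure" UNIV
    by (intro product_prob_spaceI prob_space_unit_interval)
  let ?U = "uniform_seeds" and ?W = "M \<Otimes>\<^sub>M uniform_seeds"
  interpret W: pair_prob_space M ?U ..
  note v = random_paramsD(5,6)[OF rp] and l = random_paramsD(7)[OF rp]
  have [measurable]: "V k \<in> borel_measurable M" "L \<in> borel_measurable M" for k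
    using random_paramsD(2,3)[OF rp] .
  let ?\<Sigma> = "PiM UNIV (\<lambda>_. borel) \<Otimes>\<^sub>M (borel \<Otimes>\<^sub>M (PiM UNIV (\<lambda>_. PiM UNIV (\<lambda>_. count_space UNIV)) \<Otimes>\<^sub>M
    PiM UNIV (\<lambda>_. count_space UNIV))) ::
    ((nat \<Rightarrow> real) \<times> real \<times> (nat \<Rightarrow> nat \<Rightarrow> bool) \<times> (nat \<Rightarrow> nat)) measure"
  define T where "T = (\<lambda>(\<omega>, x). (\<lambda>k. V k \<omega>, L \<omega>, \<lambda>n k. x (Inl (n, k) :: nat \<times> nat + nat) < V k \<omega>,
    \<lambda>n. poisson_quantile (L \<omega>) (x (Inr n))))"
  \<comment> \<open>Coordinates of the new space are arbitrary reals, and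
    \<open>random_params\<close> asks for the bounds everywhere; on the image of \<open>T\<close>
    the clamps do nothing.\<close>
  define V' :: "nat \<Rightarrow> (nat \<Rightarrow> real) \<times> real \<times> (nat \<Rightarrow> nat \<Rightarrow> bool) \<times> (nat \<Rightarrow> nat) \<Rightarrow> real"
    where "V' k \<omega> = max 0 (min 1 (fst \<omega> k))" for k \<omega>
  define L' :: "(nat \<Rightarrow> real) \<times> real \<times> (nat \<Rightarrow> nat \<Rightarrow> bool) \<times> (nat \<Rightarrow> nat) \<Rightarrow> real"
    where "L' \<omega> = max 0 (fst (snd \<omega>))" for \<omega>
  define B :: "nat \<Rightarrow> nat \<Rightarrow> (nat \<Rightarrow> real) \<times> real \<times> (nat \<Rightarrow> nat \<Rightarrow> bool) \<times> (nat \<Rightarrow> nat) \<Rightarrow> bool"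
    where "B n k \<omega> = fst (snd (snd \<omega>)) n k" for n k \<omega>
  define Y :: "nat \<Rightarrow> (nat \<Rightarrow> real) \<times> real \<times> (nat \<Rightarrow> nat \<Rightarrow> bool) \<times> (nat \<Rightarrow> nat) \<Rightarrow> nat"
    where "Y n \<omega> = snd (snd (snd \<omega>)) n" for n \<omega>
  have seed: "(\<lambda>p. snd p i) \<in> borel_measurable ?W" for i
  proof -
    have "(\<lambda>x. x i) \<in> ?U \<rightarrow>\<^sub>M unit_interval_measure" by (rule measurable_component_singleton) simp
    then have "(\<lambda>x. x i) \<in> borel_measurable ?U" by (simp cong: measurable_cong_sets)
    then show ?thesis by (rule measurable_compose[OF measurable_snd])
  qed
  have Vm: "(\<lambda>p. V k (fst p)) \<in> borel_measurable ?W" and Lm: "(\<lambda>p. L (fst p)) \<in> borel_measurable ?W" for k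
    by measurable
  have T: "T \<in> ?W \<rightarrow>\<^sub>M ?\<Sigma>"
    unfolding T_def case_prod_beta
  proof (intro measurable_Pair measurable_PiM_single')
    show "(\<lambda>p. snd p (Inl (n, k)) < V k (fst p)) \<in> ?W \<rightarrow>\<^sub>M count_space UNIV" for n k
      using borel_measurable_less[OF seed Vm] by (simp add: pred_def)
    show "(\<lambda>p. poisson_quantile (L (fst p)) (snd p (Inr n))) \<in> ?W \<rightarrow>\<^sub>M count_space UNIV" for n
      unfolding poisson_quantile_def poisson_cdf_def
    proof (rule measurable_Least)
      fix i
      have "(\<lambda>p. \<Sum>i<Suc i. L (fst p) ^ i / fact i * exp (- L (fst p))) \<in> borel_measurable ?W"
        using Lm by measurable
      then show "Measurable.pred ?W (\<lambda>p. snd p (Inr n) < (\<Sum>i<Suc i. L (fst p) ^ i / fact i * exp (- L (fst p))))"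
        unfolding pred_def by (rule borel_measurable_less[OF seed])
    qed
  qed (use Vm Lm in \<open>auto simp: space_PiM\<close>)
  define M' where "M' = distr ?W ?\<Sigma> T"
  have spM': "space M' = UNIV" by (simp add: M'_def space_pair_measure space_PiM)
  interpret M': prob_space M' unfolding M'_def by (rule W.prob_space_distr[OF T])
  have comp: "(\<lambda>\<omega>. fst \<omega> k) \<in> borel_measurable ?\<Sigma>" for k
    by (rule measurable_compose[OF measurable_fst measurable_component_singleton]) simp
  have V'm [measurable]: "V' k \<in> borel_measurable ?\<Sigma>" for k
    unfolding V'_def using comp by measurable
  have L'm [measurable]: "L' \<in> borel_measurable ?\<Sigma>"
    unfolding L'_def by measurable
  have Bm [measurable]: "B n k \<in> ?\<Sigma> \<rightarrow>\<^sub>M count_space UNIV" for n k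
  proof -
    have "(\<lambda>\<omega>. fst (snd (snd \<omega>))) \<in> ?\<Sigma> \<rightarrow>\<^sub>M PiM UNIV (\<lambda>_. PiM UNIV (\<lambda>_. count_space UNIV))" by measurable
    then have "(\<lambda>\<omega>. fst (snd (snd \<omega>)) n) \<in> ?\<Sigma> \<rightarrow>\<^sub>M PiM UNIV (\<lambda>_. count_space UNIV)"
      by (rule measurable_compose[OF _ measurable_component_singleton]) simp
    then show ?thesis unfolding B_def
      by (rule measurable_compose[OF _ measurable_component_singleton]) simp
  qed
  have Ym [measurable]: "Y n \<in> ?\<Sigma> \<rightarrow>\<^sub>M count_space UNIV" for n
  proof -
    have "(\<lambda>\<omega>. snd (snd (snd \<omega>))) \<in> ?\<Sigma> \<rightarrow>\<^sub>M PiM UNIV (\<lambda>_. count_space UNIV)" by measurable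
    then show ?thesis unfolding Y_def
      by (rule measurable_compose[OF _ measurable_component_singleton]) simp
  qed
  have M'm: "f \<in> M' \<rightarrow>\<^sub>M N \<longleftrightarrow> f \<in> ?\<Sigma> \<rightarrow>\<^sub>M N" for f and N :: "'c measure"
    unfolding M'_def by simp
  have pm: "params V' L' \<in> ?\<Sigma> \<rightarrow>\<^sub>M param_space"
    using V'm L'm by (intro measurable_Pair measurable_PiM_single') auto
  have VT: "V' k (T (\<omega>, x)) = V k \<omega>" and LT: "L' (T (\<omega>, x)) = L \<omega>" if "\<omega> \<in> space M" for k \<omega> x
    using v[OF that] l[OF that] by (simp_all add: V'_def L'_def T_def)
  have law: "distr M' param_space (params V' L') = distr M param_space (params V L)"
  proof -
    have "distr M' param_space (params V' L') = distr ?W param_space (params V' L' \<circ> T)"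
      unfolding M'_def by (rule distr_distr[OF pm T])
    also have "\<dots> = distr ?W param_space (params V L \<circ> fst)"
      by (rule distr_cong) (auto simp: space_pair_measure VT LT)
    also have "\<dots> = distr (distr ?W M fst) param_space (params V L)"
      by (rule distr_distr[symmetric]) (use params_measurable[OF rp] in auto)
    also have "distr ?W M fst = M" by (rule U.distr_pair_fst)
    finally show ?thesis .
  qed
  have rp': "random_params M' V' L'"
    unfolding random_params_def
  proof (intro conjI allI ballI)
    \<comment> \<open>For nonnegative terms, summability means that the partial sums have a common
      integer bound. In this form it is a measurable event about the parameters and passes between
      spaces with the same parameter law.\<close>
    let ?P = "\<lambda>p :: (nat \<Rightarrow> real) \<times> real. \<exists>c :: nat. \<forall>n. (\<Sum>k<n. fst p k) \<le> c"
    have "{p \<in> space param_space. ?P p} \<in> sets param_space"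
    proof -
      have [measurable]: "(\<lambda>p. fst p k) \<in> borel_measurable param_space" for k
        by (rule measurable_compose[OF measurable_fst measurable_component_singleton]) simp
      show ?thesis by measurable
    qed
    note iff = AE_distr_iff[OF _ this]
    have summ: "summable (\<lambda>k. a k) \<longleftrightarrow> ?P (a, r)" if "\<And>k. 0 \<le> a k" for a :: "nat \<Rightarrow> real" and r
    proof
      assume s: "summable a"
      have "(\<Sum>k<n. a k) \<le> real (nat \<lceil>suminf a\<rceil>)" for n
        using sum_le_suminf[OF s, of "{..<n}"] that real_nat_ceiling_ge[of "suminf a"] by fastforce
      then show "?P (a, r)" by auto
    next
      assume "?P (a, r)"
      then show "summable a" using that by (auto intro: summableI_nonneg_bounded)
    qed
    have "AE \<omega> in M. ?P (params V L \<omega>)"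
      using random_paramsD(4)[OF rp] AE_space
    proof eventually_elim
      case (elim \<omega>)
      then show ?case using summ[of "\<lambda>k. V k \<omega>" "L \<omega>"] v(1) by simp
    qed
    then have "AE p in distr M' param_space (params V' L'). ?P p"
      unfolding law by (subst iff[OF params_measurable[OF rp]])
    then have "AE \<omega> in M'. ?P (params V' L' \<omega>)"
      using iff[of "params V' L'" M'] pm by (simp add: M'm)
    then show "AE \<omega> in M'. summable (\<lambda>k. V' k \<omega>)"
    proof (rule eventually_mono)
      fix \<omega> assume "?P (params V' L' \<omega>)"
      then show "summable (\<lambda>k. V' k \<omega>)" using summ[of "\<lambda>k. V' k \<omega>" "L' \<omega>"] by (simp add: V'_def)
    qed
  qed (use V'm L'm in \<open>auto simp: M'm V'_def L'_def intro: M'.prob_space_axioms\<close>)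
  interpret G: finite_measure_subalgebra M' "vimage_algebra (space M') (params V' L') param_space"
    by (rule params_subalgebra[OF rp'])
  have cd: "conditional_draws M' V' L' B Y"
    unfolding conditional_draws_def
  proof (intro conjI allI impI)
    show "B n k \<in> M' \<rightarrow>\<^sub>M count_space UNIV" for n k using Bm by (simp add: M'm)
    show "Y n \<in> M' \<rightarrow>\<^sub>M count_space UNIV" for n using Ym by (simp add: M'm)
    fix I :: "(nat \<times> nat) set" and J :: "nat set" and b :: "nat \<Rightarrow> nat \<Rightarrow> bool" and y :: "nat \<Rightarrow> nat"
    assume IJ: "finite I \<and> I \<subseteq> {1..} \<times> UNIV \<and> finite J \<and> J \<subseteq> {1..}"
    then have I: "finite I" and J: "finite J" by auto
    let ?G = "vimage_algebra (space M') (params V' L') param_space"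
    let ?E = "{\<omega>' \<in> space M'. (\<forall>(n, k)\<in>I. B n k \<omega>' = b n k) \<and> (\<forall>n\<in>J. Y n \<omega>' = y n)}"
    \<comment> \<open>An explicit formula, measurable on the whole parameter space, that equals the
      product of mass functions for admissible parameters.\<close>
    define q where "q = (\<lambda>p :: (nat \<Rightarrow> real) \<times> real. (\<Prod>(n, k)\<in>I. if b n k then fst p k else 1 - fst p k) *
        (\<Prod>n\<in>J. snd p ^ y n / fact (y n) * exp (- snd p)))"
    have q_eq: "q (a, r) = (\<Prod>(n, k)\<in>I. pmf (bernoulli_pmf (a k)) (b n k)) * (\<Prod>n\<in>J. pmf (poisson_law r) (y n))"
      if "\<And>k. 0 \<le> a k \<and> a k \<le> 1" "0 \<le> r" for a r
      unfolding q_def using that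
      by (intro arg_cong2[where f = "(*)"] prod.cong refl) (auto simp: pmf_poisson_law)
    have qm: "q \<in> borel_measurable param_space"
    proof -
      have [measurable]: "(\<lambda>p. fst p k) \<in> borel_measurable param_space" for k
        by (rule measurable_compose[OF measurable_fst measurable_component_singleton]) simp
      show ?thesis unfolding q_def case_prod_beta by measurable
    qed
    have q01: "0 \<le> q (a, r)" "q (a, r) \<le> 1" if "\<And>k. 0 \<le> a k \<and> a k \<le> 1" "0 \<le> r" for a r
      unfolding q_eq[OF that]
      by (auto intro!: mult_nonneg_nonneg prod_nonneg mult_le_one prod_le_1 simp: pmf_le_1)
    have E: "?E \<in> sets M'"
    proof -
      have "{\<omega>' \<in> space ?\<Sigma>. (\<forall>p\<in>I. B (fst p) (snd p) \<omega>' = b (fst p) (snd p)) \<and> (\<forall>n\<in>J. Y n \<omega>' = y n)} \<in> sets ?\<Sigma>"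
        by (intro sets.sets_Collect_conj sets.sets_Collect_finite_All I J) measurable
      then show ?thesis by (simp add: M'_def case_prod_beta)
    qed
    have ae: "AE \<omega> in M'. real_cond_exp M' ?G (indicator ?E) \<omega> = q (params V' L' \<omega>)"
    proof (rule G.real_cond_exp_charact)
      show "integrable M' (indicator ?E :: _ \<Rightarrow> real)"
        using E by (intro integrable_real_indicator) (auto simp: less_top[symmetric])
      show "(\<lambda>\<omega>. q (params V' L' \<omega>)) \<in> borel_measurable ?G"
        by (rule measurable_compose[OF measurable_vimage_algebra1 qm]) (simp add: space_pair_measure space_PiM)
      show qint: "integrable M' (\<lambda>\<omega>. q (params V' L' \<omega>))"
      proof (rule M'.integrable_const_bound[where B = 1])
        show "AE \<omega> in M'. norm (q (params V' L' \<omega>)) \<le> 1"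
        proof (rule AE_I2)
          fix \<omega>
          have "0 \<le> q (params V' L' \<omega>)" "q (params V' L' \<omega>) \<le> 1"
            by (auto intro!: q01 simp: V'_def L'_def)
          then show "norm (q (params V' L' \<omega>)) \<le> 1" by simp
        qed
        show "(\<lambda>\<omega>. q (params V' L' \<omega>)) \<in> borel_measurable M'"
          unfolding M'm by (rule measurable_compose[OF pm qm])
      qed
      fix A assume "A \<in> sets ?G"
      then obtain C where C: "C \<in> sets param_space" "A = params V' L' -` C \<inter> space M'"
        by (auto simp: sets_vimage_algebra2 space_pair_measure space_PiM)
      let ?c = "\<lambda>\<omega>. indicator C (params V L \<omega>) :: real"
      have cm [measurable]: "?c \<in> borel_measurable M"
        by (rule measurable_compose[OF params_measurable[OF rp]]) (use C(1) in simp)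
      have c'm: "(\<lambda>\<omega>. indicator C (params V' L' \<omega>) :: real) \<in> borel_measurable ?\<Sigma>"
        by (rule measurable_compose[OF pm]) (use C(1) in simp)
      have indA: "indicator A \<omega> = (indicator C (params V' L' \<omega>) :: real)" for \<omega>
        by (simp add: C(2) spM' indicator_def)
      have "(\<integral>\<omega>\<in>A. indicator ?E \<omega> \<partial>M') = (\<integral>\<omega>. indicator C (params V' L' \<omega>) * (indicator ?E \<omega> :: real) \<partial>M')"
        unfolding set_lebesgue_integral_def indA by simp
      also have "\<dots> = (\<integral>p. indicator C (params V' L' (T p)) * (indicator ?E (T p) :: real) \<partial>?W)"
        unfolding M'_def using E
        by (intro integral_distr[OF T] borel_measurable_times c'm) (simp add: M'_def)
      \<comment> \<open>By Fubini the seeds are integrated first with the parameters held fixed; the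
        inner integral is then the product mass from \<open>uniform_seeds_draws\<close>.\<close>
      also have "\<dots> = (\<integral>\<omega>. (\<integral>x. indicator C (params V' L' (T (\<omega>, x))) * (indicator ?E (T (\<omega>, x)) :: real) \<partial>?U) \<partial>M)"
      proof (rule W.integral_fst'[symmetric])
        have "(\<lambda>p. indicator C (params V' L' (T p)) * indicator ?E (T p) :: real) \<in> borel_measurable ?W"
          using E by (intro measurable_compose[OF T, of "\<lambda>\<omega>. indicator C (params V' L' \<omega>) * indicator ?E \<omega>"]
            borel_measurable_times c'm) (simp add: M'_def)
        then show "integrable ?W (\<lambda>p. indicator C (params V' L' (T p)) * indicator ?E (T p) :: real)"
          by (intro W.integrable_const_bound[where B = 1]) (auto simp: indicator_def)
      qed
      also have "\<dots> = (\<integral>\<omega>. ?c \<omega> * q (params V L \<omega>) \<partial>M)"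
      proof (rule Bochner_Integration.integral_cong[OF refl])
        fix \<omega> assume w: "\<omega> \<in> space M"
        let ?D = "{x \<in> space ?U. (\<forall>(n, k)\<in>I. (x (Inl (n, k)) < V k \<omega>) = b n k) \<and>
          (\<forall>n\<in>J. poisson_quantile (L \<omega>) (x (Inr n)) = y n)}"
        have "(\<integral>x. indicator C (params V' L' (T (\<omega>, x))) * (indicator ?E (T (\<omega>, x)) :: real) \<partial>?U) =
            (\<integral>x. ?c \<omega> * indicator ?D x \<partial>?U)"
        proof (rule Bochner_Integration.integral_cong[OF refl])
          fix x
          have "indicator C (params V' L' (T (\<omega>, x))) = ?c \<omega>"
            by (simp only: VT[OF w] LT[OF w])
          moreover have "indicator ?E (T (\<omega>, x)) = (indicator ?D x :: real)"
            by (simp add: indicator_def spM' B_def Y_def T_def space_PiM)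
          ultimately show "indicator C (params V' L' (T (\<omega>, x))) * (indicator ?E (T (\<omega>, x)) :: real) =
              ?c \<omega> * indicator ?D x"
            by (rule arg_cong2[where f = "(*)"])
        qed
        also have "\<dots> = ?c \<omega> * measure ?U (?D \<inter> space ?U)"
          by (simp only: integral_mult_right_zero Bochner_Integration.integral_indicator)
        also have "?D \<inter> space ?U = ?D" by blast
        also have "measure ?U ?D = q (params V L \<omega>)"
          using v[OF w] l[OF w] by (subst uniform_seeds_draws) (auto simp: I J q_eq)
        finally show "(\<integral>x. indicator C (params V' L' (T (\<omega>, x))) * (indicator ?E (T (\<omega>, x)) :: real) \<partial>?U) =
            ?c \<omega> * q (params V L \<omega>)" .
      qed
      also have "\<dots> = (\<integral>p. (indicator C p * q p) \<partial>distr M param_space (params V L))"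
        using C(1) qm by (subst integral_distr[OF params_measurable[OF rp]]) auto
      also have "\<dots> = (\<integral>p. (indicator C p * q p) \<partial>distr M' param_space (params V' L'))"
        by (simp only: law)
      also have "\<dots> = (\<integral>\<omega>. indicator C (params V' L' \<omega>) * q (params V' L' \<omega>) \<partial>M')"
        using C(1) qm pm by (subst integral_distr) (auto simp: M'm)
      also have "\<dots> = (\<integral>\<omega>\<in>A. q (params V' L' \<omega>) \<partial>M')"
        unfolding set_lebesgue_integral_def indA by simp
      finally show "(\<integral>\<omega>\<in>A. indicator ?E \<omega> \<partial>M') = (\<integral>\<omega>\<in>A. q (params V' L' \<omega>) \<partial>M')" .
    qed
    have "q (params V' L' \<omega>) = (\<Prod>(n, k)\<in>I. pmf (bernoulli_pmf (V' k \<omega>)) (b n k)) *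
        (\<Prod>n\<in>J. pmf (poisson_law (L' \<omega>)) (y n))" for \<omega>
      by (rule q_eq) (auto simp: V'_def L'_def)
    with ae show "AE \<omega> in M'. real_cond_exp M' ?G (indicator ?E) \<omega> =
        (\<Prod>(n, k)\<in>I. pmf (bernoulli_pmf (V' k \<omega>)) (b n k)) * (\<Prod>n\<in>J. pmf (poisson_law (L' \<omega>)) (y n))"
      by simp
  qed
  show ?thesis by (rule that[OF rp' law cd])
qed

section \<open>The main theorem\<close>

text \<open>By consistency an event about finitely many levels is, up to a null set, an event about
  one higher level. So the point masses at single levels determine the finite-dimensional laws, and
  these determine the law.\<close>

lemma alloc_law_eqI:
  assumes F: "random_feature_allocation M F" and G: "random_feature_allocation M' G"
    and eq: "\<And>N f. 1 \<le> N \<Longrightarrow> f \<in> feature_allocs N \<Longrightarrow>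
      measure M {\<omega>\<in>space M. F N \<omega> = f} = measure M' {\<omega>\<in>space M'. G N \<omega> = f}"
  shows "alloc_law M F = alloc_law M' G"
proof -
  have meas: "(\<lambda>\<omega>. \<lambda>N\<in>{1..}. H N \<omega>) \<in> K \<rightarrow>\<^sub>M PiM {1..} alloc_space"
    if "random_feature_allocation K H" for K :: "'c measure" and H
    using that by (intro measurable_restrict) (auto simp: random_feature_allocation_def)
  have fdd: "emeasure (alloc_law K H) (prod_emb {1..} alloc_space J (Pi\<^sub>E J A)) =
      emeasure (distr K (alloc_space N) (H N)) {f \<in> feature_allocs N. \<forall>j\<in>J. restrict_alloc j f \<in> A j}"
    if K: "random_feature_allocation K H" and J: "finite J" "J \<subseteq> {1..}" and A: "\<And>j. j \<in> J \<Longrightarrow> A j \<subseteq> feature_allocs j"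
      and N: "1 \<le> N" "\<And>j. j \<in> J \<Longrightarrow> j < N" for K :: "'c measure" and H J A N
  proof -
    have H: "H n \<in> K \<rightarrow>\<^sub>M alloc_space n" if "1 \<le> n" for n
      using K that by (auto simp: random_feature_allocation_def)
    have sets: "prod_emb {1..} alloc_space J (Pi\<^sub>E J A) \<in> sets (PiM {1..} alloc_space)"
      using J A by (intro sets_PiM_I) auto
    have "emeasure (alloc_law K H) (prod_emb {1..} alloc_space J (Pi\<^sub>E J A)) =
        emeasure K ((\<lambda>\<omega>. \<lambda>N\<in>{1..}. H N \<omega>) -` prod_emb {1..} alloc_space J (Pi\<^sub>E J A) \<inter> space K)"
      unfolding alloc_law_def by (rule emeasure_distr[OF meas[OF K] sets])
    also have "\<dots> = emeasure K (H N -` {f \<in> feature_allocs N. \<forall>j\<in>J. restrict_alloc j f \<in> A j} \<inter> space K)"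
    proof (rule emeasure_eq_AE)
      have "AE \<omega> in K. \<forall>j\<in>J. H j \<omega> = restrict_alloc j (H N \<omega>)"
        using K J N unfolding random_feature_allocation_def by (intro AE_finite_allI) auto
      then show "AE \<omega> in K. \<omega> \<in> (\<lambda>\<omega>. \<lambda>N\<in>{1..}. H N \<omega>) -` prod_emb {1..} alloc_space J (Pi\<^sub>E J A) \<inter> space K \<longleftrightarrow>
          \<omega> \<in> H N -` {f \<in> feature_allocs N. \<forall>j\<in>J. restrict_alloc j f \<in> A j} \<inter> space K"
        using AE_space
      proof eventually_elim
        case (elim \<omega>)
        have HN: "H n \<omega> \<in> feature_allocs n" if "1 \<le> n" for n
          using measurable_space[OF H[OF that] elim(2)] by simp
        have "(\<lambda>N\<in>{1..}. H N \<omega>) \<in> prod_emb {1..} alloc_space J (Pi\<^sub>E J A) \<longleftrightarrow> (\<forall>j\<in>J. H j \<omega> \<in> A j)"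
          using J HN by (auto simp: prod_emb_def PiE_iff extensional_def restrict_def)
        then show ?case using elim HN[OF N(1)] by simp
      qed
      show "(\<lambda>\<omega>. \<lambda>N\<in>{1..}. H N \<omega>) -` prod_emb {1..} alloc_space J (Pi\<^sub>E J A) \<inter> space K \<in> sets K"
        by (rule measurable_sets[OF meas[OF K] sets])
      show "H N -` {f \<in> feature_allocs N. \<forall>j\<in>J. restrict_alloc j f \<in> A j} \<inter> space K \<in> sets K"
        by (rule measurable_sets[OF H[OF N(1)]]) auto
    qed
    also have "\<dots> = emeasure (distr K (alloc_space N) (H N)) {f \<in> feature_allocs N. \<forall>j\<in>J. restrict_alloc j f \<in> A j}"
      by (rule emeasure_distr[symmetric, OF H[OF N(1)]]) auto
    finally show ?thesis .
  qed
  interpret M: prob_space M using F by (simp add: random_feature_allocation_def)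
  interpret M': prob_space M' using G by (simp add: random_feature_allocation_def)
  show ?thesis
  proof (rule measure_eqI_PiM_infinite[where I = "{1..}" and M = alloc_space])
    show "sets (alloc_law M F) = sets (PiM {1..} alloc_space)" "sets (alloc_law M' G) = sets (PiM {1..} alloc_space)"
      by (simp_all add: alloc_law_def)
    show "finite_measure (alloc_law M F)"
      unfolding alloc_law_def by (intro prob_space.finite_measure M.prob_space_distr meas[OF F])
    fix A :: "nat \<Rightarrow> nat set multiset set" and J :: "nat set"
    assume J: "finite J" "J \<subseteq> {1..}" and A: "\<And>j. j \<in> J \<Longrightarrow> A j \<in> sets (alloc_space j)"
    \<comment> \<open>Strictly above every level in \<open>J\<close>, as consistency relates
      different levels; the \<open>Suc\<close> also keeps it positive for empty
      \<open>J\<close>.\<close>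
    define N where "N = Suc (\<Sum>j\<in>J. j)"
    have N: "1 \<le> N" by (simp add: N_def)
    have NJ: "\<And>j. j \<in> J \<Longrightarrow> j < N"
      using member_le_sum[of _ J "\<lambda>j. j"] J by (simp add: N_def less_Suc_eq_le)
    have A': "\<And>j. j \<in> J \<Longrightarrow> A j \<subseteq> feature_allocs j" using A by simp
    have FN: "F N \<in> M \<rightarrow>\<^sub>M alloc_space N" and GN: "G N \<in> M' \<rightarrow>\<^sub>M alloc_space N"
      using F G by (auto simp: random_feature_allocation_def N_def)
    have "distr M (alloc_space N) (F N) = distr M' (alloc_space N) (G N)"
    proof (rule measure_eqI_countable[OF _ _ countable_feature_allocs])
      fix f assume f: "f \<in> feature_allocs N"
      have "F N -` {f} \<inter> space M = {\<omega>\<in>space M. F N \<omega> = f}" "G N -` {f} \<inter> space M' = {\<omega>\<in>space M'. G N \<omega> = f}"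
        by auto
      then show "emeasure (distr M (alloc_space N) (F N)) {f} = emeasure (distr M' (alloc_space N) (G N)) {f}"
        using f FN GN eq[OF _ f] by (simp add: emeasure_distr M.emeasure_eq_measure M'.emeasure_eq_measure N_def)
    qed simp_all
    then show "emeasure (alloc_law M F) (prod_emb {1..} alloc_space J (Pi\<^sub>E J A)) =
        emeasure (alloc_law M' G) (prod_emb {1..} alloc_space J (Pi\<^sub>E J A))"
      using fdd[OF F J A' N NJ] fdd[OF G J A' N NJ] by simp
  qed
qed

lemma alloc_law_eqI_pgf:
  assumes F: "random_feature_allocation M F" and G: "random_feature_allocation M' G"
    and eq: "\<And>N t. 1 \<le> N \<Longrightarrow> unit_weight t \<Longrightarrow>
      (\<integral>\<omega>. (\<Prod>A\<in>#F N \<omega>. t A) \<partial>M) = (\<integral>\<omega>. (\<Prod>A\<in>#G N \<omega>. t A) \<partial>M')"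
  shows "alloc_law M F = alloc_law M' G"
proof (rule alloc_law_eqI[OF F G])
  fix N f assume N: "1 \<le> (N::nat)" and f: "f \<in> feature_allocs N"
  have M: "prob_space M" and M': "prob_space M'"
    using F G by (auto simp: random_feature_allocation_def)
  have FN: "F N \<in> M \<rightarrow>\<^sub>M alloc_space N" and GN: "G N \<in> M' \<rightarrow>\<^sub>M alloc_space N"
    using F G N by (auto simp: random_feature_allocation_def)
  show "measure M {\<omega>\<in>space M. F N \<omega> = f} = measure M' {\<omega>\<in>space M'. G N \<omega> = f}"
  proof (rule pgf_unique[OF M M' finite_feature_types[of N]])
    fix t :: "nat set \<Rightarrow> real" assume t: "\<forall>A. 0 \<le> t A \<and> t A \<le> 1"
    let ?t = "\<lambda>A. if A = {} then 1 else t A"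
    have congr: "(\<Prod>A\<in>#g. t A) = (\<Prod>A\<in>#g. ?t A)" if "g \<in> feature_allocs N" for g
      using that by (intro arg_cong[where f = prod_mset] image_mset_cong) (auto simp: feature_allocs_def)
    have "(\<integral>\<omega>. (\<Prod>A\<in>#F N \<omega>. t A) \<partial>M) = (\<integral>\<omega>. (\<Prod>A\<in>#F N \<omega>. ?t A) \<partial>M)"
      using measurable_space[OF FN] by (intro Bochner_Integration.integral_cong refl congr) simp
    also have "\<dots> = (\<integral>\<omega>. (\<Prod>A\<in>#G N \<omega>. ?t A) \<partial>M')"
      using t by (intro eq[OF N]) (auto simp: unit_weight_def)
    also have "\<dots> = (\<integral>\<omega>. (\<Prod>A\<in>#G N \<omega>. t A) \<partial>M')"
      using measurable_space[OF GN] by (intro Bochner_Integration.integral_cong refl congr[symmetric]) simp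
    finally show "(\<integral>\<omega>. (\<Prod>A\<in>#F N \<omega>. t A) \<partial>M) = (\<integral>\<omega>. (\<Prod>A\<in>#G N \<omega>. t A) \<partial>M')" .
  qed (use FN GN f in \<open>simp_all add: feature_allocs_alt\<close>)
qed

text \<open>The integrand is a measurable function of the parameters, so only their joint law
  matters. This carries the generating function from the space of \<open>F\<close> to the one that
  has draws.\<close>

lemma ffm_pgf_integral_params:
  assumes rp: "random_params M V L" and rp': "random_params M' V' L'"
    and law: "distr M' param_space (params V' L') = distr M param_space (params V L)"
  shows "(\<integral>\<omega>. ffm_pgf m t (\<lambda>k. V' k \<omega>) (L' \<omega>) \<partial>M') = (\<integral>\<omega>. ffm_pgf m t (\<lambda>k. V k \<omega>) (L \<omega>) \<partial>M)"
proof -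
  have [measurable]: "(\<lambda>p. fst p k) \<in> borel_measurable param_space" for k
    by (rule measurable_compose[OF measurable_fst measurable_component_singleton]) simp
  have meas: "(\<lambda>p. ffm_pgf m t (fst p) (snd p)) \<in> borel_measurable param_space"
    unfolding ffm_pgf_def bernoulli_weight_def by measurable
  show ?thesis
    using integral_distr[OF params_measurable[OF rp] meas] integral_distr[OF params_measurable[OF rp'] meas]
    by (simp add: law)
qed

text \<open>The first conjunct provides draws for every joint law of the parameters, so the second
  speaks of models that exist. Exchangeability in the second is deduced from the EFPF.\<close>

theorem mainTheorem2:
  shows
    "(\<forall>(M :: 'a measure) V L. random_params M V L \<longrightarrow>
       (\<exists>(M' :: ((nat \<Rightarrow> real) \<times> real \<times> (nat \<Rightarrow> nat \<Rightarrow> bool) \<times> (nat \<Rightarrow> nat)) measure) V' L' B Y.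
         random_params M' V' L' \<and>
         distr M' param_space (params V' L') = distr M param_space (params V L) \<and>
         conditional_draws M' V' L' B Y)) \<and>
     (\<forall>(M :: 'b measure) V L B Y. random_params M V L \<and> conditional_draws M V L B Y \<longrightarrow>
       random_feature_allocation M (generated_alloc B Y) \<and>
       exchangeable_alloc M (generated_alloc B Y) \<and>
       has_EFPF M (generated_alloc B Y)) \<and>
     (\<forall>(M :: 'c measure) F. random_feature_allocation M F \<and> has_EFPF M F \<longrightarrow>
       (\<exists>(M' :: ((nat \<Rightarrow> real) \<times> real \<times> (nat \<Rightarrow> nat \<Rightarrow> bool) \<times> (nat \<Rightarrow> nat)) measure) V L B Y.
         random_params M' V L \<and> conditional_draws M' V L B Y \<and>
         alloc_law M F = alloc_law M' (generated_alloc B Y)))"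
proof (intro conjI allI impI)
  fix M :: "'a measure" and V L
  assume rp: "random_params M V L"
  obtain M' :: "((nat \<Rightarrow> real) \<times> real \<times> (nat \<Rightarrow> nat \<Rightarrow> bool) \<times> (nat \<Rightarrow> nat)) measure" and V' L' B Y
    where "random_params M' V' L'" "distr M' param_space (params V' L') = distr M param_space (params V L)"
      "conditional_draws M' V' L' B Y"
    by (rule exists_conditional_draws[OF rp])
  then show "\<exists>(M' :: ((nat \<Rightarrow> real) \<times> real \<times> (nat \<Rightarrow> nat \<Rightarrow> bool) \<times> (nat \<Rightarrow> nat)) measure) V' L' B Y.
      random_params M' V' L' \<and>
      distr M' param_space (params V' L') = distr M param_space (params V L) \<and>
      conditional_draws M' V' L' B Y" by blast
next
  fix M :: "'b measure" and V L B Y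
  assume "random_params M V L \<and> conditional_draws M V L B Y"
  then have rp: "random_params M V L" and cd: "conditional_draws M V L B Y" by auto
  show rfa: "random_feature_allocation M (generated_alloc B Y)"
    by (rule generated_alloc_random_feature_allocation[OF rp cd])
  show ef: "has_EFPF M (generated_alloc B Y)"
    by (rule generated_alloc_EFPF[OF rp cd])
  show "exchangeable_alloc M (generated_alloc B Y)"
    by (rule EFPF_imp_exchangeable[OF rfa ef])
next
  fix M :: "'c measure" and F
  assume "random_feature_allocation M F \<and> has_EFPF M F"
  then have rfa: "random_feature_allocation M F" and ef: "has_EFPF M F" by auto
  \<comment> \<open>These parameters are functions on the space of \<open>F\<close>, where suitable
    draws need not exist; only their joint law is transferred to a space with draws.\<close>
  obtain V L where rp: "random_params M V L"
    and pgf: "\<And>m t. 1 \<le> m \<Longrightarrow> unit_weight t \<Longrightarrow>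
      (\<integral>\<omega>. (\<Prod>A\<in>#F m \<omega>. t A) \<partial>M) = (\<integral>\<omega>. ffm_pgf m t (\<lambda>k. V k \<omega>) (L \<omega>) \<partial>M)"
    using EFPF_imp_params[OF rfa ef] by blast
  obtain M' :: "((nat \<Rightarrow> real) \<times> real \<times> (nat \<Rightarrow> nat \<Rightarrow> bool) \<times> (nat \<Rightarrow> nat)) measure" and V' L' B Y
    where rp': "random_params M' V' L'"
      and law: "distr M' param_space (params V' L') = distr M param_space (params V L)"
      and cd: "conditional_draws M' V' L' B Y"
    by (rule exists_conditional_draws[OF rp])
  have "alloc_law M F = alloc_law M' (generated_alloc B Y)"
  proof (rule alloc_law_eqI_pgf[OF rfa generated_alloc_random_feature_allocation[OF rp' cd]])
    fix N t assume N: "1 \<le> (N :: nat)" and t: "unit_weight t"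
    show "(\<integral>\<omega>. (\<Prod>A\<in>#F N \<omega>. t A) \<partial>M) = (\<integral>\<omega>. (\<Prod>A\<in>#generated_alloc B Y N \<omega>. t A) \<partial>M')"
      unfolding pgf[OF N t] generated_alloc_pgf[OF rp' cd t generated_alloc_measurable[OF cd]]
      by (rule ffm_pgf_integral_params[OF rp rp' law, symmetric])
  qed
  with rp' cd show "\<exists>(M' :: ((nat \<Rightarrow> real) \<times> real \<times> (nat \<Rightarrow> nat \<Rightarrow> bool) \<times> (nat \<Rightarrow> nat)) measure) V L B Y.
      random_params M' V L \<and> conditional_draws M' V L B Y \<and>
      alloc_law M F = alloc_law M' (generated_alloc B Y)" by blast
qed

end
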